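(* Let $K$ be a field, let $S = K[x_1,\dots,x_6]$ be the polynomial ring, let $f_1,\dots,f_6 \in S_2$ form a regular sequence of quadrics, and let $g,h \in S_2$ be two quadrics such that $$\dim_K (f_1,\dots,f_6,g,h)_2 = 8.$$ Then $$\dim_K (f_1,\dots,f_6,g,h)_3 \;\geq\; \dim_K (x_1^2,\dots,x_6^2,\, x_1x_2,\, x_1x_3)_3 \;=\; 43.$$
   Context: $S=K[x_1,\dots,x_6]$ carries the standard grading ($\deg x_i = 1$). $S_t$ denotes the $K$-vector space of homogeneous polynomials of degree $t$ (together with $0$), and for a homogeneous ideal $J \subseteq S$, $J_t = J \cap S_t$ denotes its degree-$t$ component. $(u_1,\dots,u_r)$ denotes the ideal of $S$ generated by $u_1,\dots,u_r$. A quadric is an element of $S_2$. *)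

theory Defs
  imports Complex_Main "HOL-Library.Poly_Mapping" "HOL-Library.Numeral_Type"
begin

text \<open>
  A polynomial is a finitely supported map from monomials to coefficients, and a monomial
  is a finitely supported map from indeterminates to exponents. The ring structure is the
  convolution product of \<^theory>\<open>HOL-Library.Poly_Mapping\<close>.
\<close>

type_synonym ('x, 'k) mpoly = "('x \<Rightarrow>\<^sub>0 nat) \<Rightarrow>\<^sub>0 'k"

definition Var :: "'x \<Rightarrow> ('x, 'k::comm_ring_1) mpoly" where
  "Var i = Poly_Mapping.single (Poly_Mapping.single i 1) 1"

definition smult :: "'k::comm_ring_1 \<Rightarrow> ('x, 'k) mpoly \<Rightarrow> ('x, 'k) mpoly" where
  "smult c p = Poly_Mapping.single 0 c * p"

global_interpretation mpoly: vector_space "smult :: 'k::field \<Rightarrow> ('x, 'k) mpoly \<Rightarrow> ('x, 'k) mpoly"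
  by unfold_locales
    (simp_all add: smult_def distrib_left distrib_right single_add mult_single flip: mult.assoc)

definition mdeg :: "('x \<Rightarrow>\<^sub>0 nat) \<Rightarrow> nat" where
  "mdeg m = (\<Sum>i\<in>Poly_Mapping.keys m. Poly_Mapping.lookup m i)"

definition homogeneous_part :: "nat \<Rightarrow> ('x, 'k::comm_ring_1) mpoly set" where
  "homogeneous_part t = {p. \<forall>m\<in>Poly_Mapping.keys p. mdeg m = t}"

lemma module_times: "module ((*) :: 'a::comm_ring_1 \<Rightarrow> 'a \<Rightarrow> 'a)"
  by unfold_locales (simp_all add: distrib_left distrib_right mult.assoc)

text \<open>The ideal generated by a set is its span in the ring viewed as a module over itself.\<close>

definition ideal_gen :: "'a::comm_ring_1 set \<Rightarrow> 'a set" where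
  "ideal_gen A = module.span (*) A"

definition regular_sequence :: "'a::comm_ring_1 list \<Rightarrow> bool" where
  "regular_sequence fs \<longleftrightarrow>
     (\<forall>i<length fs. \<forall>p. fs ! i * p \<in> ideal_gen (set (take i fs)) \<longrightarrow> p \<in> ideal_gen (set (take i fs))) \<and>
     ideal_gen (set fs) \<noteq> UNIV"

text \<open>
  The six indeterminates are indexed by the six-element type \<^typ>\<open>6\<close>, in which numerals are
  read modulo 6: \<open>1, \<dots>, 5\<close> are distinct and the sixth index is \<open>6 = 0\<close>.
\<close>

type_synonym 'k poly6 = "(6, 'k) mpoly"

end

theory Submission
  imports "HOL-Algebra.Algebraic_Closure_Type" "HOL-Library.Product_Plus" Defs
begin

text \<open>
  Let \<open>V = S\<^sub>1\<close> and let \<open>W\<close> be the space of pairs \<open>(m, m')\<close> in \<open>V \<times> V\<close> with \<open>m g + m' h \<in> (f)\<close>.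
  As \<open>dim (f)\<^sub>3 = 36\<close>, the claim is \<open>dim W \<le> 5\<close>. Exactness of the Koszul complexes of \<open>f\<close> and of
  independent linear forms implies that a form of degree \<open>t\<close> outside \<open>(f)\<close> is annihilated modulo
  \<open>(f)\<close> by at most \<open>t\<close> independent linear forms.

  After extending scalars to the algebraic closure, \<open>dim W \<ge> 6\<close> gives, by an eigenvector argument,
  a linear form \<open>l \<noteq> 0\<close> annihilating some nonzero \<open>q\<close> in the pencil of \<open>g\<close> and \<open>h\<close>. If \<open>l\<close> does not
  annihilate another member \<open>h\<close>, then \<open>V q\<close> contributes at least \<open>6 - 2\<close> dimensions and \<open>V h\<close>,
  seen after multiplication by \<open>l\<close>, at least \<open>6 - 3\<close> more.

  If \<open>l\<close> annihilates the whole pencil, write \<open>l g = \<Sum> a\<^sub>i f\<^sub>i\<close> and \<open>l h = \<Sum> b\<^sub>i f\<^sub>i\<close>. For suitable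
  scalars \<open>c\<^sub>i\<close> the forms \<open>l\<close>, \<open>p = \<Sum> c\<^sub>i a\<^sub>i\<close>, \<open>r = \<Sum> c\<^sub>i b\<^sub>i\<close> are independent, and the Koszul
  relations attached to the elements of \<open>W\<close> yield three independent quadrics in the span of \<open>f\<close> that
  lie in \<open>(l, p, r)\<close> and are orthogonal to \<open>c\<close>. Completing them by \<open>f'\<^sub>4, f'\<^sub>5, f'\<^sub>6\<close> to a basis of
  this span, a singular \<open>3 \<times> 3\<close> matrix of quadrics shows that the cube of \<open>f'\<^sub>6\<close> lies in
  \<open>(l, p, r, f'\<^sub>4, f'\<^sub>5)\<close>. But \<open>f'\<^sub>6\<close> is a nonzerodivisor modulo this ideal, again by exactness of
  Koszul complexes.
\<close>

section \<open>Koszul complexes of regular sequences in graded rings\<close>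

text \<open>The obstacle is the case where \<open>l\<close> annihilates the whole pencil:
  multiplication by \<open>l\<close> then no longer separates \<open>V h\<close> from
  \<open>V g\<close>. What replaces it is that expanding \<open>l (m g + m' h)\<close> in two ways,
  with \<open>m g + m' h = \<Sum> e_k f_k\<close>, gives a syzygy with entries
  \<open>m a_k + m' b_k - l e_k\<close>. These are quadrics, so by Koszul exactness they come from a
  scalar alternating matrix applied to \<open>f\<close>. Contracting with \<open>c\<close> gives
  \<open>m p + m' r\<close> modulo \<open>l\<close> on one side and, on the other, a combination of
  \<open>f\<close> whose coefficient vector is orthogonal to \<open>c\<close> because the matrix is
  alternating. Three such quadrics can be chosen independent, since the pairs with
  \<open>m p + m' r\<close> in \<open>(l)\<close> span at most 3 of at least 6 dimensions.
  Contracting the same matrices with vectors dual to the three quadrics gives the singular matrix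
  with entries \<open>m_i A_j + m'_i B_j\<close>; alternation makes it minus \<open>f'_6\<close>
  times the identity modulo \<open>(l, p, r, f'_4, f'_5)\<close>.\<close>

locale graded_ring =
  fixes H :: "int \<Rightarrow> 'a::comm_ring_1 set"
  assumes zero_H: "0 \<in> H d"
    and add_H: "x \<in> H d \<Longrightarrow> y \<in> H d \<Longrightarrow> x + y \<in> H d"
    and uminus_H: "x \<in> H d \<Longrightarrow> - x \<in> H d"
    and mult_H: "x \<in> H d \<Longrightarrow> y \<in> H e \<Longrightarrow> x * y \<in> H (d + e)"
    and one_H: "1 \<in> H 0"
    and neg_H: "d < 0 \<Longrightarrow> x \<in> H d \<Longrightarrow> x = 0"
begin

lemma diff_H: "x \<in> H d \<Longrightarrow> y \<in> H d \<Longrightarrow> x - y \<in> H d"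
  using add_H[of x d "- y"] uminus_H by simp

lemma sum_H: "(\<And>i. i \<in> I \<Longrightarrow> f i \<in> H d) \<Longrightarrow> sum f I \<in> H d"
  by (induction I rule: infinite_finite_induct) (auto intro: zero_H add_H)

lemma mult_H': "x \<in> H d \<Longrightarrow> y \<in> H e \<Longrightarrow> d + e = c \<Longrightarrow> x * y \<in> H c"
  using mult_H by blast

lemma sign_H: "x \<in> H d \<Longrightarrow> (-1) ^ n * x \<in> H d"
  by (induction n) (auto intro: uminus_H)

text \<open>For \<open>F 0, \<dots>, F (n - 1)\<close> homogeneous of degree \<open>e\<close>, \<open>gspan F n e d\<close> is the part of degree \<open>d\<close>
  of the ideal they generate. Degrees are integers so that shifts below \<open>0\<close> give zero
  coefficients.\<close>

definition gspan :: "(nat \<Rightarrow> 'a) \<Rightarrow> nat \<Rightarrow> int \<Rightarrow> int \<Rightarrow> 'a set" where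
  "gspan F n e d = {p. \<exists>v. (\<forall>j. v j \<in> H (d - e)) \<and> p = (\<Sum>j<n. v j * F j)}"

definition gregular :: "(nat \<Rightarrow> 'a) \<Rightarrow> nat \<Rightarrow> int \<Rightarrow> bool" where
  "gregular F n e \<longleftrightarrow> (\<forall>i<n. F i \<in> H e) \<and>
     (\<forall>i<n. \<forall>d. \<forall>p\<in>H d. F i * p \<in> gspan F i e (d + e) \<longrightarrow> p \<in> gspan F i e d)"

lemma gspanI:
  assumes "\<And>j. j < n \<Longrightarrow> v j \<in> H (d - e)"
  shows "(\<Sum>j<n. v j * F j) \<in> gspan F n e d"
  unfolding gspan_def
  by (intro CollectI exI[of _ "\<lambda>j. if j < n then v j else 0"]) (auto simp: zero_H assms)

lemma gspanE:
  assumes "p \<in> gspan F n e d"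
  obtains v where "\<And>j. v j \<in> H (d - e)" "p = (\<Sum>j<n. v j * F j)"
  using assms unfolding gspan_def by blast

lemma gspan_0 [simp]: "gspan F 0 e d = {0}"
  unfolding gspan_def by (auto intro!: exI[of _ "\<lambda>_. 0"] zero_H)

lemma gspan_zero: "0 \<in> gspan F n e d"
  using gspanI[of n "\<lambda>_. 0" d e F] by (simp add: zero_H)

lemma gspan_add: "x \<in> gspan F n e d \<Longrightarrow> y \<in> gspan F n e d \<Longrightarrow> x + y \<in> gspan F n e d"
proof (elim gspanE)
  fix v w assume "\<And>j. v j \<in> H (d - e)" "x = (\<Sum>j<n. v j * F j)"
    "\<And>j. w j \<in> H (d - e)" "y = (\<Sum>j<n. w j * F j)"
  then show ?thesis using gspanI[of n "\<lambda>j. v j + w j" d e F]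
    by (simp add: add_H sum.distrib algebra_simps)
qed

lemma gspan_mult: "x \<in> gspan F n e d \<Longrightarrow> y \<in> H c \<Longrightarrow> y * x \<in> gspan F n e (d + c)"
proof (elim gspanE)
  fix v assume y: "y \<in> H c" and v: "\<And>j. v j \<in> H (d - e)" "x = (\<Sum>j<n. v j * F j)"
  have "y * v j \<in> H (d + c - e)" for j by (rule mult_H'[OF y v(1)]) simp
  then show ?thesis using gspanI[of n "\<lambda>j. y * v j" "d + c" e F] v
    by (simp add: sum_distrib_left algebra_simps)
qed

lemma gspan_mult': "x \<in> gspan F n e d \<Longrightarrow> y \<in> H c \<Longrightarrow> d + c = d' \<Longrightarrow> y * x \<in> gspan F n e d'"
  using gspan_mult by blast

lemma gspan_uminus: "x \<in> gspan F n e d \<Longrightarrow> - x \<in> gspan F n e d"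
  using gspan_mult[of x F n e d "-1" 0] uminus_H[OF one_H] by simp

lemma gspan_sum: "(\<And>i. i \<in> I \<Longrightarrow> f i \<in> gspan F n e d) \<Longrightarrow> sum f I \<in> gspan F n e d"
  by (induction I rule: infinite_finite_induct) (auto intro: gspan_zero gspan_add)

lemma gspan_sign: "x \<in> gspan F n e d \<Longrightarrow> (-1) ^ m * x \<in> gspan F n e d"
  by (induction m) (auto intro: gspan_uminus)

lemma gspan_mono_Suc: "x \<in> gspan F n e d \<Longrightarrow> x \<in> gspan F (Suc n) e d"
proof (elim gspanE)
  fix v assume "\<And>j. v j \<in> H (d - e)" "x = (\<Sum>j<n. v j * F j)"
  then show ?thesis using gspanI[of "Suc n" "\<lambda>j. if j < n then v j else 0" d e F]
    by (simp add: zero_H)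
qed

lemma gspan_gen:
  assumes "i < n" "y \<in> H (d - e)"
  shows "y * F i \<in> gspan F n e d"
proof -
  have "(\<Sum>j<n. (if j = i then y else 0) * F j) = (\<Sum>j<n. if j = i then y * F i else 0)"
    by (rule sum.cong) auto
  also have "\<dots> = y * F i" using assms by simp
  finally show ?thesis using gspanI[of n "\<lambda>j. if j = i then y else 0" d e F] assms
    by (auto simp: zero_H)
qed

lemma gspan_H: "(\<And>i. i < n \<Longrightarrow> F i \<in> H e) \<Longrightarrow> x \<in> gspan F n e d \<Longrightarrow> x \<in> H d"
  by (elim gspanE) (auto intro!: sum_H mult_H')

lemma gspan_SucE:
  assumes "x \<in> gspan F (Suc n) e d"
  obtains y a where "y \<in> gspan F n e d" "a \<in> H (d - e)" "x = y + a * F n"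
  using assms by (elim gspanE) (auto intro!: gspanI)

lemma gregular_prefix: "gregular F n e \<Longrightarrow> m \<le> n \<Longrightarrow> gregular F m e"
  unfolding gregular_def by auto

lemma gregularD:
  "gregular F n e \<Longrightarrow> i < n \<Longrightarrow> p \<in> H d \<Longrightarrow> F i * p \<in> gspan F i e (d + e) \<Longrightarrow> p \<in> gspan F i e d"
  unfolding gregular_def by auto

lemma gregular_H: "gregular F n e \<Longrightarrow> i < n \<Longrightarrow> F i \<in> H e"
  unfolding gregular_def by auto

subsection \<open>Koszul cochains\<close>

text \<open>A cochain assigns ring elements to finite sets of indices; only its values on
  \<open>p\<close>-element subsets of \<open>{..<k}\<close> matter for the \<open>p\<close>-th cohomology of \<open>k\<close> elements.\<close>

definition kd :: "(nat \<Rightarrow> 'a) \<Rightarrow> (nat set \<Rightarrow> 'a) \<Rightarrow> nat set \<Rightarrow> 'a" where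
  "kd F \<omega> A = (\<Sum>j\<in>A. (-1) ^ card {i\<in>A. i < j} * (F j * \<omega> (A - {j})))"

lemma kd_diff: "kd F (\<lambda>A. \<omega> A - \<eta> A) A = kd F \<omega> A - kd F \<eta> A"
  by (simp add: kd_def algebra_simps sum_subtractf)

lemma kd_add: "kd F (\<lambda>A. \<omega> A + \<eta> A) A = kd F \<omega> A + kd F \<eta> A"
  by (simp add: kd_def algebra_simps sum.distrib)

lemma kd_mult: "kd F (\<lambda>A. c * \<omega> A) A = c * kd F \<omega> A"
  by (simp add: kd_def algebra_simps sum_distrib_left)

lemma kd_H:
  assumes "\<And>j. j \<in> A \<Longrightarrow> F j \<in> H a" "\<And>B. \<omega> B \<in> H t"
  shows "kd F \<omega> A \<in> H (t + a)"
  unfolding kd_def by (intro sum_H sign_H mult_H'[OF assms]) auto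

lemma kd_cong: "(\<And>j. j \<in> A \<Longrightarrow> \<omega> (A - {j}) = \<eta> (A - {j})) \<Longrightarrow> kd F \<omega> A = kd F \<eta> A"
  by (simp add: kd_def)

text \<open>All of \<open>B\<close> lies below \<open>k\<close>, so the summand for \<open>k\<close>
  carries the sign \<open>(-1) ^ card B\<close>. This is the mapping-cone description of the Koszul
  complex, on which the inductions over the last index rest.\<close>

lemma kd_insert:
  assumes B: "B \<subseteq> {..<k}"
  shows "kd F \<omega> (insert k B) = kd F (\<lambda>C. \<omega> (insert k C)) B + (-1) ^ card B * (F k * \<omega> B)"
proof -
  have fB: "finite B" using B finite_subset by blast
  have k: "k \<notin> B" using B by auto
  have 1: "{i \<in> insert k B. i < k} = B" using B by auto
  have 2: "{i \<in> insert k B. i < j} = {i \<in> B. i < j}" if "j \<in> B" for j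
    using that B by auto
  have 3: "insert k B - {j} = insert k (B - {j})" if "j \<in> B" for j
    using that k by auto
  have 4: "insert k B - {k} = B" using k by auto
  have "(\<Sum>j\<in>B. (-1) ^ card {i \<in> insert k B. i < j} * (F j * \<omega> (insert k B - {j}))) =
      (\<Sum>j\<in>B. (-1) ^ card {i \<in> B. i < j} * (F j * \<omega> (insert k (B - {j}))))"
    by (rule sum.cong) (simp_all only: 2 3)
  then show ?thesis unfolding kd_def sum.insert[OF fB k] 1 4 by (simp add: add.commute)
qed

lemma kd_kd:
  assumes "finite A"
  shows "kd F (kd F \<omega>) A = 0"
proof -
  have "finite A \<Longrightarrow> \<forall>\<omega>. kd F (kd F \<omega>) A = 0"
  proof (induction A rule: finite_linorder_max_induct)
    case empty
    then show ?case by (simp add: kd_def)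
  next
    case (insert k B)
    have B: "B \<subseteq> {..<k}" using insert by auto
    show ?case
    proof
      fix \<omega>
      have "kd F (\<lambda>C. kd F \<omega> (insert k C)) B =
          kd F (\<lambda>C. kd F (\<lambda>C. \<omega> (insert k C)) C + (-1) ^ card C * (F k * \<omega> C)) B"
        by (rule kd_cong, rule kd_insert) (use B in auto)
      also have "\<dots> = kd F (\<lambda>C. (-1) ^ card C * (F k * \<omega> C)) B"
        using insert.IH by (simp add: kd_add)
      \<comment> \<open>Removing one element from \<open>B\<close> flips the sign; this is what
        makes the two mixed terms cancel.\<close>
      also have "\<dots> = kd F (\<lambda>C. - ((-1) ^ card B * F k) * \<omega> C) B"
      proof (rule kd_cong)
        fix j assume j: "j \<in> B"
        then have "card B = Suc (card (B - {j}))" using insert.hyps(1)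
          by (metis card_Suc_Diff1)
        then show "(- 1) ^ card (B - {j}) * (F k * \<omega> (B - {j})) = - ((- 1) ^ card B * F k) * \<omega> (B - {j})"
          by (simp add: algebra_simps)
      qed
      also have "\<dots> = - ((-1) ^ card B * F k) * kd F \<omega> B" by (rule kd_mult)
      finally show "kd F (kd F \<omega>) (insert k B) = 0"
        using kd_insert[OF B, of F "kd F \<omega>"] by (simp add: algebra_simps)
    qed
  qed
  with assms show ?thesis by blast
qed

text \<open>Induction on \<open>k\<close>, splitting a cochain into its values on sets without and
  with the last index. On sets without it the restriction is a coboundary by induction, except in
  top position \<open>p = k\<close>: there the cocycle condition says that
  \<open>F k * \<omega> {..<k}\<close> lies in the ideal of the earlier elements, and regularity
  applies. The values on sets with the last index, corrected by that primitive, form a cocycle one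
  position lower.\<close>

lemma koszul_exact:
  assumes "gregular F k e" "p < k" "\<And>A. \<omega> A \<in> H t"
    and "\<And>A. A \<subseteq> {..<k} \<Longrightarrow> card A = Suc p \<Longrightarrow> kd F \<omega> A = 0"
  shows "\<exists>\<gamma>. (\<forall>A. \<gamma> A \<in> H (t - e)) \<and> (\<forall>A\<subseteq>{..<k}. card A = p \<longrightarrow> \<omega> A = kd F \<gamma> A)"
  using assms
proof (induction k arbitrary: p \<omega> t)
  case 0
  then show ?case by simp
next
  case (Suc k)
  note reg = Suc.prems(1) and \<omega>H = Suc.prems(3) and cyc = Suc.prems(4)
  have reg': "gregular F k e" using gregular_prefix[OF reg] by simp
  have Fk: "F k \<in> H e" using gregular_H[OF reg] by simp
  obtain \<gamma>0 where \<gamma>0: "\<And>A. \<gamma>0 A \<in> H (t - e)" "\<And>A. A \<subseteq> {..<k} \<Longrightarrow> card A = p \<Longrightarrow> \<omega> A = kd F \<gamma>0 A"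
  proof (cases "p < k")
    case True
    have "\<And>A. A \<subseteq> {..<k} \<Longrightarrow> card A = Suc p \<Longrightarrow> kd F \<omega> A = 0" by (rule cyc) auto
    from Suc.IH[OF reg' True \<omega>H this] obtain \<gamma> where
      "(\<forall>A. \<gamma> A \<in> H (t - e)) \<and> (\<forall>A\<subseteq>{..<k}. card A = p \<longrightarrow> \<omega> A = kd F \<gamma> A)" by blast
    then show ?thesis by (intro that[of \<gamma>]) auto
  next
    case False
    then have p: "p = k" using Suc.prems by simp
    have "kd F \<omega> (insert k {..<k}) = 0" by (rule cyc) (auto simp: p)
    then have "(-1) ^ k * (F k * \<omega> {..<k}) = - kd F (\<lambda>C. \<omega> (insert k C)) {..<k}"
      by (subst (asm) kd_insert) (auto simp: eq_neg_iff_add_eq_0 add.commute)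
    then have "(-1) ^ k * ((-1) ^ k * (F k * \<omega> {..<k})) = (-1) ^ k * (- kd F (\<lambda>C. \<omega> (insert k C)) {..<k})"
      by simp
    then have "F k * \<omega> {..<k} = (-1) ^ k * (- kd F (\<lambda>C. \<omega> (insert k C)) {..<k})"
      by simp
    moreover have "kd F (\<lambda>C. \<omega> (insert k C)) {..<k} \<in> gspan F k e (t + e)"
    proof -
      have "(- 1) ^ n * (F j * \<omega> B) \<in> gspan F k e (t + e)" if "j < k" for n B j
        using gspan_gen[OF that, of "\<omega> B" "t + e" e F] \<omega>H
        by (intro gspan_sign) (simp add: mult.commute)
      then show ?thesis unfolding kd_def by (intro gspan_sum) auto
    qed
    ultimately have "F k * \<omega> {..<k} \<in> gspan F k e (t + e)"
      by (simp only: gspan_sign gspan_uminus)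
    then have "\<omega> {..<k} \<in> gspan F k e t" by (intro gregularD[OF reg _ \<omega>H]) auto
    then obtain v where v: "\<And>j. v j \<in> H (t - e)" "\<omega> {..<k} = (\<Sum>j<k. v j * F j)"
      by (elim gspanE) blast
    \<comment> \<open>The sign \<open>(-1) ^ j\<close> cancels the one in \<open>kd\<close> at the
      index \<open>j\<close>, so the coboundary on the full set is the given combination.\<close>
    define \<gamma>0 where "\<gamma>0 B = (\<Sum>j<k. if B = {..<k} - {j} then (-1) ^ j * v j else 0)" for B
    have "kd F \<gamma>0 {..<k} = (\<Sum>j<k. v j * F j)"
      unfolding kd_def
    proof (rule sum.cong)
      fix j assume j: "j \<in> {..<k}"
      have 1: "{i \<in> {..<k}. i < j} = {..<j}" using j by auto
      have "\<gamma>0 ({..<k} - {j}) = (\<Sum>i<k. if i = j then (-1) ^ j * v j else 0)"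
        unfolding \<gamma>0_def using j by (intro sum.cong) auto
      then have "\<gamma>0 ({..<k} - {j}) = (-1) ^ j * v j" using j by simp
      then show "(- 1) ^ card {i \<in> {..<k}. i < j} * (F j * \<gamma>0 ({..<k} - {j})) = v j * F j"
        unfolding 1 by (simp add: algebra_simps power_add[symmetric] flip: mult_2)
    qed simp
    moreover have "A = {..<k}" if "A \<subseteq> {..<k}" "card A = p" for A
      using that p card_subset_eq[of "{..<k}" A] by simp
    moreover have "\<gamma>0 A \<in> H (t - e)" for A
      unfolding \<gamma>0_def by (intro sum_H) (auto simp: zero_H intro!: sign_H v)
    ultimately show ?thesis using that v by metis
  qed
  show ?case
  proof (cases p)
    case 0
    show ?thesis
    proof (intro exI[of _ \<gamma>0] conjI allI impI \<gamma>0(1))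
      fix A assume A: "A \<subseteq> {..<Suc k}" "card A = p"
      then have "finite A" using finite_subset by blast
      then have "A = {}" using A 0 by simp
      then show "\<omega> A = kd F \<gamma>0 A" using \<gamma>0(2)[of A] 0 by simp
    qed
  next
    case (Suc q)
    \<comment> \<open>The correction compensates the \<open>F k\<close> term of
      \<open>kd_insert\<close>, which makes \<open>\<omega>1\<close> a cocycle for the first
      \<open>k\<close> elements.\<close>
    define \<omega>1 where "\<omega>1 B = \<omega> (insert k B) + (-1) ^ p * (F k * \<gamma>0 B)" for B
    have "kd F \<omega>1 B = 0" if B: "B \<subseteq> {..<k}" "card B = Suc q" for B
    proof -
      have fB: "finite B" using B(1) finite_subset by auto
      have "kd F \<omega> (insert k B) = 0" using B fB Suc by (intro cyc) (auto simp: card_insert_if)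
      then show ?thesis
        unfolding kd_insert[OF B(1)] using \<gamma>0(2)[OF B(1)] B Suc
        by (simp add: \<omega>1_def[abs_def] kd_diff kd_mult flip: mult.assoc)
    qed
    moreover have "\<omega>1 B \<in> H t" for B
      unfolding \<omega>1_def by (intro add_H \<omega>H sign_H mult_H'[OF Fk \<gamma>0(1)]) simp
    ultimately obtain \<gamma>1 where \<gamma>1: "\<And>A. \<gamma>1 A \<in> H (t - e)"
      "\<And>A. A \<subseteq> {..<k} \<Longrightarrow> card A = q \<Longrightarrow> \<omega>1 A = kd F \<gamma>1 A"
      using Suc.IH[OF reg', of q \<omega>1 t] Suc.prems(2) Suc by auto
    define \<gamma> where "\<gamma> A = (if k \<in> A then \<gamma>1 (A - {k}) else \<gamma>0 A)" for A
    show ?thesis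
    proof (intro exI[of _ \<gamma>] conjI allI impI)
      show "\<gamma> A \<in> H (t - e)" for A by (simp add: \<gamma>_def \<gamma>0 \<gamma>1)
      fix A assume A: "A \<subseteq> {..<Suc k}" "card A = p"
      show "\<omega> A = kd F \<gamma> A"
      proof (cases "k \<in> A")
        case False
        then have Ak: "A \<subseteq> {..<k}" using A by (auto simp: less_Suc_eq)
        have "kd F \<gamma> A = kd F \<gamma>0 A" by (rule kd_cong) (use False in \<open>auto simp: \<gamma>_def\<close>)
        then show ?thesis using \<gamma>0(2)[OF Ak A(2)] by simp
      next
        case True
        define B where "B = A - {k}"
        have B: "B \<subseteq> {..<k}" "A = insert k B" "k \<notin> B" using A True by (auto simp: B_def less_Suc_eq)
        have fB: "finite B" using B(1) finite_subset by auto
        have cB: "card B = q" using A B fB Suc by (simp add: card_insert_if)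
        have "kd F (\<lambda>C. \<gamma> (insert k C)) B = kd F \<gamma>1 B"
          by (rule kd_cong) (use B(3) in \<open>auto simp: \<gamma>_def\<close>)
        then have "kd F \<gamma> A = \<omega>1 B + (-1) ^ q * (F k * \<gamma>0 B)"
          unfolding B(2) kd_insert[OF B(1)] using \<gamma>1(2)[OF B(1) cB] B(3) cB by (simp add: \<gamma>_def)
        then show ?thesis unfolding \<omega>1_def B(2)[symmetric] using Suc by simp
      qed
    qed
  qed
qed

text \<open>\<open>V i p t\<close> says that the \<open>p\<close>-th cohomology of \<open>z\<close> modulo \<open>w 0, \<dots>, w (i - 1)\<close> vanishes
  in degree \<open>t\<close>; the induction follows the long exact sequence of multiplication by \<open>w i\<close>.\<close>

lemma koszul_vanishing:
  assumes z: "gregular z k a" and w: "gregular w m b"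
    and V0: "\<And>p t. V 0 p t \<Longrightarrow> p < k \<or> t < 0"
    and VSuc: "\<And>i p t. V (Suc i) p t \<Longrightarrow> V i p t \<and> V i (Suc p) (t + a - b)"
    and "i \<le> m" "V i p t" "\<And>A. \<omega> A \<in> H t"
    and "\<And>A. A \<subseteq> {..<k} \<Longrightarrow> card A = Suc p \<Longrightarrow> kd z \<omega> A \<in> gspan w i b (t + a)"
  shows "\<exists>\<gamma>. (\<forall>A. \<gamma> A \<in> H (t - a)) \<and>
           (\<forall>A\<subseteq>{..<k}. card A = p \<longrightarrow> \<omega> A - kd z \<gamma> A \<in> gspan w i b t)"
  using assms(5-)
proof (induction i arbitrary: p t \<omega>)
  case 0
  show ?case
  proof (cases "t < 0")
    case True
    then have "\<omega> A = 0" for A using neg_H 0(3) by blast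
    then show ?thesis by (intro exI[of _ "\<lambda>_. 0"]) (auto simp: zero_H kd_def)
  next
    case False
    then have "p < k" using V0[OF 0(2)] by simp
    from koszul_exact[OF z this 0(3)] 0(4) show ?thesis by auto
  qed
next
  case (Suc i)
  note \<omega>H = Suc.prems(3)
  have V: "V i p t" "V i (Suc p) (t + a - b)" using VSuc[OF Suc.prems(2)] by auto
  have wi: "w i \<in> H b" using gregular_H[OF w] Suc.prems(1) by simp
  have zH: "j < k \<Longrightarrow> z j \<in> H a" for j using gregular_H[OF z] .
  have fin: "finite A" if "A \<subseteq> {..<k}" for A using that finite_subset by auto
  \<comment> \<open>The coboundary of \<open>\<omega>\<close> equals \<open>w i * \<alpha>\<close>
    up to the earlier elements; \<open>\<alpha>\<close> represents the connecting map. Off the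
    relevant sets only its degree matters.\<close>
  have "\<exists>\<alpha>. \<alpha> \<in> H (t + a - b) \<and> (A \<subseteq> {..<k} \<longrightarrow> card A = Suc p \<longrightarrow>
      kd z \<omega> A - w i * \<alpha> \<in> gspan w i b (t + a))" for A
  proof (cases "A \<subseteq> {..<k} \<and> card A = Suc p")
    case True
    then have "kd z \<omega> A \<in> gspan w (Suc i) b (t + a)" using Suc.prems(4) by blast
    then show ?thesis by (elim gspan_SucE) (auto simp: mult.commute)
  next
    case False
    then show ?thesis by (intro exI[of _ 0]) (auto simp: zero_H)
  qed
  then obtain \<alpha> where \<alpha>: "\<And>A. \<alpha> A \<in> H (t + a - b)"
    "\<And>A. A \<subseteq> {..<k} \<Longrightarrow> card A = Suc p \<Longrightarrow> kd z \<omega> A - w i * \<alpha> A \<in> gspan w i b (t + a)"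
    by metis
  \<comment> \<open>As \<open>kd\<close> squares to zero, \<open>w i * kd z \<alpha>\<close> is up
    to sign the coboundary of something in the ideal of the earlier elements. Regularity of
    \<open>w i\<close> then makes \<open>\<alpha>\<close> a cocycle one position higher.\<close>
  have "kd z \<alpha> A \<in> gspan w i b (t + a - b + a)" if A: "A \<subseteq> {..<k}" "card A = Suc (Suc p)" for A
  proof -
    have "kd z (\<lambda>A. kd z \<omega> A - w i * \<alpha> A) A = - (w i * kd z \<alpha> A)"
      using kd_kd[OF fin[OF A(1)]] by (simp add: kd_diff kd_mult)
    moreover have "kd z (\<lambda>A. kd z \<omega> A - w i * \<alpha> A) A \<in> gspan w i b (t + a + a)"
      unfolding kd_def
    proof (intro gspan_sum gspan_sign)
      fix j assume j: "j \<in> A"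
      then have "card (A - {j}) = Suc p" using A fin[OF A(1)] by simp
      then have "kd z \<omega> (A - {j}) - w i * \<alpha> (A - {j}) \<in> gspan w i b (t + a)"
        using A by (intro \<alpha>(2)) auto
      then show "z j * ((\<Sum>ja\<in>A - {j}. (- 1) ^ card {i \<in> A - {j}. i < ja} * (z ja * \<omega> (A - {j} - {ja}))) - w i * \<alpha> (A - {j}))
          \<in> gspan w i b (t + a + a)"
        unfolding kd_def by (rule gspan_mult) (use j A zH in auto)
    qed
    ultimately have "w i * kd z \<alpha> A \<in> gspan w i b (t + a - b + a + b)"
      using gspan_uminus[of "- (w i * kd z \<alpha> A)"] by (simp add: algebra_simps)
    moreover have "kd z \<alpha> A \<in> H (t + a - b + a)"
      by (rule kd_H) (use \<alpha> A zH in auto)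
    ultimately show ?thesis using gregularD[OF w] Suc.prems(1) by simp
  qed
  from Suc.IH[OF Suc_leD[OF Suc.prems(1)] V(2) \<alpha>(1) this]
  obtain \<beta> where \<beta>: "\<And>A. \<beta> A \<in> H (t - b)"
    "\<And>A. A \<subseteq> {..<k} \<Longrightarrow> card A = Suc p \<Longrightarrow> \<alpha> A - kd z \<beta> A \<in> gspan w i b (t + a - b)"
    by auto
  \<comment> \<open>Subtracting \<open>w i * \<beta>\<close> turns \<open>\<omega>\<close> into a
    cocycle modulo the earlier elements alone. The subtracted term returns at the end as a member of
    the larger ideal.\<close>
  define \<omega>' where "\<omega>' A = \<omega> A - w i * \<beta> A" for A
  have "\<omega>' A \<in> H t" for A unfolding \<omega>'_def by (intro diff_H \<omega>H mult_H'[OF wi \<beta>(1)]) simp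
  moreover have "kd z \<omega>' A \<in> gspan w i b (t + a)" if A: "A \<subseteq> {..<k}" "card A = Suc p" for A
  proof -
    have "kd z \<omega>' A = (kd z \<omega> A - w i * \<alpha> A) + w i * (\<alpha> A - kd z \<beta> A)"
      by (simp add: \<omega>'_def[abs_def] kd_diff kd_mult right_diff_distrib)
    then show ?thesis
      using \<alpha>(2)[OF A] gspan_mult'[OF \<beta>(2)[OF A] wi, of "t + a"] by (simp add: gspan_add)
  qed
  ultimately obtain \<gamma> where \<gamma>: "\<And>A. \<gamma> A \<in> H (t - a)"
    "\<And>A. A \<subseteq> {..<k} \<Longrightarrow> card A = p \<Longrightarrow> \<omega>' A - kd z \<gamma> A \<in> gspan w i b t"
    using Suc.IH[OF _ V(1), of \<omega>'] Suc.prems(1) by (metis Suc_leD)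
  show ?case
  proof (intro exI[of _ \<gamma>] conjI allI impI \<gamma>(1))
    fix A assume A: "A \<subseteq> {..<k}" "card A = p"
    show "\<omega> A - kd z \<gamma> A \<in> gspan w (Suc i) b t"
      using gspan_add[OF gspan_mono_Suc[OF \<gamma>(2)[OF A]] gspan_gen[of i "Suc i" "\<beta> A" t b w]] \<beta>(1)
      by (simp add: \<omega>'_def)
  qed
qed

text \<open>This is position 0 of the Koszul complex of \<open>z\<close> modulo \<open>w\<close>,
  where there are no coboundaries. The bound \<open>p + t < k\<close> propagates because each
  quadric eliminated raises \<open>p\<close> by 1 and changes \<open>t\<close> by 1 - 2; with no
  quadrics left it forces \<open>p < k\<close> or \<open>t < 0\<close>.\<close>

lemma koszul_torsion_free:
  assumes z: "gregular z k 1" and w: "gregular w m 2"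
    and c: "c \<in> H t" and "t < int k"
    and ann: "\<And>i. i < k \<Longrightarrow> z i * c \<in> gspan w m 2 (t + 1)"
  shows "c \<in> gspan w m 2 t"
proof -
  have "kd z (\<lambda>_. c) A \<in> gspan w m 2 (t + 1)" if "A \<subseteq> {..<k}" for A
    unfolding kd_def using that ann by (intro gspan_sum gspan_sign) auto
  then have "\<exists>\<gamma>. (\<forall>A::nat set. \<gamma> A \<in> H (t - 1)) \<and>
      (\<forall>A\<subseteq>{..<k}. card A = 0 \<longrightarrow> c - kd z \<gamma> A \<in> gspan w m 2 t)"
    by (intro koszul_vanishing[OF z w, of "\<lambda>i p t. int p + t < int k" m 0 t "\<lambda>_. c"])
      (use c \<open>t < int k\<close> in auto)
  then obtain \<gamma> :: "nat set \<Rightarrow> 'a" where "\<forall>A\<subseteq>{..<k}. card A = 0 \<longrightarrow> c - kd z \<gamma> A \<in> gspan w m 2 t"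
    by blast
  then have "c - kd z \<gamma> {} \<in> gspan w m 2 t" by (metis card.empty empty_subsetI)
  then show ?thesis by (simp add: kd_def)
qed

text \<open>Modulo \<open>z\<close> the Koszul cohomology of the six quadrics vanishes in positions
  below 6 - 3. Since \<open>F 0\<close>, \<open>F 1\<close>, \<open>F 2\<close> are zero modulo
  \<open>z\<close>, a relation among \<open>F 3\<close>, \<open>F 4\<close>, \<open>F 5\<close>,
  with its coefficients placed on the three pairs of indices, is a cocycle in position 2. A
  primitive, evaluated at \<open>{3,4}\<close>, expresses \<open>q\<close> through
  \<open>F 3\<close> and \<open>F 4\<close>. So \<open>F 5\<close> is a nonzerodivisor modulo
  \<open>z\<close>, \<open>F 3\<close>, \<open>F 4\<close>.\<close>

lemma koszul_regular_quotient:
  assumes F: "gregular F 6 2" and z: "gregular z 3 1"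
    and Fz: "\<And>i. i < 3 \<Longrightarrow> F i \<in> gspan z 3 1 2"
    and H: "q \<in> H d" "a \<in> H d" "b \<in> H d"
    and rel: "F 5 * q - a * F 3 - b * F 4 \<in> gspan z 3 1 (d + 2)"
  obtains a' b' where "a' \<in> H (d - 2)" "b' \<in> H (d - 2)"
    "q - a' * F 3 - b' * F 4 \<in> gspan z 3 1 d"
proof -
  define \<omega> where "\<omega> A = (if A = {3,4::nat} then q else if A = {3,5} then b else if A = {4,5} then - a else 0)" for A
  have \<omega>H: "\<omega> A \<in> H d" for A using H by (auto simp: \<omega>_def zero_H intro: uminus_H)
  have \<omega>0: "\<omega> A = 0" if "\<not> A \<subseteq> {3,4,5}" for A using that by (auto simp: \<omega>_def)
  have cyc: "kd F \<omega> A \<in> gspan z 3 1 (d + 2)" if A: "A \<subseteq> {..<6}" "card A = Suc 2" for A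
  proof (cases "A = {3,4,5}")
    case True
    have s: "{i. (i = 3 \<or> i = 4 \<or> i = (5::nat)) \<and> i < 3} = {}"
      "{i. (i = 3 \<or> i = 4 \<or> i = (5::nat)) \<and> i < 4} = {3}"
      "{i. (i = 3 \<or> i = 4 \<or> i = (5::nat)) \<and> i < 5} = {3,4}" by auto
    have "kd F \<omega> {3,4,5} = F 5 * q - a * F 3 - b * F 4"
    proof -
      have 1: "\<omega> ({3,4,5} - {3}) = - a" "\<omega> ({3,4,5} - {4}) = b" "\<omega> ({3,4,5} - {5}) = q"
      proof -
        have "{3,4,5} - {3} = {4,5::nat}" "{3,4,5} - {4} = {3,5::nat}" "{3,4,5} - {5} = {3,4::nat}" by auto
        moreover have "{4,5} \<noteq> {3,4::nat}" "{4,5} \<noteq> {3,5::nat}" "{3,5} \<noteq> {3,4::nat}"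
          by (simp_all add: doubleton_eq_iff)
        ultimately show "\<omega> ({3,4,5} - {3}) = - a" "\<omega> ({3,4,5} - {4}) = b" "\<omega> ({3,4,5} - {5}) = q"
          by (simp_all add: \<omega>_def)
      qed
      have 2: "kd F \<omega> {3,4,5} = (-1) ^ card {i \<in> {3,4,5::nat}. i < 3} * (F 3 * \<omega> ({3,4,5} - {3}))
          + ((-1) ^ card {i \<in> {3,4,5::nat}. i < 4} * (F 4 * \<omega> ({3,4,5} - {4}))
          + (-1) ^ card {i \<in> {3,4,5::nat}. i < 5} * (F 5 * \<omega> ({3,4,5} - {5})))"
        unfolding kd_def by (subst sum.insert; simp)+
      show ?thesis unfolding 2 1 by (simp add: s algebra_simps)
    qed
    then show ?thesis using True rel by simp
  next
    case False
    have fA: "finite A" using A(1) finite_subset by auto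
    show ?thesis unfolding kd_def
    proof (intro gspan_sum gspan_sign)
      fix j assume j: "j \<in> A"
      show "F j * \<omega> (A - {j}) \<in> gspan z 3 1 (d + 2)"
      proof (cases "A - {j} \<subseteq> {3,4,5}")
        case True
        have "j \<notin> {3,4,5}"
        proof
          assume "j \<in> {3,4,5}"
          with True have "A \<subseteq> {3,4,5}" by auto
          then have "A = {3,4,5}" using A by (intro card_subset_eq) auto
          with False show False by simp
        qed
        then have "j < 3" using A(1) j by auto
        from gspan_mult[OF Fz[OF this] \<omega>H] show ?thesis by (simp add: algebra_simps)
      next
        case False
        then show ?thesis by (simp add: \<omega>0 gspan_zero)
      qed
    qed
  qed
  have "\<exists>\<gamma>. (\<forall>A. \<gamma> A \<in> H (d - 2)) \<and>
      (\<forall>A\<subseteq>{..<6}. card A = 2 \<longrightarrow> \<omega> A - kd F \<gamma> A \<in> gspan z 3 1 d)"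
    by (rule koszul_vanishing[OF F z, of "\<lambda>i p t. p + i < 6" 3]) (use \<omega>H cyc in auto)
  then obtain \<gamma> where \<gamma>: "\<And>A. \<gamma> A \<in> H (d - 2)"
    "\<And>A. A\<subseteq>{..<6} \<Longrightarrow> card A = 2 \<Longrightarrow> \<omega> A - kd F \<gamma> A \<in> gspan z 3 1 d" by blast
  have s: "{i. (i = 3 \<or> i = (4::nat)) \<and> i < 3} = {}" "{i. (i = 3 \<or> i = (4::nat)) \<and> i < 4} = {3}"
    "{3,4} - {3} = {4::nat}" "{3,4} - {4} = {3::nat}" by auto
  have "kd F \<gamma> {3,4} = F 3 * \<gamma> {4} - F 4 * \<gamma> {3}" by (simp add: kd_def s)
  moreover have "\<omega> {3,4} - kd F \<gamma> {3,4} \<in> gspan z 3 1 d" by (rule \<gamma>(2)) auto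
  moreover have "q - (F 3 * \<gamma> {4} - F 4 * \<gamma> {3}) = q - \<gamma> {4} * F 3 - (- \<gamma> {3}) * F 4"
    by (simp add: algebra_simps)
  ultimately have "q - \<gamma> {4} * F 3 - (- \<gamma> {3}) * F 4 \<in> gspan z 3 1 d"
    by (simp add: \<omega>_def)
  then show thesis using that \<gamma>(1) uminus_H by blast
qed

subsection \<open>Koszul syzygies\<close>

text \<open>The coefficient matrix is written as \<open>t - t\<^sup>T\<close>, so that it is alternating also in
  characteristic 2.\<close>

definition gsyz :: "(nat \<Rightarrow> 'a) \<Rightarrow> nat \<Rightarrow> int \<Rightarrow> bool" where
  "gsyz F n e \<longleftrightarrow> (\<forall>i<n. F i \<in> H e) \<and>
     (\<forall>d u. (\<forall>i. u i \<in> H d) \<longrightarrow> (\<Sum>i<n. u i * F i) = 0 \<longrightarrow>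
        (\<exists>t. (\<forall>i j. t i j \<in> H (d - e)) \<and> (\<forall>i<n. u i = (\<Sum>j<n. (t i j - t j i) * F j))))"

lemma gsyzE:
  assumes "gsyz F n e" "\<And>i. u i \<in> H d" "(\<Sum>i<n. u i * F i) = 0"
  obtains t where "\<And>i j. t i j \<in> H (d - e)" "\<And>i. i < n \<Longrightarrow> u i = (\<Sum>j<n. (t i j - t j i) * F j)"
proof -
  have "\<exists>t. (\<forall>i j. t i j \<in> H (d - e)) \<and> (\<forall>i<n. u i = (\<Sum>j<n. (t i j - t j i) * F j))"
    using assms unfolding gsyz_def by blast
  then show thesis using that by blast
qed

text \<open>By regularity the coefficient of the last generator lies in the ideal of the earlier
  ones. Removing the Koszul relations between \<open>F n\<close> and these leaves a syzygy of the
  first \<open>n\<close> generators.\<close>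

lemma gregular_imp_gsyz: "gregular F n e \<Longrightarrow> gsyz F n e"
proof (induction n)
  case 0
  show ?case by (auto simp: gsyz_def intro!: exI[of _ "\<lambda>_ _. 0"] zero_H)
next
  case (Suc n)
  have Fn: "F n \<in> H e" using gregular_H[OF Suc.prems] by simp
  have syz: "gsyz F n e" by (rule Suc.IH) (rule gregular_prefix[OF Suc.prems], simp)
  show ?case unfolding gsyz_def
  proof (intro conjI allI impI)
    show "F i \<in> H e" if "i < Suc n" for i using gregular_H[OF Suc.prems that] .
    fix d u assume u: "\<forall>i. u i \<in> H d" and 0: "(\<Sum>i<Suc n. u i * F i) = 0"
    have "F n * u n = (\<Sum>j<n. - u j * F j)"
      using 0 by (simp add: sum_negf add_eq_0_iff mult.commute)
    also have "\<dots> \<in> gspan F n e (d + e)" by (intro gspanI uminus_H) (use u in auto)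
    finally have "u n \<in> gspan F n e d" using gregularD[OF Suc.prems lessI, of "u n" d] u by blast
    then obtain v where v: "\<And>j. v j \<in> H (d - e)" "u n = (\<Sum>j<n. v j * F j)" by (elim gspanE) blast
    have "(\<Sum>i<n. (u i + v i * F n) * F i) = 0"
    proof -
      have "(\<Sum>i<n. (u i + v i * F n) * F i) = (\<Sum>i<n. u i * F i) + F n * (\<Sum>i<n. v i * F i)"
        by (simp add: distrib_left sum.distrib sum_distrib_left mult_ac)
      also have "\<dots> = 0" unfolding v(2)[symmetric] using 0 by (simp add: mult.commute)
      finally show ?thesis .
    qed
    moreover have "u i + v i * F n \<in> H d" for i
      using u by (intro add_H mult_H'[OF v(1) Fn]) auto
    ultimately obtain t where t: "\<And>i j. t i j \<in> H (d - e)"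
      "\<And>i. i < n \<Longrightarrow> u i + v i * F n = (\<Sum>j<n. (t i j - t j i) * F j)"
      using gsyzE[OF syz, of "\<lambda>i. u i + v i * F n" d] by blast
    \<comment> \<open>Row \<open>n\<close> holds \<open>v\<close> and column \<open>n\<close> is
      zero, so the alternating difference has \<open>v\<close> in row \<open>n\<close> and
      \<open>- v\<close> in column \<open>n\<close>.\<close>
    define t' where "t' i j = (if i < n \<and> j < n then t i j else if i = n \<and> j < n then v j else 0)" for i j
    show "\<exists>t. (\<forall>i j. t i j \<in> H (d - e)) \<and> (\<forall>i<Suc n. u i = (\<Sum>j<Suc n. (t i j - t j i) * F j))"
    proof (intro exI[of _ t'] conjI allI impI)
      show "t' i j \<in> H (d - e)" for i j by (simp add: t'_def t v zero_H)
      fix i assume "i < Suc n"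
      then consider "i < n" | "i = n" by linarith
      then show "u i = (\<Sum>j<Suc n. (t' i j - t' j i) * F j)"
      proof cases
        case 1
        then have "(\<Sum>j<n. (t' i j - t' j i) * F j) = (\<Sum>j<n. (t i j - t j i) * F j)"
          by (intro sum.cong) (auto simp: t'_def)
        moreover have "u i = (\<Sum>j<n. (t i j - t j i) * F j) - v i * F n"
          using t(2)[OF 1, symmetric] by simp
        moreover have "t' i n - t' n i = - v i" using 1 by (simp add: t'_def)
        ultimately show ?thesis by (simp only: sum.lessThan_Suc minus_mult_left diff_conv_add_uminus)
      next
        case 2
        then have "(\<Sum>j<n. (t' i j - t' j i) * F j) = (\<Sum>j<n. v j * F j)"
          by (intro sum.cong) (auto simp: t'_def)
        moreover have "u i = (\<Sum>j<n. v j * F j)" using 2 v(2) by simp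
        ultimately show ?thesis
          using 2 by (simp only: sum.lessThan_Suc diff_self mult_zero_left add_0_right)
      qed
    qed
  qed
qed

text \<open>A syzygy of the first \<open>n\<close> generators, extended by zero, has a Koszul matrix
  that may involve \<open>F n\<close>. Its last row is again a syzygy of the first \<open>n\<close>
  generators, of degree lower by \<open>e\<close>. By descent on the degree that row is Koszul, and
  its terms are absorbed into the other entries.\<close>

lemma gsyz_prefix:
  assumes "0 < e" "gsyz F (Suc n) e"
  shows "gsyz F n e"
proof -
  have Fn: "F n \<in> H e" using assms unfolding gsyz_def by blast
  have descent: "\<exists>t. (\<forall>i j. t i j \<in> H (d - e)) \<and> (\<forall>i<n. u i = (\<Sum>j<n. (t i j - t j i) * F j))"
    if "d < int k" "\<And>i. u i \<in> H d" "(\<Sum>i<n. u i * F i) = 0" for k d u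
    using that
  proof (induction k arbitrary: d u)
    case 0
    then have "u i = 0" for i using neg_H[of d "u i"] by simp
    then show ?case by (intro exI[of _ "\<lambda>_ _. 0"]) (simp add: zero_H)
  next
    case (Suc k)
    define u' where "u' i = (if i < n then u i else 0)" for i
    have "u' i \<in> H d" for i using Suc.prems by (simp add: u'_def zero_H)
    moreover have "(\<Sum>i<Suc n. u' i * F i) = 0" using Suc.prems by (simp add: u'_def)
    ultimately obtain t where t: "\<And>i j. t i j \<in> H (d - e)"
      "\<And>i. i < Suc n \<Longrightarrow> u' i = (\<Sum>j<Suc n. (t i j - t j i) * F j)"
      using gsyzE[OF assms(2)] by blast
    have "(\<Sum>j<n. (t n j - t j n) * F j) = 0" using t(2)[of n] by (simp add: u'_def)
    moreover have "t n j - t j n \<in> H (d - e)" for j by (intro diff_H t)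
    moreover have "d - e < int k" using Suc.prems assms(1) by simp
    ultimately obtain r where r: "\<And>i j. r i j \<in> H (d - e - e)"
      "\<And>i. i < n \<Longrightarrow> t n i - t i n = (\<Sum>j<n. (r i j - r j i) * F j)"
      using Suc.IH[of "d - e" "\<lambda>j. t n j - t j n"] by blast
    show ?case
    proof (intro exI[of _ "\<lambda>i j. t i j - r i j * F n"] conjI allI impI)
      show "t i j - r i j * F n \<in> H (d - e)" for i j
        by (intro diff_H t mult_H'[OF r(1) Fn]) simp
      fix i assume i: "i < n"
      have "u i = (\<Sum>j<n. (t i j - t j i) * F j) - (t n i - t i n) * F n"
        using t(2)[of i] i by (simp add: u'_def algebra_simps)
      also have "\<dots> = (\<Sum>j<n. (t i j - r i j * F n - (t j i - r j i * F n)) * F j)"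
        unfolding r(2)[OF i] by (simp add: sum_distrib_left sum_subtractf sum.distrib algebra_simps)
      finally show "u i = (\<Sum>j<n. (t i j - r i j * F n - (t j i - r j i * F n)) * F j)" .
    qed
  qed
  then have "\<exists>t. (\<forall>i j. t i j \<in> H (d - e)) \<and> (\<forall>i<n. u i = (\<Sum>j<n. (t i j - t j i) * F j))"
    if "\<forall>i. u i \<in> H d" "(\<Sum>i<n. u i * F i) = 0" for d u
    using that by (intro descent[of d "Suc (nat d)" u]) auto
  then show ?thesis using assms(2) unfolding gsyz_def by simp
qed

text \<open>Membership of \<open>F n * p\<close> in the ideal of the earlier generators is a syzygy
  with last coefficient \<open>p\<close>, and the last row of an alternating matrix has no
  \<open>F n\<close> term. In contrast to \<open>gregular\<close>, the notion \<open>gsyz\<close>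
  does not depend on the order of the generators, which is what permits a change of basis.\<close>

lemma gsyz_imp_gregular:
  assumes "0 < e"
  shows "gsyz F n e \<Longrightarrow> gregular F n e"
proof (induction n)
  case 0
  then show ?case by (simp add: gregular_def)
next
  case (Suc n)
  have reg: "gregular F n e" using Suc gsyz_prefix[OF assms] by blast
  have FH: "F i \<in> H e" if "i < Suc n" for i using Suc.prems that unfolding gsyz_def by blast
  have "p \<in> gspan F n e d" if p: "p \<in> H d" "F n * p \<in> gspan F n e (d + e)" for d p
  proof -
    obtain v where v: "\<And>j. v j \<in> H (d + e - e)" "F n * p = (\<Sum>j<n. v j * F j)"
      using p(2) by (elim gspanE) blast
    define u where "u i = (if i < n then - v i else p)" for i
    have "(\<Sum>i<Suc n. u i * F i) = 0" using v(2) by (simp add: u_def sum_negf mult.commute)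
    moreover have "u i \<in> H d" for i using v(1)[of i] p by (simp add: u_def uminus_H)
    ultimately obtain t where t: "\<And>i j. t i j \<in> H (d - e)"
      "\<And>i. i < Suc n \<Longrightarrow> u i = (\<Sum>j<Suc n. (t i j - t j i) * F j)"
      using gsyzE[OF Suc.prems] by blast
    have "p = (\<Sum>j<n. (t n j - t j n) * F j)" using t(2)[of n] by (simp add: u_def)
    also have "\<dots> \<in> gspan F n e d" by (intro gspanI diff_H t)
    finally show ?thesis .
  qed
  then show ?case using reg FH unfolding gregular_def by (auto simp: less_Suc_eq)
qed

text \<open>Multiplication by \<open>c\<close> turns a syzygy of \<open>F'\<close> into one of
  \<open>F\<close>. The matrix \<open>t\<close> is transported back by the congruence
  \<open>D^T t D\<close>, under which \<open>t - t^T\<close> stays alternating.\<close>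

lemma gsyz_base_change:
  assumes syz: "gsyz F n e"
    and c: "\<And>i j. c i j \<in> H 0" and D: "\<And>i j. D i j \<in> H 0"
    and F': "\<And>i. i < n \<Longrightarrow> F' i = (\<Sum>j<n. c i j * F j)"
    and F: "\<And>i. i < n \<Longrightarrow> F i = (\<Sum>j<n. D i j * F' j)"
    and inv: "\<And>i k. i < n \<Longrightarrow> k < n \<Longrightarrow> (\<Sum>j<n. c i j * D j k) = (if i = k then 1 else 0)"
  shows "gsyz F' n e"
  unfolding gsyz_def
proof (intro conjI allI impI)
  have FH: "F i \<in> H e" if "i < n" for i using syz that unfolding gsyz_def by blast
  show "F' i \<in> H e" if "i < n" for i
    unfolding F'[OF that] by (intro sum_H mult_H'[OF c FH]) auto
  fix d u assume u: "\<forall>i. u i \<in> H d" and 0: "(\<Sum>i<n. u i * F' i) = 0"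
  have "(\<Sum>j<n. (\<Sum>i<n. u i * c i j) * F j) = (\<Sum>j<n. \<Sum>i<n. u i * c i j * F j)"
    by (simp add: sum_distrib_right)
  also have "\<dots> = (\<Sum>i<n. u i * F' i)"
    by (subst sum.swap) (auto simp: F' sum_distrib_left mult.assoc intro!: sum.cong)
  finally have "(\<Sum>j<n. (\<Sum>i<n. u i * c i j) * F j) = 0" using 0 by simp
  moreover have "(\<Sum>i<n. u i * c i j) \<in> H d" for j
    using u by (intro sum_H mult_H'[OF _ c]) auto
  ultimately obtain t where t: "\<And>i j. t i j \<in> H (d - e)"
    "\<And>j. j < n \<Longrightarrow> (\<Sum>i<n. u i * c i j) = (\<Sum>l<n. (t j l - t l j) * F l)"
    using gsyzE[OF syz, of "\<lambda>j. \<Sum>i<n. u i * c i j" d] by blast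
  define t' where "t' k m = (\<Sum>j<n. \<Sum>l<n. t j l * D j k * D l m)" for k m
  show "\<exists>t. (\<forall>i j. t i j \<in> H (d - e)) \<and> (\<forall>i<n. u i = (\<Sum>j<n. (t i j - t j i) * F' j))"
  proof (intro exI[of _ t'] conjI allI impI)
    show "t' i j \<in> H (d - e)" for i j
      unfolding t'_def by (intro sum_H mult_H'[OF mult_H'[OF t(1) D] D]) auto
    fix k assume k: "k < n"
    have "(\<Sum>m<n. (t' k m - t' m k) * F' m) = (\<Sum>m<n. \<Sum>j<n. \<Sum>l<n. (t j l - t l j) * D j k * D l m * F' m)"
    proof (rule sum.cong)
      fix m
      have "t' m k = (\<Sum>j<n. \<Sum>l<n. t l j * D j k * D l m)"
        unfolding t'_def by (subst sum.swap) (intro sum.cong refl, simp add: mult_ac)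
      then show "(t' k m - t' m k) * F' m = (\<Sum>j<n. \<Sum>l<n. (t j l - t l j) * D j k * D l m * F' m)"
        unfolding t'_def by (simp add: sum_subtractf sum_distrib_right left_diff_distrib)
    qed simp
    also have "\<dots> = (\<Sum>j<n. \<Sum>l<n. \<Sum>m<n. (t j l - t l j) * D j k * D l m * F' m)"
      by (subst sum.swap) (intro sum.cong refl sum.swap)
    also have "\<dots> = (\<Sum>j<n. \<Sum>l<n. (t j l - t l j) * D j k * F l)"
      by (intro sum.cong refl) (simp add: F sum_distrib_left mult.assoc)
    also have "\<dots> = (\<Sum>j<n. D j k * (\<Sum>i<n. u i * c i j))"
      by (intro sum.cong refl) (simp add: t(2) sum_distrib_left mult_ac)
    also have "\<dots> = (\<Sum>j<n. \<Sum>i<n. u i * (c i j * D j k))"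
      by (simp add: sum_distrib_left mult_ac)
    also have "\<dots> = (\<Sum>i<n. u i * (\<Sum>j<n. c i j * D j k))"
      by (subst sum.swap) (simp add: sum_distrib_left)
    also have "\<dots> = (\<Sum>i<n. if i = k then u k else 0)"
      by (intro sum.cong refl) (use k in \<open>simp add: inv\<close>)
    also have "\<dots> = u k" using k by simp
    finally show "u k = (\<Sum>m<n. (t' k m - t' m k) * F' m)" by simp
  qed
qed

end

section \<open>Dimension formulas for subspaces of finite-dimensional spans\<close>

lemma (in vector_space) subspace_basis:
  assumes "subspace M" "M \<subseteq> span F" "finite F"
  obtains B where "finite B" "independent B" "B \<subseteq> M" "span B = M" "card B = dim M"
proof -
  obtain B where B: "B \<subseteq> M" "independent B" "M \<subseteq> span B" "card B = dim M"
    using basis_exists by blast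
  moreover have "finite B" using independent_span_bound[OF assms(3) B(2)] B(1) assms(2) by auto
  moreover have "span B = M" using B assms(1) by (intro span_subspace) auto
  ultimately show ?thesis using that by blast
qed

lemma (in vector_space) dim_mono_finite:
  assumes "M \<subseteq> Y" "Y \<subseteq> span F" "finite F"
  shows "dim M \<le> dim Y"
proof -
  have "span Y \<subseteq> span F" using assms(2) span_minimal by blast
  from subspace_basis[OF subspace_span this assms(3)] obtain B where B:
    "finite B" "span B = span Y" "card B = dim (span Y)" by metis
  have "M \<subseteq> span B" using B(2) assms(1) span_superset by blast
  from dim_le_card[OF this B(1)] show ?thesis using B(3) by simp
qed

lemma (in vector_space) exists_projection:
  assumes "subspace M"
  obtains g where "Vector_Spaces.linear scale scale g" "\<And>x. g x \<in> M" "\<And>x. x \<in> M \<Longrightarrow> g x = x"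
proof -
  interpret p: vector_space_pair scale scale by unfold_locales
  obtain B where B: "B \<subseteq> M" "independent B" "M \<subseteq> span B" by (rule basis_exists)
  have sp: "span B = M" using B assms by (intro span_subspace)
  define g where "g = p.construct B (\<lambda>b. b)"
  have lin: "Vector_Spaces.linear scale scale g" unfolding g_def using B(2) by (rule p.linear_construct)
  have "g x = x" if "x \<in> M" for x
  proof (rule p.linear_eq_on[OF lin _ that[folded sp]])
    show "Vector_Spaces.linear scale scale (\<lambda>x. x)" using linear_id by (simp add: id_def)
    show "g b = b" if "b \<in> B" for b unfolding g_def using B(2) that by (rule p.construct_basis)
  qed
  moreover have "g x \<in> M" for x
    unfolding g_def sp[symmetric] using p.construct_in_span[OF B(2), of "\<lambda>b. b" x] by simp
  ultimately show ?thesis using that lin by blast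
qed

text \<open>The ambient polynomial rings are infinite-dimensional, hence the formulation for a
  subspace \<open>Y\<close> inside a finite span. A basis of the kernel is extended to a basis of
  \<open>Y\<close>, and the added vectors map to a basis of the image.\<close>

lemma (in vector_space_pair) rank_nullity:
  assumes T: "Vector_Spaces.linear s1 s2 T" and Y: "vs1.subspace Y" "Y \<subseteq> vs1.span F" "finite F"
  shows "vs2.dim (T ` Y) + vs1.dim {y \<in> Y. T y = 0} = vs1.dim Y"
proof -
  interpret T: Vector_Spaces.linear s1 s2 T by (rule T)
  define Z where "Z = {y \<in> Y. T y = 0}"
  have Zs: "vs1.subspace Z" unfolding Z_def
    using vs1.subspace_inter[OF Y(1) T.subspace_kernel] by (simp add: Int_def)
  have ZF: "Z \<subseteq> vs1.span F" using Y(2) by (auto simp: Z_def)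
  obtain C where C: "finite C" "vs1.independent C" "C \<subseteq> Z" "vs1.span C = Z" "card C = vs1.dim Z"
    using vs1.subspace_basis[OF Zs ZF Y(3)] .
  have "C \<subseteq> Y" using C(3) by (auto simp: Z_def)
  from vs1.maximal_independent_subset_extend[OF this C(2)]
  obtain B where B: "C \<subseteq> B" "B \<subseteq> Y" "vs1.independent B" "Y \<subseteq> vs1.span B" by auto
  have fB: "finite B" using vs1.independent_span_bound[OF Y(3) B(3)] B(2) Y(2) by auto
  have spB: "vs1.span B = Y" by (rule vs1.span_subspace[OF B(2,4) Y(1)])
  define E where "E = B - C"
  have E: "vs1.independent E" "finite E" "C \<inter> E = {}" "C \<union> E = B"
    using B fB vs1.independent_mono[of B E] by (auto simp: E_def)
  have inj: "inj_on T (vs1.span E)"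
  proof (subst T.inj_on_iff_eq_0)
    show "vs1.subspace (vs1.span E)" by simp
    show "\<forall>x\<in>vs1.span E. T x = 0 \<longrightarrow> x = 0"
    proof (intro ballI impI)
      fix x assume x: "x \<in> vs1.span E" "T x = 0"
      have "vs1.span E \<subseteq> Y" using spB E(4) vs1.span_mono[of E B] by auto
      then have xC: "x \<in> vs1.span C" using x C(4) by (auto simp: Z_def)
      have "vs1.representation B x b = 0" for b
      proof (cases "b \<in> C")
        case True
        then have "b \<notin> E" using E(3) by blast
        then have "vs1.representation E x b = 0" using vs1.representation_ne_zero by blast
        then show ?thesis using vs1.representation_extend[OF B(3) x(1)] E(4) by auto
      next
        case False
        then have "vs1.representation C x b = 0" using vs1.representation_ne_zero by blast
        then show ?thesis using vs1.representation_extend[OF B(3) xC B(1)] by simp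
      qed
      moreover have "x \<in> vs1.span B" using xC vs1.span_mono[OF B(1)] by blast
      ultimately show "x = 0"
        using vs1.sum_representation_eq[OF B(3) _ fB order_refl, of x] by simp
    qed
  qed
  have ind: "vs2.independent (T ` E)" by (rule T.independent_injective_image[OF E(1) inj])
  have "vs2.span (T ` E) = T ` Y"
  proof
    have "E \<subseteq> Y" using B(2) E(4) by blast
    then have "T ` E \<subseteq> T ` Y" by blast
    then show "vs2.span (T ` E) \<subseteq> T ` Y"
      by (rule vs2.span_minimal) (rule T.subspace_image[OF Y(1)])
    have "T b \<in> vs2.span (T ` E)" if "b \<in> B" for b
    proof (cases "b \<in> C")
      case True
      then have "T b = 0" using C(3) by (auto simp: Z_def)
      then show ?thesis using vs2.span_zero by simp
    next
      case False
      then show ?thesis using that E(4) by (intro vs2.span_base) auto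
    qed
    then have "vs2.span (T ` B) \<subseteq> vs2.span (T ` E)" by (intro vs2.span_minimal) auto
    then show "T ` Y \<subseteq> vs2.span (T ` E)" using T.span_image[of B] spB by simp
  qed
  then have "vs2.dim (T ` Y) = card (T ` E)" using vs2.dim_span_eq_card_independent[OF ind] by simp
  also have "\<dots> = card E"
    by (rule card_image) (rule inj_on_subset[OF inj vs1.span_superset])
  finally have "vs2.dim (T ` Y) + vs1.dim Z = card (C \<union> E)"
    using C(1,5) E(2,3) by (simp add: card_Un_disjoint)
  also have "\<dots> = vs1.dim Y" using vs1.dim_span_eq_card_independent[OF B(3)] spB E(4) by simp
  finally show ?thesis unfolding Z_def .
qed

text \<open>The main dimension counts have this shape: \<open>M\<close> is a subspace already
  understood, and \<open>T\<close> adds multiples of new generators to it. The map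
  \<open>\<pi>\<close>, with kernel exactly \<open>M\<close>, serves as the quotient map;
  rank-nullity is applied to \<open>\<pi>\<close> and to its composition with
  \<open>T\<close>.\<close>

lemma (in vector_space_pair) dim_sum_image:
  assumes T: "Vector_Spaces.linear s1 s2 T" and Y: "vs1.subspace Y" "Y \<subseteq> vs1.span F" "finite F"
    and M: "vs2.subspace M" "M \<subseteq> vs2.span G" "finite G"
  shows "vs2.dim {x + T y |x y. x \<in> M \<and> y \<in> Y} + vs1.dim {y \<in> Y. T y \<in> M} = vs2.dim M + vs1.dim Y"
proof -
  interpret T: Vector_Spaces.linear s1 s2 T by (rule T)
  interpret p: vector_space_pair s2 s2 by unfold_locales
  obtain g where g: "Vector_Spaces.linear s2 s2 g" "\<And>x. g x \<in> M" "\<And>x. x \<in> M \<Longrightarrow> g x = x"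
    using vs2.exists_projection[OF M(1)] by metis
  interpret g: Vector_Spaces.linear s2 s2 g by (rule g)
  define \<pi> where "\<pi> x = x - g x" for x
  have \<pi>: "Vector_Spaces.linear s2 s2 \<pi>" unfolding \<pi>_def
    using p.linear_compose_sub[OF vs2.linear_id g(1)] by (simp add: id_def)
  interpret \<pi>: Vector_Spaces.linear s2 s2 \<pi> by (rule \<pi>)
  have ker: "\<pi> x = 0 \<longleftrightarrow> x \<in> M" for x using g(2)[of x] g(3)[of x] by (auto simp: \<pi>_def)
  define S where "S = {x + T y |x y. x \<in> M \<and> y \<in> Y}"
  have S: "S = {x + y |x y. x \<in> M \<and> y \<in> T ` Y}" unfolding S_def by blast
  have TY: "vs2.subspace (T ` Y)" by (rule T.subspace_image[OF Y(1)])
  have Ss: "vs2.subspace S" unfolding S by (rule vs2.subspace_sums[OF M(1) TY])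
  have "T ` Y \<subseteq> vs2.span (T ` F)" using T.span_image[of F] Y(2) by auto
  then have SF: "S \<subseteq> vs2.span (G \<union> T ` F)"
    unfolding S vs2.span_Un using M(2) by blast
  have 1: "vs2.dim (\<pi> ` S) + vs2.dim {x \<in> S. \<pi> x = 0} = vs2.dim S"
    by (rule p.rank_nullity[OF \<pi> Ss SF]) (use M Y in auto)
  have "M \<subseteq> S" unfolding S_def using Y(1) vs1.subspace_0 T.zero by force
  then have 2: "{x \<in> S. \<pi> x = 0} = M" using ker by blast
  have "Vector_Spaces.linear s1 s2 (\<pi> \<circ> T)" by (rule Vector_Spaces.linear_compose[OF T \<pi>])
  from rank_nullity[OF this Y] have 3: "vs2.dim ((\<pi> \<circ> T) ` Y) + vs1.dim {y \<in> Y. T y \<in> M} = vs1.dim Y"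
    by (simp add: ker)
  have "\<pi> ` S = (\<pi> \<circ> T) ` Y"
  proof
    have "\<pi> (x + T y) = \<pi> (T y)" if "x \<in> M" for x y using that ker[of x] by (simp add: \<pi>.add)
    then show "\<pi> ` S \<subseteq> (\<pi> \<circ> T) ` Y" unfolding S_def by auto
    show "(\<pi> \<circ> T) ` Y \<subseteq> \<pi> ` S" unfolding S_def using vs2.subspace_0[OF M(1)] by force
  qed
  with 1 2 3 show ?thesis unfolding S_def[symmetric] by simp
qed

context vector_space begin

text \<open>Families rather than sets, so that repeated members count as dependent and members can
  be addressed by index.\<close>

definition indep_family :: "(nat \<Rightarrow> 'b) \<Rightarrow> nat \<Rightarrow> bool" where
  "indep_family F n \<longleftrightarrow> (\<forall>c. (\<Sum>j<n. scale (c j) (F j)) = 0 \<longrightarrow> (\<forall>j<n. c j = 0))"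

lemma indep_familyD: "local.indep_family F n \<Longrightarrow> (\<Sum>j<n. scale (c j) (F j)) = 0 \<Longrightarrow> j < n \<Longrightarrow> c j = 0"
  unfolding indep_family_def by blast

lemma span_family:
  fixes F :: "nat \<Rightarrow> 'b"
  shows "x \<in> span (F ` {..<n}) \<longleftrightarrow> (\<exists>c. x = (\<Sum>j<n. scale (c j) (F j)))"
proof
  have "subspace {x. \<exists>c. x = (\<Sum>j<n. scale (c j) (F j))}"
  proof (rule subspaceI)
    show "0 \<in> {x. \<exists>c. x = (\<Sum>j<n. scale (c j) (F j))}"
      by (auto intro!: exI[of _ "\<lambda>_. 0"])
    fix x y assume "x \<in> {x. \<exists>c. x = (\<Sum>j<n. scale (c j) (F j))}" "y \<in> {x. \<exists>c. x = (\<Sum>j<n. scale (c j) (F j))}"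
    then obtain c d where "x = (\<Sum>j<n. scale (c j) (F j))" "y = (\<Sum>j<n. scale (d j) (F j))" by blast
    then show "x + y \<in> {x. \<exists>c. x = (\<Sum>j<n. scale (c j) (F j))}"
      by (auto intro!: exI[of _ "\<lambda>j. c j + d j"] simp: scale_left_distrib sum.distrib)
  next
    fix a x assume "x \<in> {x. \<exists>c. x = (\<Sum>j<n. scale (c j) (F j))}"
    then obtain c where "x = (\<Sum>j<n. scale (c j) (F j))" by blast
    then show "scale a x \<in> {x. \<exists>c. x = (\<Sum>j<n. scale (c j) (F j))}"
      by (auto intro!: exI[of _ "\<lambda>j. a * c j"] simp: scale_sum_right)
  qed
  moreover have "F ` {..<n} \<subseteq> {x. \<exists>c. x = (\<Sum>j<n. scale (c j) (F j))}"
  proof safe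
    fix i assume "i < n"
    have "(\<Sum>j<n. scale (if j = i then 1 else 0) (F j)) = (\<Sum>j<n. if j = i then F j else 0)"
      by (rule sum.cong) auto
    then have "F i = (\<Sum>j<n. scale (if j = i then 1 else 0) (F j))"
      using \<open>i < n\<close> by simp
    then show "\<exists>c. F i = (\<Sum>j<n. scale (c j) (F j))" by (intro exI)
  qed
  ultimately show "x \<in> span (F ` {..<n}) \<Longrightarrow> \<exists>c. x = (\<Sum>j<n. scale (c j) (F j))"
    using span_minimal by blast
qed (auto intro!: span_sum span_scale intro: span_base)

lemma indep_familyI:
  assumes "independent (F ` {..<n})" "inj_on F {..<n}"
  shows "local.indep_family F n"
  unfolding indep_family_def
proof (intro allI impI)
  fix c j assume 0: "(\<Sum>j<n. scale (c j) (F j)) = 0" and j: "j < n"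
  define u where "u v = c (the_inv_into {..<n} F v)" for v
  have u: "u (F j) = c j" if "j < n" for j using that assms(2) by (simp add: u_def the_inv_into_f_f)
  have "(\<Sum>v\<in>F ` {..<n}. scale (u v) v) = (\<Sum>j<n. scale (c j) (F j))"
    by (subst sum.reindex[OF assms(2)]) (auto simp: u)
  then have "u (F j) = 0"
    using 0 j independentD[OF assms(1), of "F ` {..<n}" u "F j"] by auto
  then show "c j = 0" using u j by simp
qed

lemma indep_family_inj: "local.indep_family F n \<Longrightarrow> inj_on F {..<n}"
proof (rule inj_onI, rule ccontr)
  fix i j assume ind: "local.indep_family F n" and ij: "i \<in> {..<n}" "j \<in> {..<n}" "F i = F j" "i \<noteq> j"
  have "(\<Sum>k<n. scale (if k = i then 1 else if k = j then -1 else 0) (F k))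
      = (\<Sum>k<n. (if k = i then F i else 0) + (if k = j then - F j else 0))"
    using ij by (intro sum.cong) auto
  also have "\<dots> = 0" using ij by (simp add: sum.distrib)
  finally show False using indep_familyD[OF ind, of "\<lambda>k. if k = i then 1 else if k = j then -1 else 0" i] ij
    by simp
qed

lemma indep_family_independent:
  assumes "local.indep_family F n"
  shows "independent (F ` {..<n})"
proof (rule independent_if_scalars_zero)
  fix f x assume 0: "(\<Sum>x\<in>F ` {..<n}. scale (f x) x) = 0" and x: "x \<in> F ` {..<n}"
  have "(\<Sum>j<n. scale (f (F j)) (F j)) = 0"
    using 0 by (subst (asm) sum.reindex[OF indep_family_inj[OF assms]]) (simp add: o_def)
  then show "f x = 0" using indep_familyD[OF assms, of "\<lambda>j. f (F j)"] x by auto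
qed simp

lemma indep_family_dim: "local.indep_family F n \<Longrightarrow> dim (span (F ` {..<n})) = n"
  using dim_span_eq_card_independent[OF indep_family_independent] card_image[OF indep_family_inj]
  by fastforce

lemma indep_family_le_dim:
  assumes "local.indep_family F n" "F ` {..<n} \<subseteq> M" "M \<subseteq> span G" "finite G"
  shows "n \<le> dim M"
  using dim_mono_finite[OF assms(2-)] indep_family_dim[OF assms(1)] by simp

lemma dim_imp_indep_family:
  assumes "subspace M" "M \<subseteq> span G" "finite G" "n \<le> dim M"
  obtains F where "local.indep_family F n" "F ` {..<n} \<subseteq> M"
proof -
  obtain B where B: "finite B" "independent B" "B \<subseteq> M" "span B = M" "card B = dim M"
    using subspace_basis[OF assms(1-3)] .
  obtain F where F: "bij_betw F {..<dim M} B"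
    using ex_bij_betw_nat_finite[OF B(1)] B(5) by (auto simp: atLeast0LessThan)
  have sub: "F ` {..<n} \<subseteq> B" using F assms(4) by (auto simp: bij_betw_def)
  have "independent (F ` {..<n})" using independent_mono[OF B(2) sub] .
  moreover have "inj_on F {..<n}" using F assms(4) by (auto simp: bij_betw_def inj_on_def)
  ultimately show ?thesis using that indep_familyI sub B(3) by blast
qed

lemma indep_family_span_eq:
  assumes "local.indep_family F n" "F ` {..<n} \<subseteq> M" "subspace M" "M \<subseteq> span G" "finite G" "dim M = n"
  shows "span (F ` {..<n}) = M"
proof
  show "span (F ` {..<n}) \<subseteq> M" using assms span_minimal by blast
  obtain B where B: "F ` {..<n} \<subseteq> B" "B \<subseteq> M" "independent B" "M \<subseteq> span B"
    using maximal_independent_subset_extend[OF assms(2) indep_family_independent[OF assms(1)]] by auto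
  have "finite B" using independent_span_bound[OF assms(5) B(3)] B(2) assms(4) by auto
  moreover have "card B = n" using basis_card_eq_dim[OF B(2,4,3)] assms(6) by simp
  moreover have "card (F ` {..<n}) = n" using card_image[OF indep_family_inj[OF assms(1)]] by simp
  ultimately have "F ` {..<n} = B" using card_subset_eq B(1) by metis
  then show "M \<subseteq> span (F ` {..<n})" using B(4) by simp
qed

end

section \<open>Homogeneous polynomials\<close>

abbreviation (input) lookup :: "('a \<Rightarrow>\<^sub>0 'b::zero) \<Rightarrow> 'a \<Rightarrow> 'b" where "lookup \<equiv> Poly_Mapping.lookup"
abbreviation (input) keys :: "('a \<Rightarrow>\<^sub>0 'b::zero) \<Rightarrow> 'a set" where "keys \<equiv> Poly_Mapping.keys"
abbreviation (input) single :: "'a \<Rightarrow> 'b \<Rightarrow> ('a \<Rightarrow>\<^sub>0 'b::zero)" where "single \<equiv> Poly_Mapping.single"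

lemma mdeg_eq_sum: "finite A \<Longrightarrow> keys m \<subseteq> A \<Longrightarrow> mdeg m = (\<Sum>i\<in>A. lookup m i)"
  unfolding mdeg_def by (rule sum.mono_neutral_left) (auto simp: in_keys_iff)

lemma mdeg_add: "mdeg (a + b) = mdeg a + mdeg b"
proof -
  let ?A = "keys a \<union> keys b"
  have "keys (a + b) \<subseteq> ?A" by (rule Poly_Mapping.keys_add)
  then show ?thesis
    using mdeg_eq_sum[of ?A a] mdeg_eq_sum[of ?A b] mdeg_eq_sum[of ?A "a + b"]
    by (simp add: lookup_add sum.distrib)
qed

lemma mdeg_single [simp]: "mdeg (single i n) = n"
  by (simp add: mdeg_def)

lemma mdeg_zero [simp]: "mdeg 0 = 0"
  by (simp add: mdeg_def)

lemma mdeg_eq_0_iff: "mdeg m = 0 \<longleftrightarrow> m = 0"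
  by (auto simp: mdeg_def in_keys_iff intro!: poly_mapping_eqI)

definition hpart :: "int \<Rightarrow> ('x, 'k::comm_ring_1) mpoly set" where
  "hpart d = {p. \<forall>m\<in>keys p. int (mdeg m) = d}"

lemma homogeneous_part_eq_hpart: "homogeneous_part t = hpart (int t)"
  by (simp add: homogeneous_part_def hpart_def)

interpretation gr: graded_ring "hpart :: int \<Rightarrow> ('x, 'k::comm_ring_1) mpoly set"
proof
  fix d e :: int and x y :: "('x, 'k) mpoly"
  show "0 \<in> (hpart d :: ('x, 'k) mpoly set)" by (simp add: hpart_def)
  show "x + y \<in> hpart d" if "x \<in> hpart d" "y \<in> hpart d"
    using that Poly_Mapping.keys_add[of x y] by (auto simp: hpart_def)
  show "- x \<in> hpart d" if "x \<in> hpart d" using that by (auto simp: hpart_def in_keys_iff)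
  show "x * y \<in> hpart (d + e)" if "x \<in> hpart d" "y \<in> hpart e"
    unfolding hpart_def
  proof (intro CollectI ballI)
    fix m assume "m \<in> keys (x * y)"
    then obtain a b where "m = a + b" "a \<in> keys x" "b \<in> keys y"
      using keys_mult[of x y] by blast
    then show "int (mdeg m) = d + e" using that by (auto simp: hpart_def mdeg_add)
  qed
  show "1 \<in> (hpart 0 :: ('x, 'k) mpoly set)" by (simp add: hpart_def)
  show "x = 0" if "d < 0" "x \<in> hpart d"
  proof -
    have "keys x = {}" using that by (force simp: hpart_def)
    then show ?thesis by (auto simp: in_keys_iff intro!: poly_mapping_eqI)
  qed
qed

lemma single_hpart: "int (mdeg m) = d \<Longrightarrow> single m c \<in> hpart d"
  by (simp add: hpart_def)

lemma const_hpart [simp]: "single 0 c \<in> hpart 0"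
  by (rule single_hpart) simp

lemma Var_hpart [simp]: "Var i \<in> hpart 1"
  unfolding Var_def by (rule single_hpart) simp

lemma smult_hpart: "p \<in> hpart d \<Longrightarrow> smult c p \<in> hpart d"
  unfolding smult_def using gr.mult_H[OF const_hpart] by fastforce

lemma hpart_0E:
  assumes "p \<in> hpart 0"
  obtains c where "p = single 0 c"
proof
  show "p = single 0 (lookup p 0)"
  proof (rule poly_mapping_eqI)
    fix m show "lookup p m = lookup (single 0 (lookup p 0)) m"
      using assms by (cases "m = 0") (auto simp: hpart_def lookup_single in_keys_iff mdeg_eq_0_iff)
  qed
qed

lemma hpart_subspace: "mpoly.subspace (hpart d)"
  by (rule mpoly.subspaceI) (auto intro: gr.zero_H gr.add_H smult_hpart)

lemma smult_mult_left: "smult c p * q = smult c (p * q)"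
  by (simp add: smult_def mult.assoc)

lemma smult_mult_right: "p * smult c q = smult c (p * q)"
  by (simp add: smult_def mult_ac)

lemma poly_mapping_sum_single: "p = (\<Sum>m\<in>keys p. single m (lookup p m))"
  by (rule poly_mapping_eqI) (auto simp: lookup_sum lookup_single when_def sum.delta in_keys_iff)

definition hcomp :: "int \<Rightarrow> ('x, 'k::comm_ring_1) mpoly \<Rightarrow> ('x, 'k) mpoly" where
  "hcomp d p = Poly_Mapping.mapp (\<lambda>m c. if int (mdeg m) = d then c else 0) p"

lemma lookup_hcomp:
  "lookup (hcomp d p) m = (if int (mdeg m) = d then lookup p m else 0)"
  by (auto simp: hcomp_def lookup_mapp when_def in_keys_iff)

lemma hcomp_hpart: "hcomp d p \<in> hpart d"
  by (auto simp: hpart_def in_keys_iff lookup_hcomp split: if_splits)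

lemma hcomp_id: "p \<in> hpart d \<Longrightarrow> hcomp d p = p"
  by (rule poly_mapping_eqI) (auto simp: lookup_hcomp hpart_def in_keys_iff)

lemma hcomp_other: "p \<in> hpart e \<Longrightarrow> d \<noteq> e \<Longrightarrow> hcomp d p = 0"
  by (rule poly_mapping_eqI) (auto simp: lookup_hcomp hpart_def in_keys_iff)

lemma hcomp_sum: "hcomp d (sum f A) = (\<Sum>i\<in>A. hcomp d (f i))"
  by (rule poly_mapping_eqI) (simp add: lookup_hcomp lookup_sum)

lemma hcomp_mult:
  assumes "F \<in> hpart e"
  shows "hcomp d (p * F) = hcomp (d - e) p * F"
proof -
  have 1: "hcomp d (single m c * F) = hcomp (d - e) (single m c) * F" for m c
  proof -
    have s: "single m c \<in> hpart (int (mdeg m))" by (rule single_hpart) simp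
    have sF: "single m c * F \<in> hpart (int (mdeg m) + e)" using gr.mult_H[OF s assms] .
    show ?thesis
    proof (cases "int (mdeg m) + e = d")
      case True
      then have "d - e = int (mdeg m)" by simp
      then show ?thesis using hcomp_id[OF s] hcomp_id[OF sF] unfolding True by simp
    next
      case False
      then show ?thesis using hcomp_other[OF s, of "d - e"] hcomp_other[OF sF, of d] by auto
    qed
  qed
  show ?thesis
    by (subst (1 2) poly_mapping_sum_single[of p]) (simp add: sum_distrib_right hcomp_sum 1)
qed

section \<open>Ideals in a fixed degree\<close>

lemma ideal_gen_family:
  fixes F :: "nat \<Rightarrow> 'a::comm_ring_1"
  shows "p \<in> ideal_gen (F ` {..<n}) \<longleftrightarrow> (\<exists>v. p = (\<Sum>j<n. v j * F j))"
proof -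
  interpret m: Modules.module "(*) :: 'a \<Rightarrow> 'a \<Rightarrow> 'a" by (rule module_times)
  define S where "S = {x. \<exists>v. x = (\<Sum>j<n. v j * F j)}"
  have "m.subspace S"
  proof (rule m.subspaceI)
    show "0 \<in> S" by (auto simp: S_def intro!: exI[of _ "\<lambda>_. 0"])
    fix x y assume "x \<in> S" "y \<in> S"
    then obtain c d where "x = (\<Sum>j<n. c j * F j)" "y = (\<Sum>j<n. d j * F j)" by (auto simp: S_def)
    then have "x + y = (\<Sum>j<n. (c j + d j) * F j)" by (simp only: distrib_right sum.distrib)
    then show "x + y \<in> S" unfolding S_def by (intro CollectI exI)
  next
    fix a x assume "x \<in> S"
    then obtain c where "x = (\<Sum>j<n. c j * F j)" by (auto simp: S_def)
    then have "a * x = (\<Sum>j<n. (a * c j) * F j)" by (simp only: sum_distrib_left mult.assoc)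
    then show "a * x \<in> S" unfolding S_def by (intro CollectI exI)
  qed
  moreover have "F ` {..<n} \<subseteq> S"
  proof safe
    fix i assume "i < n"
    have "(\<Sum>j<n. (if j = i then 1 else 0) * F j) = (\<Sum>j<n. if j = i then F j else 0)"
      by (rule sum.cong) auto
    then have "F i = (\<Sum>j<n. (if j = i then 1 else 0) * F j)"
      using \<open>i < n\<close> by simp
    then show "F i \<in> S" unfolding S_def by (intro CollectI exI)
  qed
  ultimately have "m.span (F ` {..<n}) \<subseteq> S" by (rule m.span_minimal[rotated])
  moreover have "S \<subseteq> m.span (F ` {..<n})"
    by (auto simp: S_def intro!: m.span_sum m.span_scale intro: m.span_base)
  ultimately show ?thesis unfolding ideal_gen_def S_def by blast
qed

text \<open>Coefficients witnessing membership may be inhomogeneous; replacing each by its component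
  of degree \<open>d - e\<close> does not change a sum that lies in degree \<open>d\<close>.\<close>

lemma ideal_gen_hpart:
  assumes "\<And>j. j < n \<Longrightarrow> F j \<in> hpart e"
  shows "ideal_gen (F ` {..<n}) \<inter> hpart d = gr.gspan F n e d"
proof (intro Set.set_eqI iffI)
  fix p assume p: "p \<in> ideal_gen (F ` {..<n}) \<inter> hpart d"
  then obtain v where v: "p = (\<Sum>j<n. v j * F j)" by (auto simp: ideal_gen_family)
  have "p = hcomp d p" using p by (simp add: hcomp_id)
  also have "\<dots> = (\<Sum>j<n. hcomp (d - e) (v j) * F j)"
    unfolding v hcomp_sum using assms by (intro sum.cong) (auto simp: hcomp_mult)
  also have "\<dots> \<in> gr.gspan F n e d" by (rule gr.gspanI) (rule hcomp_hpart)
  finally show "p \<in> gr.gspan F n e d" .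
next
  fix p assume p: "p \<in> gr.gspan F n e d"
  then have "p \<in> hpart d" using gr.gspan_H[of n F e p d] assms by blast
  then show "p \<in> ideal_gen (F ` {..<n}) \<inter> hpart d"
    using p by (auto simp: ideal_gen_family gr.gspan_def)
qed

lemma regular_sequence_gregular:
  assumes "regular_sequence fs" "set fs \<subseteq> hpart e"
  shows "gr.gregular ((!) fs) (length fs) e"
proof -
  have img: "set (take i fs) = (!) fs ` {..<i}" if "i < length fs" for i
    using that nth_image[of i fs] by (simp add: lessThan_atLeast0)
  have F: "fs ! i \<in> hpart e" if "i < length fs" for i using assms(2) that by auto
  show ?thesis unfolding gr.gregular_def
  proof (intro conjI allI impI ballI F)
    fix i d p assume i: "i < length fs" and p: "p \<in> hpart d"
      and "fs ! i * p \<in> gr.gspan ((!) fs) i e (d + e)"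
    moreover have *: "ideal_gen ((!) fs ` {..<i}) \<inter> hpart d' = gr.gspan ((!) fs) i e d'" for d'
      using i F by (intro ideal_gen_hpart) auto
    ultimately have "fs ! i * p \<in> ideal_gen (set (take i fs))" unfolding img[OF i] by blast
    then have "p \<in> ideal_gen (set (take i fs))" using assms(1) i unfolding regular_sequence_def by blast
    then show "p \<in> gr.gspan ((!) fs) i e d" using p *[of d] unfolding img[OF i] by blast
  qed
qed

lemma lookup_single_mult:
  fixes p :: "('x, 'k::comm_ring_1) mpoly"
  shows "lookup (single a c * p) (a + m) = c * lookup p m"
proof -
  have "single a c * p =
      (\<Sum>k\<in>keys p. single (a + k) (c * lookup p k))"
    by (subst (1) poly_mapping_sum_single[of p]) (simp add: sum_distrib_left mult_single)
  then have "lookup (single a c * p) (a + m)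
      = (\<Sum>k\<in>keys p. if k = m then c * lookup p m else 0)"
    by (simp add: lookup_sum lookup_single when_def cong: if_cong)
  then show ?thesis by (simp add: in_keys_iff)
qed

section \<open>Regular sequences of linear forms\<close>

lemma gspan_VarI:
  fixes p :: "('x, 'k::comm_ring_1) mpoly"
  assumes "p \<in> hpart d" "\<And>m. m \<in> keys p \<Longrightarrow> \<exists>j<n. lookup m (e j) \<noteq> 0"
  shows "p \<in> gr.gspan (\<lambda>i. Var (e i)) n 1 d"
proof -
  have "single m (lookup p m) \<in> gr.gspan (\<lambda>i. Var (e i)) n 1 d"
    if m: "m \<in> keys p" for m
  proof -
    obtain j where j: "j < n" "lookup m (e j) \<noteq> 0" using assms(2)[OF m] by blast
    define m' where "m' = Poly_Mapping.update (e j) (lookup m (e j) - 1) m"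
    have m': "m = m' + single (e j) 1"
      by (rule poly_mapping_eqI) (use j in \<open>auto simp: m'_def lookup_add lookup_update lookup_single when_def\<close>)
    have "int (mdeg m) = d" using assms(1) m by (auto simp: hpart_def)
    then have "single m' (lookup p m) \<in> hpart (d - 1)"
      by (intro single_hpart) (auto simp: m' mdeg_add)
    from gr.gspan_gen[OF j(1) this, of "\<lambda>i. Var (e i)"] show ?thesis using m' by (simp add: Var_def mult_single)
  qed
  then have "(\<Sum>m\<in>keys p. single m (lookup p m))
      \<in> gr.gspan (\<lambda>i. Var (e i)) n 1 d" by (rule gr.gspan_sum)
  then show ?thesis by (subst poly_mapping_sum_single)
qed

lemma gspan_VarD:
  fixes p :: "('x, 'k::comm_ring_1) mpoly"
  assumes "p \<in> gr.gspan (\<lambda>i. Var (e i)) n 1 d" "m \<in> keys p"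
  shows "\<exists>j<n. lookup m (e j) \<noteq> 0"
proof -
  obtain v where v: "p = (\<Sum>j<n. v j * Var (e j))" using assms(1) by (rule gr.gspanE)
  have "m \<in> (\<Union>j<n. keys (v j * Var (e j)))"
    using assms(2) Poly_Mapping.keys_sum[of "\<lambda>j. v j * Var (e j)" "{..<n}"] unfolding v by blast
  then obtain j where j: "j < n" "m \<in> keys (v j * Var (e j))" by blast
  then obtain a b where ab: "m = a + b" "b \<in> keys (Var (e j) :: ('x, 'k) mpoly)"
    using keys_mult[of "v j" "Var (e j)"] by blast
  then have "b = single (e j) 1" by (auto simp: Var_def split: if_splits)
  then show ?thesis using ab j by (auto simp: lookup_add)
qed

text \<open>Membership in an ideal of variables is decided monomial by monomial. Multiplication by
  \<open>Var (e i)\<close> cannot create divisibility by an earlier variable, as the variables are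
  distinct.\<close>

lemma gregular_Var:
  assumes "inj_on e {..<n}"
  shows "gr.gregular (\<lambda>i. Var (e i) :: ('x, 'k::comm_ring_1) mpoly) n 1"
  unfolding gr.gregular_def
proof (intro conjI allI impI ballI)
  show "Var (e i) \<in> hpart 1" for i by simp
  fix i d and p :: "('x, 'k) mpoly"
  assume i: "i < n" and p: "p \<in> hpart d" and mem: "Var (e i) * p \<in> gr.gspan (\<lambda>i. Var (e i)) i 1 (d + 1)"
  show "p \<in> gr.gspan (\<lambda>i. Var (e i)) i 1 d"
  proof (rule gspan_VarI[OF p])
    fix m assume m: "m \<in> keys p"
    then have "single (e i) 1 + m \<in> keys (Var (e i) * p)"
      by (simp add: in_keys_iff Var_def lookup_single_mult)
    from gspan_VarD[OF mem this] obtain j where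
      j: "j < i" "lookup (single (e i) 1 + m) (e j) \<noteq> 0" by blast
    then have "e j \<noteq> e i" using i assms by (auto simp: inj_on_def)
    then show "\<exists>j<i. lookup m (e j) \<noteq> 0"
      using j by (auto simp: lookup_add lookup_single)
  qed
qed

lemma hpart_0_iff: "p \<in> hpart 0 \<longleftrightarrow> (\<exists>c. p = single 0 c)"
  by (auto elim: hpart_0E)

lemma gspan_eq_span:
  "gr.gspan F n e e = mpoly.span (F ` {..<n} :: ('x, 'k::field) mpoly set)"
proof (intro Set.set_eqI iffI)
  fix p assume "p \<in> gr.gspan F n e e"
  then obtain v where v: "\<And>j. v j \<in> hpart 0" "p = (\<Sum>j<n. v j * F j)" by (rule gr.gspanE) auto
  from v(1) obtain c where "\<And>j. v j = single 0 (c j)" unfolding hpart_0_iff by metis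
  then have "p = (\<Sum>j<n. smult (c j) (F j))" using v(2) by (simp add: smult_def)
  then show "p \<in> mpoly.span (F ` {..<n})" unfolding mpoly.span_family by (intro exI)
next
  fix p assume "p \<in> mpoly.span (F ` {..<n})"
  then obtain c where "p = (\<Sum>j<n. smult (c j) (F j))" unfolding mpoly.span_family by blast
  then show "p \<in> gr.gspan F n e e" by (auto simp: smult_def intro!: gr.gspanI)
qed

text \<open>The Koszul matrix would have entries of negative degree \<open>d - e\<close>.\<close>

lemma gsyz_low_degree:
  assumes "gr.gsyz F n e" "d < e" "\<And>i. i < n \<Longrightarrow> u i \<in> hpart d" "(\<Sum>i<n. u i * F i) = 0" "i < n"
  shows "u i = 0"
proof -
  define u' where "u' i = (if i < n then u i else 0)" for i
  have "u' i \<in> hpart d" for i using assms(3) by (simp add: u'_def gr.zero_H)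
  moreover have "(\<Sum>i<n. u' i * F i) = 0" using assms(4) by (simp add: u'_def)
  ultimately obtain t where t: "\<And>i j. t i j \<in> hpart (d - e)"
    "\<And>i. i < n \<Longrightarrow> u' i = (\<Sum>j<n. (t i j - t j i) * F j)" using gr.gsyzE[OF assms(1)] by blast
  have "t i j = 0" for i j using gr.neg_H[OF _ t(1)] assms(2) by simp
  then show ?thesis using t(2)[OF assms(5)] assms(5) by (simp add: u'_def)
qed

lemma gregular_indep_family:
  fixes F :: "nat \<Rightarrow> ('x, 'k::field) mpoly"
  assumes "gr.gregular F n e" "0 < e"
  shows "mpoly.indep_family F n"
  unfolding mpoly.indep_family_def
proof (intro allI impI)
  fix c j assume 0: "(\<Sum>j<n. smult (c j) (F j)) = 0" and j: "j < n"
  have "single 0 (c j) = (0 :: ('x, 'k) mpoly)"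
    by (rule gsyz_low_degree[OF gr.gregular_imp_gsyz[OF assms(1)] assms(2), of "\<lambda>j. single 0 (c j)"])
      (use 0 j in \<open>auto simp: smult_def\<close>)
  then show "c j = 0" by (metis lookup_single_eq lookup_zero)
qed

text \<open>Regularity in positive degree depends only on the space that the generators span.
  Substituting one expansion into the other and comparing coefficients inverts the transition
  matrix, and regularity is carried across through Koszul syzygies.\<close>

lemma gregular_base_change:
  fixes F F' :: "nat \<Rightarrow> ('x, 'k::field) mpoly"
  assumes F: "gr.gregular F n e" and e: "0 < e"
    and F': "mpoly.indep_family F' n" "\<And>i. i < n \<Longrightarrow> F' i \<in> mpoly.span (F ` {..<n})"
  shows "gr.gregular F' n e"
proof -
  have dim: "mpoly.dim (mpoly.span (F ` {..<n})) = n"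
    by (rule mpoly.indep_family_dim[OF gregular_indep_family[OF F e]])
  have span: "mpoly.span (F' ` {..<n}) = mpoly.span (F ` {..<n})"
    by (rule mpoly.indep_family_span_eq[OF F'(1) _ _ order_refl _ dim]) (use F'(2) in auto)
  have "\<exists>c. \<forall>i<n. F' i = (\<Sum>j<n. smult (c i j) (F j))"
    using F'(2) unfolding mpoly.span_family by metis
  then obtain c where c: "\<And>i. i < n \<Longrightarrow> F' i = (\<Sum>j<n. smult (c i j) (F j))" by blast
  have "F i \<in> mpoly.span (F' ` {..<n})" if "i < n" for i
    unfolding span using that by (intro mpoly.span_base) auto
  then have "\<exists>D. \<forall>i<n. F i = (\<Sum>j<n. smult (D i j) (F' j))"
    unfolding mpoly.span_family by metis
  then obtain D where D: "\<And>i. i < n \<Longrightarrow> F i = (\<Sum>j<n. smult (D i j) (F' j))" by blast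
  have inv: "(\<Sum>j<n. c i j * D j k) = (if i = k then 1 else 0)" if ik: "i < n" "k < n" for i k
  proof -
    have "F' i = (\<Sum>j<n. \<Sum>k<n. smult (c i j * D j k) (F' k))"
      unfolding c[OF ik(1)] by (intro sum.cong refl) (simp add: D mpoly.scale_sum_right)
    also have "\<dots> = (\<Sum>k<n. smult (\<Sum>j<n. c i j * D j k) (F' k))"
      by (subst sum.swap) (simp add: mpoly.scale_sum_left)
    finally have *: "F' i = (\<Sum>k<n. smult (\<Sum>j<n. c i j * D j k) (F' k))" .
    have "(\<Sum>k<n. smult (if i = k then 1 else 0) (F' k)) = (\<Sum>k<n. if k = i then F' k else 0)"
      by (rule sum.cong) auto
    also have "\<dots> = F' i" using ik by simp
    finally have "(\<Sum>k<n. smult ((\<Sum>j<n. c i j * D j k) - (if i = k then 1 else 0)) (F' k)) = 0"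
      using * by (simp add: mpoly.scale_left_diff_distrib sum_subtractf)
    from mpoly.indep_familyD[OF F'(1) this ik(2)] show ?thesis by simp
  qed
  have "gr.gsyz F' n e"
  proof (rule gr.gsyz_base_change[OF gr.gregular_imp_gsyz[OF F]])
    show "F' i = (\<Sum>j<n. single 0 (c i j) * F j)" if "i < n" for i
      using c[OF that] by (simp add: smult_def)
    show "F i = (\<Sum>j<n. single 0 (D i j) * F' j)" if "i < n" for i
      using D[OF that] by (simp add: smult_def)
    have "(\<Sum>j<n. single 0 (c i j) * single 0 (D j k)) =
        (single 0 (\<Sum>j<n. c i j * D j k) :: ('x, 'k) mpoly)" for i k
      by (rule poly_mapping_eqI) (simp add: lookup_sum lookup_single mult_single when_def)
    then show "(\<Sum>j<n. single 0 (c i j) * single 0 (D j k)) =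
        (if i = k then 1 else (0 :: ('x, 'k) mpoly))" if "i < n" "k < n" for i k
      using inv[OF that] by simp
  qed simp_all
  then show ?thesis by (rule gr.gsyz_imp_gregular[OF e])
qed

abbreviation var6 :: "nat \<Rightarrow> 'k::comm_ring_1 poly6" where
  "var6 i \<equiv> Var (of_nat i)"

lemma inj_of_nat_6: "inj_on (of_nat :: nat \<Rightarrow> 6) {..<6}"
  by (auto simp: lessThan_def numeral_eq_Suc less_Suc_eq inj_on_def)

lemma range_of_nat_6: "(of_nat :: nat \<Rightarrow> 6) ` {..<6} = UNIV"
proof (rule card_subset_eq)
  show "card ((of_nat :: nat \<Rightarrow> 6) ` {..<6}) = card (UNIV :: 6 set)"
    by (simp add: card_image[OF inj_of_nat_6])
qed auto

lemma gregular_var6: "gr.gregular var6 6 1"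
  by (rule gregular_Var[OF inj_of_nat_6])

lemma hpart_eq_gspan_var6:
  assumes "0 < d"
  shows "hpart d = gr.gspan (var6 :: nat \<Rightarrow> 'k::comm_ring_1 poly6) 6 1 d"
proof (intro Set.set_eqI iffI)
  fix p :: "'k poly6" assume p: "p \<in> hpart d"
  show "p \<in> gr.gspan var6 6 1 d"
  proof (rule gspan_VarI[OF p])
    fix m assume "m \<in> keys p"
    then have "int (mdeg m) = d" using p by (auto simp: hpart_def)
    then have "m \<noteq> 0" using assms by auto
    then obtain i where "lookup m i \<noteq> 0" by (metis lookup_zero poly_mapping_eqI)
    moreover obtain j where "j < 6" "i = of_nat j" using range_of_nat_6 by (metis UNIV_I imageE lessThan_iff)
    ultimately show "\<exists>j<6. lookup m (of_nat j) \<noteq> 0" by blast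
  qed
qed (auto intro: gr.gspan_H[of 6 var6 1])

lemma hpart_1_eq_span: "hpart 1 = mpoly.span ((var6 :: nat \<Rightarrow> 'k::field poly6) ` {..<6})"
  by (simp only: hpart_eq_gspan_var6[OF zero_less_one] gspan_eq_span)

lemma dim_hpart_1: "mpoly.dim (hpart 1 :: 'k::field poly6 set) = 6"
  unfolding hpart_1_eq_span by (rule mpoly.indep_family_dim[OF gregular_indep_family[OF gregular_var6]]) simp

text \<open>Completed to a basis of the linear forms, the family is a base change of the six
  variables, and prefixes of regular sequences are regular.\<close>

lemma gregular_linear_forms:
  fixes z :: "nat \<Rightarrow> 'k::field poly6"
  assumes ind: "mpoly.indep_family z k" and z: "\<And>i. i < k \<Longrightarrow> z i \<in> hpart 1"
  shows "gr.gregular z k 1"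
proof -
  have sub: "z ` {..<k} \<subseteq> hpart 1" using z by auto
  from mpoly.maximal_independent_subset_extend[OF sub mpoly.indep_family_independent[OF ind]]
  obtain B where B: "z ` {..<k} \<subseteq> B" "B \<subseteq> hpart 1" "mpoly.independent B" "hpart 1 \<subseteq> mpoly.span B" by auto
  have cB: "card B = 6" using mpoly.basis_card_eq_dim[OF B(2,4,3)] dim_hpart_1 by simp
  have fB: "finite B" using cB card.infinite by fastforce
  have ck: "card (z ` {..<k}) = k" using card_image[OF mpoly.indep_family_inj[OF ind]] by simp
  then have k6: "k \<le> 6" using card_mono[OF fB B(1)] cB by simp
  have "card (B - z ` {..<k}) = 6 - k" using B(1) fB cB ck by (simp add: card_Diff_subset finite_subset)
  then have "\<exists>h. bij_betw h {k..<6} (B - z ` {..<k})"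
    using fB by (intro finite_same_card_bij) auto
  then obtain h where h: "bij_betw h {k..<6} (B - z ` {..<k})" by blast
  define z' where "z' i = (if i < k then z i else h i)" for i
  have un: "{..<6} = {..<k} \<union> {k..<6}" using k6 by auto
  have im: "z' ` {..<6} = B"
  proof -
    have "z' ` {..<k} = z ` {..<k}" by (auto simp: z'_def)
    moreover have "z' ` {k..<6} = h ` {k..<6}" by (auto simp: z'_def)
    ultimately show ?thesis using h B(1) unfolding un image_Un by (auto simp: bij_betw_def)
  qed
  have "inj_on z' {..<6}" using im cB by (intro eq_card_imp_inj_on) auto
  then have "mpoly.indep_family z' 6" using im B(3) by (intro mpoly.indep_familyI) auto
  moreover have "z' i \<in> mpoly.span (var6 ` {..<6})" if "i < 6" for i
    using im B(2) that unfolding hpart_1_eq_span by blast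
  ultimately have "gr.gregular z' 6 1" by (intro gregular_base_change[OF gregular_var6]) auto
  then have "gr.gregular z' k 1" using k6 by (rule gr.gregular_prefix)
  moreover have "gr.gspan z' i 1 d = gr.gspan z i 1 d" if "i \<le> k" for i d
    using that by (auto simp: gr.gspan_def z'_def)
  ultimately show ?thesis unfolding gr.gregular_def by (simp add: z'_def)
qed

section \<open>Dimension counts\<close>

interpretation mpolys: vector_space_pair
  "smult :: 'k::field \<Rightarrow> ('x, 'k) mpoly \<Rightarrow> ('x, 'k) mpoly" "smult :: 'k \<Rightarrow> ('y, 'k) mpoly \<Rightarrow> ('y, 'k) mpoly"
  by unfold_locales

lemma linear_mult_right: "Vector_Spaces.linear smult smult (\<lambda>m :: ('x, 'k::field) mpoly. m * q)"
  by (auto simp: Vector_Spaces.linear_iff smult_mult_left distrib_right intro: mpoly.vector_space_axioms)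

lemma hpart_finite_span:
  obtains G where "finite G" "hpart d \<subseteq> mpoly.span (G :: 'k::field poly6 set)"
proof -
  have "\<exists>G. finite G \<and> hpart (int n) \<subseteq> mpoly.span (G :: 'k poly6 set)" for n
  proof (induction n)
    case 0
    have "hpart 0 \<subseteq> mpoly.span {1 :: 'k poly6}"
      unfolding mpoly.span_singleton by (auto simp: hpart_0_iff smult_def)
    then show ?case by (metis finite.emptyI finite.insertI of_nat_0)
  next
    case (Suc n)
    then obtain G where G: "finite G" "hpart (int n) \<subseteq> mpoly.span (G :: 'k poly6 set)" by blast
    define G' where "G' = (\<Union>j<6. (\<lambda>m. m * var6 j) ` G)"
    have "v * var6 j \<in> mpoly.span G'" if "v \<in> hpart (int n)" "j < 6" for v j
    proof -
      have "v * var6 j \<in> (\<lambda>m. m * var6 j) ` mpoly.span G" using that G by blast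
      also have "\<dots> = mpoly.span ((\<lambda>m. m * var6 j) ` G)"
        by (rule mpolys.linear_span_image[OF linear_mult_right, symmetric])
      also have "\<dots> \<subseteq> mpoly.span G'" using that by (intro mpoly.span_mono) (auto simp: G'_def)
      finally show ?thesis .
    qed
    then have "hpart (int (Suc n)) \<subseteq> mpoly.span G'"
      by (subst hpart_eq_gspan_var6) (auto elim!: gr.gspanE intro!: mpoly.span_sum)
    moreover have "finite G'" using G by (simp add: G'_def)
    ultimately show ?case by blast
  qed
  then obtain G where G: "finite G" "hpart (int (nat d)) \<subseteq> mpoly.span (G :: 'k poly6 set)" by blast
  have "hpart d \<subseteq> mpoly.span G"
  proof (cases "d < 0")
    case True
    then show ?thesis using gr.neg_H[OF True] mpoly.span_zero by blast
  next
    case False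
    then show ?thesis using G(2) by simp
  qed
  with G(1) show ?thesis by (rule that)
qed

lemma gspan_subspace: "mpoly.subspace (gr.gspan F n e d)"
  by (rule mpoly.subspaceI)
    (auto intro: gr.gspan_zero gr.gspan_add gr.gspan_mult'[where c = 0] simp: smult_def)

lemma hpart_dim_mono: "A \<subseteq> B \<Longrightarrow> B \<subseteq> hpart d \<Longrightarrow> mpoly.dim A \<le> mpoly.dim (B :: 'k::field poly6 set)"
  using hpart_finite_span[of d] mpoly.dim_mono_finite by (metis subset_trans)

lemma dim_add_multiples:
  fixes M :: "'k::field poly6 set"
  assumes "mpoly.subspace M" "M \<subseteq> hpart d"
  shows "mpoly.dim {x + m * q |x m. x \<in> M \<and> m \<in> hpart 1} + mpoly.dim {m \<in> hpart 1. m * q \<in> M}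
    = mpoly.dim M + 6"
proof -
  obtain G where G: "finite G" "hpart d \<subseteq> mpoly.span (G :: 'k poly6 set)" by (rule hpart_finite_span)
  have G': "M \<subseteq> mpoly.span G" using G assms by blast
  have V: "hpart 1 \<subseteq> mpoly.span (var6 ` {..<6} :: 'k poly6 set)" by (simp add: hpart_1_eq_span)
  show ?thesis
    using mpolys.dim_sum_image[OF linear_mult_right[of q] hpart_subspace V _ assms(1) G' G(1)]
    by (simp add: dim_hpart_1)
qed

lemma add_multiples_subspace:
  assumes "mpoly.subspace M"
  shows "mpoly.subspace {x + m * q |x m. x \<in> M \<and> m \<in> hpart 1}"
proof -
  interpret T: Vector_Spaces.linear smult smult "\<lambda>m. m * q" by (rule linear_mult_right)
  have "{x + m * q |x m. x \<in> M \<and> m \<in> hpart 1} = {x + y |x y. x \<in> M \<and> y \<in> (\<lambda>m. m * q) ` hpart 1}" by blast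
  then show ?thesis using mpoly.subspace_sums[OF assms T.subspace_image[OF hpart_subspace]] by simp
qed

lemma add_multiples_hpart:
  assumes "M \<subseteq> hpart (d + 1)" "q \<in> hpart d"
  shows "{x + m * q |x m. x \<in> M \<and> m \<in> hpart 1} \<subseteq> hpart (d + 1)"
  using assms gr.mult_H'[of _ 1 q d "d + 1"] by (auto intro!: gr.add_H)

lemma annihilator_subspace:
  assumes "mpoly.subspace M"
  shows "mpoly.subspace {m \<in> hpart 1. m * q \<in> M}"
proof -
  interpret T: Vector_Spaces.linear smult smult "\<lambda>m. m * q" by (rule linear_mult_right)
  show ?thesis
    using mpoly.subspace_inter[OF hpart_subspace T.subspace_linear_preimage[OF assms]] by (simp add: Int_def)
qed

text \<open>\<open>t + 1\<close> independent annihilating linear forms would be a regular sequence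
  longer than the degree of \<open>c\<close>, which \<open>koszul_torsion_free\<close>
  excludes.\<close>

lemma dim_annihilator_le:
  fixes F :: "nat \<Rightarrow> 'k::field poly6"
  assumes F: "gr.gregular F n 2" and c: "c \<in> hpart (int t)" "c \<notin> gr.gspan F n 2 (int t)"
  shows "mpoly.dim {m \<in> hpart 1. m * c \<in> gr.gspan F n 2 (int t + 1)} \<le> t"
proof (rule ccontr)
  let ?A = "{m \<in> hpart 1. m * c \<in> gr.gspan F n 2 (int t + 1)}"
  assume "\<not> mpoly.dim ?A \<le> t"
  then have dim: "Suc t \<le> mpoly.dim ?A" by simp
  obtain G where G: "finite G" "hpart 1 \<subseteq> mpoly.span (G :: 'k poly6 set)" by (rule hpart_finite_span)
  have "?A \<subseteq> mpoly.span G" using G by blast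
  from mpoly.dim_imp_indep_family[OF annihilator_subspace[OF gspan_subspace] this G(1) dim]
  obtain z where z: "mpoly.indep_family z (Suc t)" "z ` {..<Suc t} \<subseteq> ?A" .
  have "gr.gregular z (Suc t) 1" using z by (intro gregular_linear_forms) auto
  then have "c \<in> gr.gspan F n 2 (int t)"
    using z(2) by (intro gr.koszul_torsion_free[OF _ F c(1)]) auto
  with c(2) show False by contradiction
qed

text \<open>Each further quadric adds six dimensions: if a linear form times \<open>F n\<close> lies
  in the earlier ideal, regularity puts the linear form there too, and that ideal is zero in degree
  1.\<close>

lemma dim_ideal_degree_3:
  fixes F :: "nat \<Rightarrow> 'k::field poly6"
  assumes "gr.gregular F n 2"
  shows "mpoly.dim (gr.gspan F n 2 3) = 6 * n"
  using assms
proof (induction n)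
  case 0
  show ?case using mpoly.dim_eq_card_independent[OF mpoly.independent_empty]
    by (metis gr.gspan_0 card.empty mpoly.dim_span mpoly.span_empty mult_0_right)
next
  case (Suc n)
  note reg = gr.gregular_prefix[OF Suc.prems, of n]
  have FH: "F i \<in> hpart 2" if "i < Suc n" for i using gr.gregular_H[OF Suc.prems that] .
  have sub: "gr.gspan F n 2 3 \<subseteq> hpart 3" using gr.gspan_H[of n F 2] FH by auto
  have eq: "{x + m * F n |x m. x \<in> gr.gspan F n 2 3 \<and> m \<in> hpart 1} = gr.gspan F (Suc n) 2 3"
  proof safe
    fix x and m :: "'k poly6" assume "x \<in> gr.gspan F n 2 3" "m \<in> hpart 1"
    then show "x + m * F n \<in> gr.gspan F (Suc n) 2 3"
      using gr.gspan_gen[of n "Suc n" m 3 2 F] gr.gspan_mono_Suc by (intro gr.gspan_add) auto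
  next
    fix x assume "x \<in> gr.gspan F (Suc n) 2 3"
    then show "\<exists>y m. x = y + m * F n \<and> y \<in> gr.gspan F n 2 3 \<and> m \<in> hpart 1"
      by (rule gr.gspan_SucE) auto
  qed
  have "m = 0" if "m \<in> hpart 1" "m * F n \<in> gr.gspan F n 2 3" for m
  proof -
    have "m \<in> gr.gspan F n 2 1"
      using gr.gregularD[OF Suc.prems lessI that(1)] that(2) by (simp add: mult.commute)
    then obtain v where v: "\<And>j. v j \<in> hpart (1 - 2)" "m = (\<Sum>j<n. v j * F j)" by (rule gr.gspanE) auto
    have "v j = 0" for j using gr.neg_H[OF _ v(1)] by simp
    then show "m = 0" using v(2) by simp
  qed
  then have ker: "{m \<in> hpart 1. m * F n \<in> gr.gspan F n 2 3} = {0}"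
    by (auto intro: gr.zero_H gr.gspan_zero)
  have "mpoly.dim {0 :: 'k poly6} = 0"
    by (metis card.empty mpoly.dim_eq_card_independent mpoly.dim_span mpoly.independent_empty mpoly.span_empty)
  then show ?case
    using dim_add_multiples[OF gspan_subspace sub, of "F n"] Suc.IH[OF reg] unfolding eq ker by simp
qed

abbreviation (input) cubics :: "(nat \<Rightarrow> 'k poly6) \<Rightarrow> 'k::field poly6 \<Rightarrow> 'k poly6 \<Rightarrow> 'k poly6 set" where
  "cubics F g h \<equiv> {x + m * g + m' * h |x m m'. x \<in> gr.gspan F 6 2 3 \<and> m \<in> hpart 1 \<and> m' \<in> hpart 1}"

text \<open>36 + (6 - 2) + (6 - 3) = 43, where the losses bound the annihilators of the quadric
  \<open>g\<close> and of the cubic \<open>l * h\<close>, both outside the ideal.\<close>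

lemma dim_ge_43_single_annihilator:
  fixes F :: "nat \<Rightarrow> 'k::field poly6"
  assumes F: "gr.gregular F 6 2"
    and gh: "g \<in> hpart 2" "h \<in> hpart 2" and g: "g \<notin> gr.gspan F 6 2 2"
    and l: "l \<in> hpart 1" "l * g \<in> gr.gspan F 6 2 3" "l * h \<notin> gr.gspan F 6 2 3"
  shows "43 \<le> mpoly.dim (cubics F g h)"
proof -
  let ?N = "gr.gspan F 6 2 3"
  have NH: "gr.gspan F 6 2 d \<subseteq> hpart d" for d using gr.gspan_H[of 6 F 2] gr.gregular_H[OF F] by auto
  define M where "M = {x + m * g |x m. x \<in> ?N \<and> m \<in> hpart 1}"
  have M: "mpoly.subspace M" unfolding M_def by (rule add_multiples_subspace[OF gspan_subspace])
  have MH: "M \<subseteq> hpart 3" unfolding M_def using add_multiples_hpart[of ?N 2 g] NH gh(1) by simp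
  have "mpoly.dim {m \<in> hpart 1. m * g \<in> ?N} \<le> 2" using dim_annihilator_le[OF F, of g 2] gh g by simp
  then have M40: "40 \<le> mpoly.dim M"
    using dim_add_multiples[OF gspan_subspace NH, of g 3] dim_ideal_degree_3[OF F] unfolding M_def by simp
  \<comment> \<open>Multiplying by \<open>l\<close> removes the unknown multiple of
    \<open>g\<close>, because \<open>l * g\<close> is in the ideal.\<close>
  have "{m \<in> hpart 1. m * h \<in> M} \<subseteq> {m \<in> hpart 1. m * (l * h) \<in> gr.gspan F 6 2 4}"
  proof safe
    fix m assume m: "m \<in> hpart 1" "m * h \<in> M"
    then obtain x m' where x: "x \<in> ?N" "m' \<in> hpart 1" "m * h = x + m' * g" by (auto simp: M_def)
    have "m * (l * h) = l * x + m' * (l * g)" 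
    proof -
      have "m * (l * h) = l * (m * h)" by (simp only: mult_ac)
      then show ?thesis unfolding x(3) distrib_left by (simp only: mult_ac)
    qed
    also have "\<dots> \<in> gr.gspan F 6 2 4"
      using gr.gspan_mult[OF x(1) l(1)] gr.gspan_mult[OF l(2) x(2)] by (simp add: gr.gspan_add)
    finally show "m * (l * h) \<in> gr.gspan F 6 2 4" .
  qed
  then have "mpoly.dim {m \<in> hpart 1. m * h \<in> M} \<le> mpoly.dim {m \<in> hpart 1. m * (l * h) \<in> gr.gspan F 6 2 4}"
    by (rule hpart_dim_mono[of _ _ 1]) auto
  also have "\<dots> \<le> 3" using dim_annihilator_le[OF F, of "l * h" 3] l gr.mult_H[OF l(1) gh(2)] by simp
  finally have "43 \<le> mpoly.dim {x + m * h |x m. x \<in> M \<and> m \<in> hpart 1}"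
    using dim_add_multiples[OF M MH, of h] M40 by simp
  moreover have "{x + m * h |x m. x \<in> M \<and> m \<in> hpart 1} =
      {x + m * g + m' * h |x m m'. x \<in> ?N \<and> m \<in> hpart 1 \<and> m' \<in> hpart 1}"
    unfolding M_def by blast
  ultimately show ?thesis by simp
qed

text \<open>An eigenvector of the map \<open>\<psi>\<close> with \<open>\<psi> m * g + m * h\<close> in the ideal, found as in the
  textbook proof: factor a polynomial relation of least degree between the iterates of \<open>\<psi>\<close>.\<close>

lemma pencil_annihilator_exists:
  fixes F :: "nat \<Rightarrow> 'k::alg_closed_field poly6"
  assumes F: "gr.gregular F 6 2" and gh: "g \<in> hpart 2" "h \<in> hpart 2"
    and small: "mpoly.dim (cubics F g h) \<le> 42"
  obtains l a b where "l \<in> hpart 1" "l \<noteq> 0" "a \<noteq> 0 \<or> b \<noteq> 0" "l * (smult a g + smult b h) \<in> gr.gspan F 6 2 3"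
proof (cases "\<exists>l\<in>hpart 1. l \<noteq> 0 \<and> l * g \<in> gr.gspan F 6 2 3")
  case True
  then obtain l where "l \<in> hpart 1" "l \<noteq> 0" "l * g \<in> gr.gspan F 6 2 3" by blast
  then show ?thesis using that[of l 1 0] by simp
next
  case False
  let ?N = "gr.gspan F 6 2 3"
  have NH: "?N \<subseteq> hpart 3" using gr.gspan_H[of 6 F 2] gr.gregular_H[OF F] by auto
  define M where "M = {x + m * g |x m. x \<in> ?N \<and> m \<in> hpart 1}"
  have M: "mpoly.subspace M" unfolding M_def by (rule add_multiples_subspace[OF gspan_subspace])
  have MH: "M \<subseteq> hpart 3" unfolding M_def using add_multiples_hpart[of ?N 2 g] NH gh(1) by simp
  have "{m \<in> hpart 1. m * g \<in> ?N} \<subseteq> mpoly.span ({} :: 'k poly6 set)" using False by auto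
  then have "mpoly.dim {m \<in> hpart 1. m * g \<in> ?N} \<le> card ({} :: 'k poly6 set)" by (rule mpoly.dim_le_card) simp
  then have M42: "mpoly.dim M = 42"
    using dim_add_multiples[OF gspan_subspace NH, of g] dim_ideal_degree_3[OF F] unfolding M_def by simp
  \<comment> \<open>The ideal and the multiples of \<open>g\<close> already account for 36 + 6 = 42
    dimensions, so the multiples of \<open>h\<close> add nothing and \<open>U\<close> has to contain
    all linear forms.\<close>
  define U where "U = {m \<in> hpart 1. m * h \<in> M}"
  have "{x + m * h |x m. x \<in> M \<and> m \<in> hpart 1} =
      {x + m * g + m' * h |x m m'. x \<in> ?N \<and> m \<in> hpart 1 \<and> m' \<in> hpart 1}"
    unfolding M_def by blast
  then have U6: "6 \<le> mpoly.dim U"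
    using dim_add_multiples[OF M MH, of h] M42 small unfolding U_def by simp
  have Us: "mpoly.subspace U" unfolding U_def by (rule annihilator_subspace[OF M])
  have V: "hpart 1 \<subseteq> mpoly.span (var6 ` {..<6} :: 'k poly6 set)" by (simp add: hpart_1_eq_span)
  have UV: "U \<subseteq> hpart 1" by (auto simp: U_def)
  obtain e where e: "mpoly.indep_family e 6" "e ` {..<6} \<subseteq> U"
    using mpoly.dim_imp_indep_family[OF Us _ _ U6, of "var6 ` {..<6}"] UV V by blast
  have "mpoly.span (e ` {..<6}) = hpart 1"
    using mpoly.indep_family_span_eq[OF e(1) _ hpart_subspace V _ dim_hpart_1] e(2) UV by blast
  then have U: "hpart 1 \<subseteq> U" using mpoly.span_minimal[OF e(2) Us] by simp
  have "\<exists>m\<in>hpart 1. m * g + m' * h \<in> ?N" if "m' \<in> hpart 1" for m'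
  proof -
    have "m' \<in> U" using U that by blast
    then obtain x m where "x \<in> ?N" "m \<in> hpart 1" "m' * h = x + m * g"
      by (auto simp: U_def M_def)
    then show ?thesis by (intro bexI[of _ "- m"]) (auto intro: gr.uminus_H)
  qed
  \<comment> \<open>The choice is pointwise. Linearity of \<open>\<psi>\<close> does not enter: the
    relations between consecutive iterates are combined linearly afterwards.\<close>
  then obtain \<psi> where \<psi>: "\<And>m. m \<in> hpart 1 \<Longrightarrow> \<psi> m \<in> hpart 1" "\<And>m. m \<in> hpart 1 \<Longrightarrow> \<psi> m * g + m * h \<in> ?N"
    by metis
  define v where "v i = (\<psi> ^^ i) (var6 0 :: 'k poly6)" for i
  have vH: "v i \<in> hpart 1" for i by (induction i) (auto simp: v_def intro: \<psi>)
  have vrel: "v (Suc i) * g + v i * h \<in> ?N" for i using \<psi>(2)[OF vH[of i]] by (simp add: v_def)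
  have v0: "v 0 \<noteq> 0"
  proof
    assume "v 0 = 0"
    then have "lookup (v 0) (single 0 1) = 0" by simp
    then show False by (simp add: v_def Var_def)
  qed
  \<comment> \<open>\<open>R p\<close> says that \<open>p\<close> evaluated at \<open>\<psi>\<close>
    kills the starting vector, written out through the iterates. Seven iterates in a space of
    dimension six yield such a \<open>p\<close>.\<close>
  define R where "R p \<longleftrightarrow> p \<noteq> 0 \<and> (\<Sum>i\<le>Polynomial.degree p. smult (poly.coeff p i) (v i)) = 0" for p :: "'k Polynomial.poly"
  have "\<exists>p. R p"
  proof -
    have "\<not> mpoly.indep_family v 7"
    proof
      assume "mpoly.indep_family v 7"
      then have "7 \<le> mpoly.dim (hpart 1 :: 'k poly6 set)"
        by (rule mpoly.indep_family_le_dim[OF _ _ V]) (use vH in auto)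
      then show False by (simp add: dim_hpart_1)
    qed
    then obtain c k where c: "(\<Sum>i<7. smult (c i) (v i)) = 0" "k < 7" "c k \<noteq> 0"
      unfolding mpoly.indep_family_def by blast
    define p where "p = (\<Sum>i<7. Polynomial.monom (c i) i)"
    have co: "poly.coeff p i = (if i < 7 then c i else 0)" for i
      by (auto simp: p_def coeff_sum)
    have "p \<noteq> 0" using co[of k] c by auto
    moreover have "(\<Sum>i\<le>Polynomial.degree p. smult (poly.coeff p i) (v i)) = (\<Sum>i<7. smult (c i) (v i))"
    proof (rule sum.mono_neutral_cong)
      show "smult (poly.coeff p i) (v i) = 0" if "i \<in> {..Polynomial.degree p} - {..<7}" for i
        using that by (simp add: co)
      show "smult (c i) (v i) = 0" if "i \<in> {..<7} - {..Polynomial.degree p}" for i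
        using that co[of i] coeff_eq_0[of p i] by auto
    qed (auto simp: co)
    ultimately show ?thesis using c(1) by (auto simp: R_def)
  qed
  then obtain p where p: "R p" "\<And>q. Polynomial.degree q < Polynomial.degree p \<Longrightarrow> \<not> R q"
    using ex_has_least_nat[of R _ Polynomial.degree] by (metis not_le)
  have "Polynomial.degree p \<noteq> 0"
  proof
    assume "Polynomial.degree p = 0"
    then show False using p(1) v0 by (auto simp: R_def elim!: degree_eq_zeroE)
  qed
  then obtain x where "poly p x = 0" using alg_closed_imp_poly_has_root[of p] by blast
  then obtain q where q: "p = [:- x, 1:] * q" unfolding poly_eq_0_iff_dvd by (auto elim: dvdE)
  have q0: "q \<noteq> 0" using p(1) q by (auto simp: R_def)
  define n where "n = Polynomial.degree p"
  have n: "n = Suc (Polynomial.degree q)"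
    unfolding n_def q using q0 by (subst degree_mult_eq) auto
  \<comment> \<open>\<open>u\<close> is the value of the cofactor \<open>q\<close>, nonzero because
    \<open>q\<close> has smaller degree than the minimal relation. As \<open>p\<close> vanishes on
    the iterates, shifting them in \<open>u\<close> amounts to multiplication by the root
    \<open>x\<close>, so \<open>u\<close> is the eigenvector.\<close>
  define u where "u = (\<Sum>i<n. smult (poly.coeff q i) (v i))"
  have uH: "u \<in> hpart 1" unfolding u_def by (intro gr.sum_H smult_hpart vH)
  have "u \<noteq> 0" using p(2)[of q] q0 n by (auto simp: R_def u_def lessThan_Suc_atMost n_def)
  have "(\<Sum>i\<le>n. smult (poly.coeff p i) (v i)) =
      (\<Sum>i\<le>n. smult (poly.coeff (pCons 0 q) i) (v i)) - smult x (\<Sum>i\<le>n. smult (poly.coeff q i) (v i))"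
    unfolding mpoly.scale_sum_right sum_subtractf[symmetric] q
    by (intro sum.cong refl) (simp add: mpoly.scale_left_diff_distrib)
  also have "(\<Sum>i\<le>n. smult (poly.coeff (pCons 0 q) i) (v i)) = (\<Sum>i<n. smult (poly.coeff q i) (v (Suc i)))"
    by (subst sum.atMost_shift) simp
  also have "(\<Sum>i\<le>n. smult (poly.coeff q i) (v i)) = u"
    using n by (simp add: u_def lessThan_Suc_atMost[symmetric] coeff_eq_0)
  finally have shift: "(\<Sum>i<n. smult (poly.coeff q i) (v (Suc i))) = smult x u"
    using p(1) by (simp add: R_def n_def)
  have "(\<Sum>i<n. smult (poly.coeff q i) (v (Suc i) * g + v i * h)) \<in> ?N"
    by (rule mpoly.subspace_sum[OF gspan_subspace], rule mpoly.subspace_scale[OF gspan_subspace vrel])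
  also have "(\<Sum>i<n. smult (poly.coeff q i) (v (Suc i) * g + v i * h))
      = (\<Sum>i<n. smult (poly.coeff q i) (v (Suc i))) * g + u * h"
    by (simp add: u_def mpoly.scale_right_distrib sum.distrib sum_distrib_right smult_mult_left)
  also have "\<dots> = u * (smult x g + smult 1 h)"
    unfolding shift by (simp add: distrib_left smult_mult_left smult_mult_right)
  finally show ?thesis using that[OF uH \<open>u \<noteq> 0\<close>, of x 1] by simp
qed

section \<open>A linear form annihilating the whole pencil\<close>

text \<open>This is the classical dichotomy for spaces of matrices of rank at most one, the pairs
  being their two columns: a common kernel or a common image line. Starting from a pair with
  \<open>y0 = k x0\<close>, either \<open>y = k x\<close> throughout, or one pair with
  \<open>y - k x\<close> nonzero forces everything onto the line of \<open>x0\<close>.\<close>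

lemma (in vector_space) dependent_pairs:
  assumes add: "\<And>x y x' y'. (x, y) \<in> S \<Longrightarrow> (x', y') \<in> S \<Longrightarrow> (x + x', y + y') \<in> S"
    and dep: "\<And>x y. (x, y) \<in> S \<Longrightarrow> \<exists>s t. (s \<noteq> 0 \<or> t \<noteq> 0) \<and> scale s x + scale t y = 0"
  shows "(\<exists>s t. (s \<noteq> 0 \<or> t \<noteq> 0) \<and> (\<forall>(x, y)\<in>S. scale s x + scale t y = 0)) \<or>
    (\<exists>(v, w)\<in>S. v \<noteq> 0 \<and> (\<forall>(x, y)\<in>S. x \<in> span {v} \<and> y \<in> span {v}))"
proof (cases "\<forall>(x, y)\<in>S. x = 0")
  case True
  then have "\<forall>(x, y)\<in>S. scale 1 x + scale 0 y = 0" by auto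
  then show ?thesis by (intro disjI1 exI[of _ 1] exI[of _ 0]) simp
next
  case False
  then obtain x0 y0 where 0: "(x0, y0) \<in> S" "x0 \<noteq> 0" by blast
  obtain s t where st: "s \<noteq> 0 \<or> t \<noteq> 0" "scale s x0 + scale t y0 = 0" using dep[OF 0(1)] by blast
  have "t \<noteq> 0" using st 0 by auto
  have "scale (1 / t) (scale s x0 + scale t y0) = 0" by (simp add: st)
  then have "scale (s / t) x0 + y0 = 0" using \<open>t \<noteq> 0\<close> by (simp add: scale_right_distrib)
  then have y0: "y0 = scale (- s / t) x0" by (simp add: add_eq_0_iff)
  define k where "k = - s / t"
  show ?thesis
  proof (cases "\<forall>(x, y)\<in>S. y = scale k x")
    case True
    then have "\<forall>(x, y)\<in>S. scale (- k) x + scale 1 y = 0" by auto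
    then show ?thesis by (intro disjI1 exI[of _ "- k"] exI[of _ 1]) simp
  next
    case False
    then obtain x1 y1 where 1: "(x1, y1) \<in> S" "y1 - scale k x1 \<noteq> 0" by force
    have mult: "\<exists>c. x = scale c (y - scale k x)" if xy: "(x, y) \<in> S" "y - scale k x \<noteq> 0" for x y
    proof -
      obtain s t where st: "s \<noteq> 0 \<or> t \<noteq> 0" "scale s x + scale t y = 0" using dep[OF xy(1)] by blast
      have eq: "scale (s + t * k) x + scale t (y - scale k x) = 0"
        using st(2) by (simp add: scale_left_distrib scale_right_diff_distrib)
      have ne: "s + t * k \<noteq> 0"
      proof
        assume *: "s + t * k = 0"
        then have "t = 0" using eq xy(2) by simp
        then show False using * st(1) by simp
      qed
      have "scale (1 / (s + t * k)) (scale (s + t * k) x + scale t (y - scale k x)) = 0" by (simp add: eq)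
      then have "x + scale (t / (s + t * k)) (y - scale k x) = 0"
        using ne by (simp add: scale_right_distrib)
      then have "x = scale (- (t / (s + t * k))) (y - scale k x)" by (simp add: add_eq_0_iff2)
      then show ?thesis by (intro exI)
    qed
    have sp: "x \<in> span {x0} \<and> y - scale k x \<in> span {x0}" if xy: "(x, y) \<in> S" "y - scale k x \<noteq> 0" for x y
    proof -
      define d where "d = y - scale k x"
      obtain c where c: "x = scale c d" using mult[OF xy] by (auto simp: d_def)
      \<comment> \<open>Adding \<open>(x0, y0)\<close> leaves \<open>y - k x\<close> unchanged, so
        \<open>x\<close> and \<open>x + x0\<close> are multiples of the same vector
        \<open>d\<close>, and so is their difference \<open>x0\<close>.\<close>
      have d': "(y + y0) - scale k (x + x0) = d" by (simp add: y0 k_def d_def scale_right_distrib)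
      obtain c' where c': "x + x0 = scale c' d"
        using mult[OF add[OF xy(1) 0(1)]] xy(2) unfolding d' by (auto simp: d_def)
      have "scale c' d - scale c d = x0" unfolding c'[symmetric] c[symmetric] by simp
      then have x0: "scale (c' - c) d = x0" by (simp only: scale_left_diff_distrib)
      have ne: "c' - c \<noteq> 0"
      proof
        assume "c' - c = 0"
        then show False using x0 0(2) by simp
      qed
      have "scale (1 / (c' - c)) x0 = d" unfolding x0[symmetric] using ne by simp
      then have d: "d \<in> span {x0}" using span_scale[OF span_base[of x0 "{x0}"], of "1 / (c' - c)"] by simp
      show ?thesis using span_scale[OF d, of c] d unfolding c[symmetric] by (simp add: d_def)
    qed
    have "x \<in> span {x0} \<and> y \<in> span {x0}" if xy: "(x, y) \<in> S" for x y
    proof -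
      have x: "x \<in> span {x0}" and d: "y - scale k x \<in> span {x0}"
      proof -
        show "y - scale k x \<in> span {x0}" using sp[OF xy] span_zero by (cases "y - scale k x = 0") auto
        show "x \<in> span {x0}"
        proof (cases "y - scale k x = 0")
          case True
          \<comment> \<open>When \<open>y - k x\<close> vanishes, adding the pair
            \<open>(x1, y1)\<close> leads back to the case already treated.\<close>
          then have e: "(y + y1) - scale k (x + x1) = y1 - scale k x1"
            by (simp add: scale_right_distrib)
          have "(y + y1) - scale k (x + x1) \<noteq> 0" unfolding e by (rule 1(2))
          then have "x + x1 \<in> span {x0}" using sp[OF add[OF xy 1(1)]] by blast
          moreover have "x1 \<in> span {x0}" using sp[OF 1] by simp
          ultimately show ?thesis using span_diff by fastforce
        qed (use sp[OF xy] in blast)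
      qed
      have "y = (y - scale k x) + scale k x" by simp
      then show ?thesis using x span_add[OF d span_scale[OF x, of k]] by simp
    qed
    then show ?thesis using 0 by blast
  qed
qed

text \<open>A nonzero linear form is a regular sequence of length one.\<close>

lemma linear_form_cancel:
  fixes l :: "'k::field poly6"
  assumes "l \<in> hpart 1" "l \<noteq> 0" "x \<in> hpart d" "l * x = 0"
  shows "x = 0"
proof -
  have "mpoly.indep_family (\<lambda>_. l) 1" using assms(2) by (simp add: mpoly.indep_family_def)
  then have reg: "gr.gregular (\<lambda>_. l) 1 1" by (rule gregular_linear_forms) (rule assms(1))
  have "x \<in> gr.gspan (\<lambda>_. l) 0 1 d"
    by (rule gr.gregularD[OF reg zero_less_one assms(3)]) (simp add: assms(4))
  then show ?thesis by simp
qed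

text \<open>If every \<open>c\<close> failed, the pairs of combinations would be dependent modulo
  \<open>l\<close>, and \<open>dependent_pairs\<close> leaves two cases. A common relation makes
  some \<open>s g + t h\<close> a combination of \<open>F\<close> after cancelling \<open>l\<close>.
  A common line, spanned by \<open>v\<close>, makes \<open>l\<close> divide two combinations
  \<open>P\<close> and \<open>Q\<close> of \<open>F\<close>; the quotients give a linear syzygy of
  \<open>F\<close>, which vanishes. So \<open>P\<close> and \<open>Q\<close> are proportional, and
  again some nontrivial \<open>s g + t h\<close> falls into the ideal.\<close>

lemma independent_combination_exists:
  fixes F :: "nat \<Rightarrow> 'k::field poly6"
  assumes F: "gr.gregular F n 2" and gh: "g \<in> hpart 2" "h \<in> hpart 2"
    and ind: "\<And>s t. smult s g + smult t h \<in> gr.gspan F n 2 2 \<Longrightarrow> s = 0 \<and> t = 0"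
    and l: "l \<in> hpart 1" "l \<noteq> 0"
    and a: "\<And>i. a i \<in> hpart 1" "l * g = (\<Sum>i<n. a i * F i)"
    and b: "\<And>i. b i \<in> hpart 1" "l * h = (\<Sum>i<n. b i * F i)"
  obtains c where "mpoly.indep_family ((!) [l, \<Sum>i<n. smult (c i) (a i), \<Sum>i<n. smult (c i) (b i)]) 3"
proof (rule ccontr)
  assume "\<not> thesis"
  then have no: "\<not> mpoly.indep_family ((!) [l, \<Sum>i<n. smult (c i) (a i), \<Sum>i<n. smult (c i) (b i)]) 3" for c
    using that by blast
  have FH: "F i \<in> hpart 2" if "i < n" for i using gr.gregular_H[OF F that] .
  have comb: "(\<Sum>i<n. smult (e i) (F i)) \<in> gr.gspan F n 2 2" for e
    unfolding smult_def by (rule gr.gspanI) simp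
  have combH: "(\<Sum>i<n. smult (e i) (F i)) \<in> hpart 2" for e
    by (intro gr.sum_H smult_hpart FH) auto
  \<comment> \<open>Subtracting the projection \<open>\<rho>\<close> onto the line of
    \<open>l\<close> models linear forms modulo \<open>l\<close>.\<close>
  obtain \<rho> where \<rho>: "Vector_Spaces.linear smult smult \<rho>" "\<And>x. \<rho> x \<in> mpoly.span {l}"
    "\<And>x. x \<in> mpoly.span {l} \<Longrightarrow> \<rho> x = x" by (rule mpoly.exists_projection[OF mpoly.subspace_span[of "{l}"]]) blast
  interpret \<rho>: Vector_Spaces.linear smult smult \<rho> by (rule \<rho>)
  have spl: "mpoly.span {l} \<subseteq> hpart 1" using l hpart_subspace by (intro mpoly.span_minimal) auto
  have sumH: "(\<Sum>i<n. smult (c i) (a i)) \<in> hpart 1" "(\<Sum>i<n. smult (c i) (b i)) \<in> hpart 1" for c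
    by (auto intro!: gr.sum_H smult_hpart a b)
  define S where "S = {(\<Sum>i<n. smult (c i) (a i - \<rho> (a i)), \<Sum>i<n. smult (c i) (b i - \<rho> (b i))) |c. True}"
  have proj: "(\<Sum>i<n. smult (c i) (a i - \<rho> (a i))) = (\<Sum>i<n. smult (c i) (a i)) - \<rho> (\<Sum>i<n. smult (c i) (a i))"
    "(\<Sum>i<n. smult (c i) (b i - \<rho> (b i))) = (\<Sum>i<n. smult (c i) (b i)) - \<rho> (\<Sum>i<n. smult (c i) (b i))" for c
    by (simp_all add: \<rho>.sum \<rho>.scale mpoly.scale_right_diff_distrib sum_subtractf)
  have SI: "(a i - \<rho> (a i), b i - \<rho> (b i)) \<in> S" if "i < n" for i
  proof -
    have 1: "(\<Sum>j<n. smult (if j = i then 1 else 0) (F' j)) = F' i" for F' :: "nat \<Rightarrow> 'k poly6"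
    proof -
      have "(\<Sum>j<n. smult (if j = i then 1 else 0) (F' j)) = (\<Sum>j<n. if j = i then F' j else 0)"
        by (rule sum.cong) auto
      then show ?thesis using that by simp
    qed
    show ?thesis unfolding S_def
      by (intro CollectI exI[of _ "\<lambda>j. if j = i then 1 else 0"]) (simp only: 1)
  qed
  have "(\<exists>s t. (s \<noteq> 0 \<or> t \<noteq> 0) \<and> (\<forall>(x, y)\<in>S. smult s x + smult t y = 0)) \<or>
      (\<exists>(v, w)\<in>S. v \<noteq> 0 \<and> (\<forall>(x, y)\<in>S. x \<in> mpoly.span {v} \<and> y \<in> mpoly.span {v}))"
  proof (rule mpoly.dependent_pairs)
    fix x y x' y' assume "(x, y) \<in> S" "(x', y') \<in> S"
    then obtain c c' where
      "x = (\<Sum>i<n. smult (c i) (a i - \<rho> (a i)))" "y = (\<Sum>i<n. smult (c i) (b i - \<rho> (b i)))"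
      "x' = (\<Sum>i<n. smult (c' i) (a i - \<rho> (a i)))" "y' = (\<Sum>i<n. smult (c' i) (b i - \<rho> (b i)))"
      unfolding S_def by blast
    then have "x + x' = (\<Sum>i<n. smult (c i + c' i) (a i - \<rho> (a i)))"
      "y + y' = (\<Sum>i<n. smult (c i + c' i) (b i - \<rho> (b i)))"
      by (simp_all only: mpoly.scale_left_distrib sum.distrib)
    then show "(x + x', y + y') \<in> S" unfolding S_def by (intro CollectI exI[of _ "\<lambda>i. c i + c' i"]) simp
  next
    fix x y assume "(x, y) \<in> S"
    then obtain c where xy: "x = (\<Sum>i<n. smult (c i) (a i - \<rho> (a i)))" "y = (\<Sum>i<n. smult (c i) (b i - \<rho> (b i)))"
      unfolding S_def by blast
    let ?A = "\<Sum>i<n. smult (c i) (a i)" and ?B = "\<Sum>i<n. smult (c i) (b i)"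
    obtain u k where u: "(\<Sum>j<3. smult (u j) ([l, ?A, ?B] ! j)) = 0" "k < 3" "u k \<noteq> (0::'k)"
      using no[of c] unfolding mpoly.indep_family_def by blast
    have u': "smult (u 0) l + smult (u 1) ?A + smult (u 2) ?B = 0"
      using u(1) by (simp add: numeral_eq_Suc add.assoc)
    have "u 1 \<noteq> 0 \<or> u 2 \<noteq> 0"
    proof (rule ccontr)
      assume "\<not> ?thesis"
      then have "smult (u 0) l = 0" "u 0 \<noteq> 0 \<or> False" using u' u(2,3) by (auto simp: numeral_eq_Suc less_Suc_eq)
      then show False using l(2) by simp
    qed
    moreover have "smult (u 1) x + smult (u 2) y = 0"
    proof -
      have "\<rho> (smult (u 0) l + smult (u 1) ?A + smult (u 2) ?B) = 0" unfolding u' by (rule \<rho>.zero)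
      then have "smult (u 0) l + smult (u 1) (\<rho> ?A) + smult (u 2) (\<rho> ?B) = 0"
        using \<rho>(3)[of l] by (simp add: \<rho>.add \<rho>.scale mpoly.span_base)
      moreover have "smult (u 1) (?A - \<rho> ?A) + smult (u 2) (?B - \<rho> ?B) =
          (smult (u 0) l + smult (u 1) ?A + smult (u 2) ?B) - (smult (u 0) l + smult (u 1) (\<rho> ?A) + smult (u 2) (\<rho> ?B))"
        unfolding mpoly.scale_right_diff_distrib by (simp only: diff_conv_add_uminus minus_add_distrib add_ac) simp
      ultimately show ?thesis unfolding xy proj u' by simp
    qed
    ultimately show "\<exists>s t. (s \<noteq> 0 \<or> t \<noteq> 0) \<and> smult s x + smult t y = 0" by blast
  qed
  then consider (1) s t where "s \<noteq> 0 \<or> t \<noteq> 0" "\<forall>(x, y)\<in>S. smult s x + smult t y = 0"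
    | (2) v w where "(v, w) \<in> S" "v \<noteq> 0" "\<forall>(x, y)\<in>S. x \<in> mpoly.span {v} \<and> y \<in> mpoly.span {v}"
    by blast
  then show False
  proof cases
    case (1 s t)
    note st = 1(1) and all = 1(2)
    have ab: "smult s (a i - \<rho> (a i)) + smult t (b i - \<rho> (b i)) = 0" if "i < n" for i
      using all SI[OF that] by blast
    have "\<exists>e. smult s (a i) + smult t (b i) = smult e l" if "i < n" for i
    proof -
      have "smult s (a i) + smult t (b i) = smult s (\<rho> (a i)) + smult t (\<rho> (b i))"
      proof -
        have "smult s (a i - \<rho> (a i)) + smult t (b i - \<rho> (b i)) =
            (smult s (a i) + smult t (b i)) - (smult s (\<rho> (a i)) + smult t (\<rho> (b i)))"
          by (simp add: mpoly.scale_right_diff_distrib)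
        then show ?thesis using ab[OF that] by simp
      qed
      also have "\<dots> \<in> mpoly.span {l}" by (intro mpoly.span_add mpoly.span_scale \<rho>(2))
      finally show ?thesis by (auto simp: mpoly.span_singleton)
    qed
    then obtain e where e: "\<And>i. i < n \<Longrightarrow> smult s (a i) + smult t (b i) = smult (e i) l" by metis
    have "l * (smult s g + smult t h) = smult s (l * g) + smult t (l * h)"
      by (simp add: distrib_left smult_mult_right)
    also have "\<dots> = (\<Sum>i<n. (smult s (a i) + smult t (b i)) * F i)"
      by (simp add: a(2) b(2) mpoly.scale_sum_right distrib_right sum.distrib smult_mult_left)
    also have "\<dots> = l * (\<Sum>i<n. smult (e i) (F i))"
      by (simp add: e sum_distrib_left smult_mult_left smult_mult_right)
    finally have "l * (smult s g + smult t h - (\<Sum>i<n. smult (e i) (F i))) = 0" by (simp add: right_diff_distrib)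
    moreover have "smult s g + smult t h - (\<Sum>i<n. smult (e i) (F i)) \<in> hpart 2"
      by (intro gr.diff_H gr.add_H smult_hpart gh combH)
    ultimately have "smult s g + smult t h - (\<Sum>i<n. smult (e i) (F i)) = 0" using linear_form_cancel[OF l] by blast
    then have "smult s g + smult t h \<in> gr.gspan F n 2 2" using comb[of e] by simp
    from ind[OF this] st show False by simp
  next
    case (2 v w)
    then have v: "(v, w) \<in> S" "v \<noteq> 0" "\<And>x y. (x, y) \<in> S \<Longrightarrow> x \<in> mpoly.span {v} \<and> y \<in> mpoly.span {v}"
      by blast+
    obtain c where vc: "v = (\<Sum>i<n. smult (c i) (a i)) - \<rho> (\<Sum>i<n. smult (c i) (a i))"
      using v(1) unfolding S_def proj by blast
    have vH: "v \<in> hpart 1" unfolding vc using sumH \<rho>(2) spl by (intro gr.diff_H) auto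
    have \<rho>v: "\<rho> v = 0" unfolding vc \<rho>.diff using \<rho>(3)[OF \<rho>(2)] by simp
    have "mpoly.indep_family ((!) [l, v]) 2"
      unfolding mpoly.indep_family_def
    proof (intro allI impI)
      fix u j assume 0: "(\<Sum>j<2. smult (u j) ([l, v] ! j)) = 0" and j: "j < (2::nat)"
      have u: "smult (u 0) l + smult (u 1) v = 0" using 0 by (simp add: numeral_eq_Suc)
      have "\<rho> (smult (u 0) l + smult (u 1) v) = 0" unfolding u by (rule \<rho>.zero)
      then have u0: "smult (u 0) l = 0" using \<rho>(3)[of l] by (simp add: \<rho>.add \<rho>.scale mpoly.span_base \<rho>v)
      have "smult (u 1) v = 0" using u unfolding u0 by simp
      then show "u j = 0" using u0 l(2) v(2) j by (auto simp: numeral_eq_Suc less_Suc_eq)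
    qed
    then have reg: "gr.gregular ((!) [l, v]) 2 1"
      by (rule gregular_linear_forms) (use vH l in \<open>auto simp: numeral_eq_Suc less_Suc_eq\<close>)
    have decomp: "\<exists>s t. x = smult s v + smult t l" if x: "x - \<rho> x \<in> mpoly.span {v}" for x
    proof -
      obtain s t where "x - \<rho> x = smult s v" "\<rho> x = smult t l"
        using x \<rho>(2)[of x] unfolding mpoly.span_singleton by blast
      then have "x = smult s v + smult t l" using diff_add_cancel[of x "\<rho> x"] by simp
      then show ?thesis by (intro exI)
    qed
    have "a i - \<rho> (a i) \<in> mpoly.span {v} \<and> b i - \<rho> (b i) \<in> mpoly.span {v}" if "i < n" for i
      using v(3)[OF SI[OF that]] .
    then have ex: "\<exists>s t. a i = smult s v + smult t l" "\<exists>s t. b i = smult s v + smult t l" if "i < n" for i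
      using decomp that by blast+
    from ex(1) obtain \<alpha> \<alpha>' where "\<And>i. i < n \<Longrightarrow> a i = smult (\<alpha> i) v + smult (\<alpha>' i) l" by metis
    moreover from ex(2) obtain \<beta> \<beta>' where "\<And>i. i < n \<Longrightarrow> b i = smult (\<beta> i) v + smult (\<beta>' i) l" by metis
    ultimately have ab: "\<And>i. i < n \<Longrightarrow> a i = smult (\<alpha> i) v + smult (\<alpha>' i) l"
      "\<And>i. i < n \<Longrightarrow> b i = smult (\<beta> i) v + smult (\<beta>' i) l" by blast+
    \<comment> \<open>With \<open>a i\<close> and \<open>b i\<close> in the span of \<open>v\<close>
      and \<open>l\<close>, the expansions of \<open>l * g\<close> and \<open>l * h\<close> separate
      into a part with \<open>v\<close> and a part with \<open>l\<close>. The latter is moved to the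
      left-hand side, into \<open>g'\<close> and \<open>h'\<close>.\<close>
    define P Q where "P = (\<Sum>i<n. smult (\<alpha> i) (F i))" and "Q = (\<Sum>i<n. smult (\<beta> i) (F i))"
    define g' h' where "g' = g - (\<Sum>i<n. smult (\<alpha>' i) (F i))" and "h' = h - (\<Sum>i<n. smult (\<beta>' i) (F i))"
    have H: "P \<in> hpart 2" "Q \<in> hpart 2" "g' \<in> hpart 2" "h' \<in> hpart 2"
      unfolding P_def Q_def g'_def h'_def by (intro gr.diff_H gh combH)+
    have vP: "v * P = l * g'"
      unfolding P_def g'_def right_diff_distrib a(2) sum_distrib_left sum_subtractf[symmetric]
      by (intro sum.cong refl) (simp add: ab smult_mult_left smult_mult_right distrib_right)
    have vQ: "v * Q = l * h'"
      unfolding Q_def h'_def right_diff_distrib b(2) sum_distrib_left sum_subtractf[symmetric]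
      by (intro sum.cong refl) (simp add: ab smult_mult_left smult_mult_right distrib_right)
    have ldvd: "\<exists>m\<in>hpart 1. p = m * l" if p: "p \<in> hpart 2" "v * p = l * q" "q \<in> hpart 2" for p q
    proof -
      have "[l, v] ! 1 * p \<in> gr.gspan ((!) [l, v]) 1 1 (2 + 1)"
        using gr.gspan_gen[of 0 1 q "2 + 1" 1 "(!) [l, v]"] p by (simp add: mult.commute)
      then have "p \<in> gr.gspan ((!) [l, v]) 1 1 2" by (intro gr.gregularD[OF reg _ p(1)]) auto
      then show ?thesis by (rule gr.gspanE) auto
    qed
    obtain m where m: "m \<in> hpart 1" "P = m * l" using ldvd[OF H(1) vP H(3)] by blast
    obtain m' where m': "m' \<in> hpart 1" "Q = m' * l" using ldvd[OF H(2) vQ H(4)] by blast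
    have nz: "\<not> (smult s g' + smult t h' = 0)" if "s \<noteq> 0 \<or> t \<noteq> 0" for s t
    proof
      assume 0: "smult s g' + smult t h' = 0"
      have "smult s g + smult t h = smult s (\<Sum>i<n. smult (\<alpha>' i) (F i)) + smult t (\<Sum>i<n. smult (\<beta>' i) (F i))"
      proof -
        have "smult s g' + smult t h' = (smult s g + smult t h) -
            (smult s (\<Sum>i<n. smult (\<alpha>' i) (F i)) + smult t (\<Sum>i<n. smult (\<beta>' i) (F i)))"
          unfolding g'_def h'_def by (simp add: mpoly.scale_right_diff_distrib)
        then show ?thesis using 0 by simp
      qed
      also have "\<dots> \<in> gr.gspan F n 2 2"
        by (intro mpoly.subspace_add[OF gspan_subspace] mpoly.subspace_scale[OF gspan_subspace] comb)
      finally show False using ind that by blast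
    qed
    have key: "smult s P + smult t Q \<noteq> 0" if "s \<noteq> 0 \<or> t \<noteq> 0" for s t
    proof
      assume 0: "smult s P + smult t Q = 0"
      have "l * (smult s g' + smult t h') = v * (smult s P + smult t Q)"
        by (simp add: distrib_left smult_mult_right vP vQ)
      then have "smult s g' + smult t h' = 0"
        using 0 linear_form_cancel[OF l, of "smult s g' + smult t h'" 2] H by (simp add: gr.add_H smult_hpart)
      then show False using nz that by blast
    qed
    \<comment> \<open>Both products equal \<open>m * m' * l\<close>, and coefficients of degree 1 in
      a syzygy of the quadrics vanish.\<close>
    have "(\<Sum>i<n. (smult (\<alpha> i) m' - smult (\<beta> i) m) * F i) = m' * P - m * Q"
      by (simp add: P_def Q_def left_diff_distrib sum_subtractf sum_distrib_left smult_mult_left smult_mult_right)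
    also have "\<dots> = 0" unfolding m(2) m'(2) by (simp add: mult_ac)
    finally have "(\<Sum>i<n. (smult (\<alpha> i) m' - smult (\<beta> i) m) * F i) = 0" .
    then have am: "smult (\<alpha> i) m' - smult (\<beta> i) m = 0" if "i < n" for i
      using gsyz_low_degree[OF gr.gregular_imp_gsyz[OF F], of 1 "\<lambda>i. smult (\<alpha> i) m' - smult (\<beta> i) m" i] m(1) m'(1) that
      by (simp add: gr.diff_H smult_hpart)
    have "m \<noteq> 0" using key[of 1 0] m by auto
    have "\<exists>i<n. \<alpha> i \<noteq> 0"
    proof (rule ccontr)
      assume "\<not> ?thesis"
      then have "P = 0" unfolding P_def by simp
      then show False using key[of 1 0] by simp
    qed
    then obtain i where i: "i < n" "\<alpha> i \<noteq> 0" by blast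
    have "m' = smult (\<beta> i / \<alpha> i) m"
    proof -
      have "smult (1 / \<alpha> i) (smult (\<alpha> i) m') = smult (1 / \<alpha> i) (smult (\<beta> i) m)" using am[OF i(1)] by simp
      then show ?thesis using i by simp
    qed
    then have "smult (- (\<beta> i / \<alpha> i)) P + smult 1 Q = 0" using m(2) m'(2) by (simp add: smult_mult_left)
    then show False using key[of "- (\<beta> i / \<alpha> i)" 1] by simp
  qed
qed

text \<open>In the Leibniz expansion with diagonal entries \<open>q - f\<close>, the only term
  without a factor among the three \<open>q\<close> and \<open>n01\<close>, \<open>n02\<close>,
  \<open>n21\<close> is minus the cube of \<open>f\<close>: every permutation other than the
  identity uses one of these three entries. The coefficients are read off from this
  expansion.\<close>

lemma det3_shift:
  fixes f :: "'a::comm_ring_1"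
  assumes "n00 * (n11 * n22 - n12 * n21) - n01 * (n10 * n22 - n12 * n20) + n02 * (n10 * n21 - n11 * n20) = 0"
    and q: "q00 = n00 + f" "q11 = n11 + f" "q22 = n22 + f"
  shows "f * (f * f) = (f * f - f * q11 - f * q22 + q11 * q22 - n12 * n21) * q00 + (f * f - f * q22) * q11
    + (f * f) * q22 + (f * n10 + n12 * n20 - n10 * q22) * n01 + (f * n20 + n10 * n21 - q11 * n20) * n02
    + (f * n12) * n21"
proof -
  have "f * (f * f) = (f * f - f * q11 - f * q22 + q11 * q22 - n12 * n21) * q00 + (f * f - f * q22) * q11
    + (f * f) * q22 + (f * n10 + n12 * n20 - n10 * q22) * n01 + (f * n20 + n10 * n21 - q11 * n20) * n02
    + (f * n12) * n21 - (n00 * (n11 * n22 - n12 * n21) - n01 * (n10 * n22 - n12 * n20) + n02 * (n10 * n21 - n11 * n20))"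
    unfolding q by (simp add: algebra_simps)
  then show ?thesis using assms(1) by simp
qed

text \<open>The \<open>3 \<times> 3\<close> matrix in the hypothesis is a product of a \<open>3 \<times> 2\<close> and a \<open>2 \<times> 3\<close> matrix,
  hence singular, so modulo \<open>z\<close>, \<open>F 3\<close>, \<open>F 4\<close> the cube of \<open>F 5\<close> vanishes.\<close>

lemma singular_matrix_contradiction:
  fixes F m m' A B :: "nat \<Rightarrow> 'k::field poly6"
  assumes F: "gr.gregular F 6 2" and z: "gr.gregular z 3 1"
    and Fz: "\<And>i. i < 3 \<Longrightarrow> F i \<in> gr.gspan z 3 1 2"
    and H: "\<And>i::nat. i < 3 \<Longrightarrow> m i \<in> hpart 1" "\<And>i. i < 3 \<Longrightarrow> m' i \<in> hpart 1"
      "\<And>i. i < 3 \<Longrightarrow> A i \<in> hpart 1" "\<And>i. i < 3 \<Longrightarrow> B i \<in> hpart 1"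
    and rel: "\<And>i j. i < 3 \<Longrightarrow> j < 3 \<Longrightarrow> \<exists>q\<in>gr.gspan z 3 1 2. \<exists>s t.
      m i * A j + m' i * B j + (if i = j then F 5 else 0) = q + smult s (F 3) + smult t (F 4)"
  shows False
proof -
  \<comment> \<open>\<open>Q d\<close> is the part of degree \<open>d\<close> of the ideal generated
    by \<open>z\<close>, \<open>F 3\<close> and \<open>F 4\<close>. The generators have mixed
    degrees, so \<open>gspan\<close> alone does not describe it.\<close>
  define Q where "Q d = {q + u * F 3 + v * F 4 | q u v. q \<in> gr.gspan z 3 1 d \<and> u \<in> hpart (d - 2) \<and> v \<in> hpart (d - 2)}" for d
  have QI: "q + u * F 3 + v * F 4 \<in> Q d" if "q \<in> gr.gspan z 3 1 d" "u \<in> hpart (d - 2)" "v \<in> hpart (d - 2)" for q u v d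
    using that unfolding Q_def by blast
  have Qadd: "x + y \<in> Q d" if "x \<in> Q d" "y \<in> Q d" for x y d
  proof -
    obtain q u v q' u' v' where "x = q + u * F 3 + v * F 4" "y = q' + u' * F 3 + v' * F 4"
      "q \<in> gr.gspan z 3 1 d" "u \<in> hpart (d - 2)" "v \<in> hpart (d - 2)"
      "q' \<in> gr.gspan z 3 1 d" "u' \<in> hpart (d - 2)" "v' \<in> hpart (d - 2)" using \<open>x \<in> Q d\<close> \<open>y \<in> Q d\<close> unfolding Q_def by blast
    then show ?thesis using QI[of "q + q'" d "u + u'" "v + v'"]
      by (simp add: gr.gspan_add gr.add_H distrib_right add_ac)
  qed
  have Qmult: "y * x \<in> Q (d + c)" if "x \<in> Q d" "y \<in> hpart c" for x y d c
  proof -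
    obtain q u v where x: "x = q + u * F 3 + v * F 4"
      "q \<in> gr.gspan z 3 1 d" "u \<in> hpart (d - 2)" "v \<in> hpart (d - 2)" using \<open>x \<in> Q d\<close> unfolding Q_def by blast
    have "y * u \<in> hpart (d + c - 2)" "y * v \<in> hpart (d + c - 2)"
      using gr.mult_H'[OF that(2) x(3), of "d + c - 2"] gr.mult_H'[OF that(2) x(4), of "d + c - 2"] by auto
    from QI[OF gr.gspan_mult[OF x(2) that(2)] this] show ?thesis by (simp add: x(1) distrib_left mult.assoc)
  qed
  have FH: "F i \<in> hpart 2" if "i < 6" for i using gr.gregular_H[OF F that] .
  have reduce: "q \<in> Q d" if q: "q \<in> hpart d" "F 5 * q \<in> Q (d + 2)" for q d
  proof -
    obtain w u v where w: "F 5 * q = w + u * F 3 + v * F 4" "w \<in> gr.gspan z 3 1 (d + 2)" "u \<in> hpart d" "v \<in> hpart d"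
      using q(2) unfolding Q_def by auto
    then have "F 5 * q - u * F 3 - v * F 4 \<in> gr.gspan z 3 1 (d + 2)" by simp
    from gr.koszul_regular_quotient[OF F z Fz q(1) w(3,4) this]
    obtain a' b' where ab: "a' \<in> hpart (d - 2)" "b' \<in> hpart (d - 2)" "q - a' * F 3 - b' * F 4 \<in> gr.gspan z 3 1 d" .
    from QI[OF ab(3,1,2)] show ?thesis by simp
  qed
  define n where "n i j = m i * A j + m' i * B j" for i j
  have nH: "n i j \<in> hpart 2" if "i < 3" "j < 3" for i j
    unfolding n_def using that H by (intro gr.add_H gr.mult_H'[of _ 1 _ 1]) auto
  have nQ: "n i j + (if i = j then F 5 else 0) \<in> Q 2" if ij: "i < 3" "j < 3" for i j
  proof -
    obtain q s t where q: "q \<in> gr.gspan z 3 1 2"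
      "n i j + (if i = j then F 5 else 0) = q + smult s (F 3) + smult t (F 4)"
      using rel[OF ij] unfolding n_def by blast
    show ?thesis unfolding q(2) smult_def by (rule QI) (use q(1) in auto)
  qed
  have n0: "n 0 1 \<in> Q 2" "n 0 2 \<in> Q 2" "n 2 1 \<in> Q 2"
    using nQ[of 0 1] nQ[of 0 2] nQ[of 2 1] by auto
  have n1: "n 0 0 + F 5 \<in> Q 2" "n 1 1 + F 5 \<in> Q 2" "n 2 2 + F 5 \<in> Q 2"
    using nQ[of 0 0] nQ[of 1 1] nQ[of 2 2] by auto
  have det: "n 0 0 * (n 1 1 * n 2 2 - n 1 2 * n 2 1) - n 0 1 * (n 1 0 * n 2 2 - n 1 2 * n 2 0)
      + n 0 2 * (n 1 0 * n 2 1 - n 1 1 * n 2 0) = 0"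
    unfolding n_def by (simp add: algebra_simps)
  have mm: "x * y \<in> hpart 4" if "x \<in> hpart 2" "y \<in> hpart 2" for x y :: "'k poly6"
    using gr.mult_H[OF that] by simp
  have qH: "n i i + F 5 \<in> hpart 2" if "i < 3" for i using nH[OF that that] FH[of 5] by (simp add: gr.add_H)
  have Q6: "y * x \<in> Q 6" if "x \<in> Q 2" "y \<in> hpart 4" for x y using Qmult[OF that] by simp
  have "F 5 * (F 5 * F 5) \<in> Q 6"
    by (subst det3_shift[OF det refl refl refl])
      (intro Qadd Q6 n0 n1 gr.diff_H gr.add_H mm nH qH FH; simp)
  \<comment> \<open>Cancelling \<open>F 5\<close> three times brings 1 into \<open>Q 0\<close>,
    where all coefficients have negative degree.\<close>
  then have "F 5 * F 5 \<in> Q 4" using reduce[of "F 5 * F 5" 4] mm FH by simp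
  then have "F 5 \<in> Q 2" using reduce[of "F 5" 2] FH by simp
  then have "1 \<in> Q 0" using reduce[of 1 0] gr.one_H by simp
  then obtain q u v where 1: "1 = q + u * F 3 + v * F 4" "q \<in> gr.gspan z 3 1 0" "u \<in> hpart (- 2)" "v \<in> hpart (- 2)"
    unfolding Q_def by auto
  have "u = 0" "v = 0" using gr.neg_H[OF _ 1(3)] gr.neg_H[OF _ 1(4)] by auto
  moreover have "q = 0"
  proof -
    obtain w where w: "\<And>j. w j \<in> hpart (0 - 1)" "q = (\<Sum>j<3. w j * z j)" using 1(2) by (rule gr.gspanE) blast
    have "w j = 0" for j using gr.neg_H[OF _ w(1)] by simp
    then show ?thesis using w(2) by simp
  qed
  ultimately show False using 1(1) by simp
qed

section \<open>Pairs of linear forms\<close>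

definition smult2 :: "'k::comm_ring_1 \<Rightarrow> ('x, 'k) mpoly \<times> ('x, 'k) mpoly \<Rightarrow> ('x, 'k) mpoly \<times> ('x, 'k) mpoly" where
  "smult2 c w = (smult c (fst w), smult c (snd w))"

interpretation pairs: vector_space "smult2 :: 'k::field \<Rightarrow> ('x, 'k) mpoly \<times> ('x, 'k) mpoly \<Rightarrow> _"
  by unfold_locales
    (simp_all add: smult2_def mpoly.scale_right_distrib mpoly.scale_left_distrib)

interpretation pairs_mpoly: vector_space_pair
  "smult2 :: 'k::field \<Rightarrow> ('x, 'k) mpoly \<times> ('x, 'k) mpoly \<Rightarrow> _" "smult :: 'k \<Rightarrow> ('x, 'k) mpoly \<Rightarrow> ('x, 'k) mpoly"
  by unfold_locales

interpretation mpoly_pairs: vector_space_pair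
  "smult :: 'k::field \<Rightarrow> ('x, 'k) mpoly \<Rightarrow> ('x, 'k) mpoly" "smult2 :: 'k \<Rightarrow> ('x, 'k) mpoly \<times> ('x, 'k) mpoly \<Rightarrow> _"
  by unfold_locales

lemma linear_pair_combination:
  "Vector_Spaces.linear smult2 smult (\<lambda>w :: ('x, 'k::field) mpoly \<times> ('x, 'k) mpoly. fst w * p + snd w * q)"
  by (auto simp: Vector_Spaces.linear_iff smult2_def smult_mult_left distrib_right mpoly.scale_right_distrib
      intro: mpoly.vector_space_axioms pairs.vector_space_axioms)

lemma pairs_subspace: "pairs.subspace (hpart 1 \<times> hpart 1)"
  by (rule pairs.subspaceI) (auto simp: smult2_def zero_prod_def intro: gr.zero_H gr.add_H smult_hpart)

lemma pairs_finite_span: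
  obtains G where "finite G" "hpart 1 \<times> hpart 1 \<subseteq> pairs.span (G :: ('k::field poly6 \<times> 'k poly6) set)"
proof -
  define G :: "('k poly6 \<times> 'k poly6) set" where "G = (\<lambda>x. (x, 0)) ` (var6 ` {..<6}) \<union> (\<lambda>x. (0, x)) ` (var6 ` {..<6})"
  have 1: "Vector_Spaces.linear smult smult2 (\<lambda>x :: 'k poly6. (x, 0))"
    and 2: "Vector_Spaces.linear smult smult2 (\<lambda>x :: 'k poly6. (0, x))"
    by (auto simp: Vector_Spaces.linear_iff smult2_def intro: mpoly.vector_space_axioms pairs.vector_space_axioms)
  have "hpart 1 \<times> hpart 1 \<subseteq> pairs.span G"
  proof safe
    fix x y :: "'k poly6" assume "x \<in> hpart 1" "y \<in> hpart 1"
    then have "(x, 0) \<in> (\<lambda>x. (x, 0)) ` mpoly.span (var6 ` {..<6})" "(0, y) \<in> (\<lambda>x. (0, x)) ` mpoly.span (var6 ` {..<6})"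
      by (auto simp: hpart_1_eq_span)
    then have "(x, 0) \<in> pairs.span ((\<lambda>x. (x, 0)) ` (var6 ` {..<6}))" "(0, y) \<in> pairs.span ((\<lambda>x. (0, x)) ` (var6 ` {..<6}))"
      by (simp_all only: mpoly_pairs.linear_span_image[OF 1] mpoly_pairs.linear_span_image[OF 2])
    then have "(x, 0) \<in> pairs.span G" "(0, y) \<in> pairs.span G"
      unfolding G_def using pairs.span_mono by blast+
    then show "(x, y) \<in> pairs.span G" using pairs.span_add[of "(x, 0)" G "(0, y)"] by simp
  qed
  then show ?thesis by (intro that[of G]) (auto simp: G_def)
qed

lemma dim_zero_set: "mpoly.dim ({0} :: ('x, 'k::field) mpoly set) = 0"
  by (metis card.empty mpoly.dim_eq_card_independent mpoly.dim_span mpoly.independent_empty mpoly.span_empty)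

lemma dim_pairs: "pairs.dim (hpart 1 \<times> hpart 1 :: ('k::field poly6 \<times> 'k poly6) set) = 12"
proof -
  let ?V = "hpart 1 :: 'k poly6 set"
  obtain G where G: "finite G" "?V \<times> ?V \<subseteq> pairs.span G" by (rule pairs_finite_span)
  have fst: "Vector_Spaces.linear smult2 smult (fst :: 'k poly6 \<times> 'k poly6 \<Rightarrow> _)"
    and emb: "Vector_Spaces.linear smult smult2 (\<lambda>x :: 'k poly6. (0, x))"
    by (auto simp: Vector_Spaces.linear_iff smult2_def intro: mpoly.vector_space_axioms pairs.vector_space_axioms)
  have V: "?V \<subseteq> mpoly.span (var6 ` {..<6})" by (simp add: hpart_1_eq_span)
  have 0: "0 \<in> ?V" by (rule gr.zero_H)
  have 1: "fst ` (?V \<times> ?V) = ?V" using 0 by force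
  have 2: "{y \<in> ?V \<times> ?V. fst y = 0} = (\<lambda>x. (0, x)) ` ?V" using 0 by force
  have 3: "{y \<in> ?V. (0, y) = (0 :: 'k poly6 \<times> 'k poly6)} = {0}" using 0 by (auto simp: zero_prod_def)
  have "mpoly.dim ?V + pairs.dim ((\<lambda>x. (0, x)) ` ?V) = pairs.dim (?V \<times> ?V)"
    using pairs_mpoly.rank_nullity[OF fst pairs_subspace G(2,1)] unfolding 1 2 .
  moreover have "pairs.dim ((\<lambda>x. (0, x)) ` ?V) + mpoly.dim {0 :: 'k poly6} = mpoly.dim ?V"
    using mpoly_pairs.rank_nullity[OF emb hpart_subspace V] unfolding 3 by simp
  ultimately show ?thesis by (simp add: dim_hpart_1 dim_zero_set)
qed

text \<open>Cancelling \<open>r\<close> modulo \<open>l\<close> and \<open>p\<close>, and then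
  \<open>p\<close> modulo \<open>l\<close>, leaves only multiples of \<open>l\<close> and the Koszul
  relation \<open>(r, - p)\<close>. The number of spanning pairs is the bound 3 on the kernel in the
  case of a common annihilator.\<close>

lemma linear_relations_in_span:
  fixes l p r :: "'k::field poly6"
  assumes z: "gr.gregular ((!) [l, p, r]) 3 1"
    and H: "m \<in> hpart 1" "m' \<in> hpart 1" "n \<in> hpart 1" and rel: "m * p + m' * r = n * l"
  shows "(m, m') \<in> pairs.span {(l, 0), (0, l), (r, - p)}"
proof -
  have lpr: "l \<in> hpart 1" "p \<in> hpart 1" "r \<in> hpart 1"
    using gr.gregular_H[OF z, of 0] gr.gregular_H[OF z, of 1] gr.gregular_H[OF z, of 2] by auto
  have two: "gr.gspan ((!) [l, p, r]) 2 1 d = {u * l + v * p |u v. u \<in> hpart (d - 1) \<and> v \<in> hpart (d - 1)}" for d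
  proof safe
    fix x assume "x \<in> gr.gspan ((!) [l, p, r]) 2 1 d"
    then show "\<exists>u v. x = u * l + v * p \<and> u \<in> hpart (d - 1) \<and> v \<in> hpart (d - 1)"
      by (rule gr.gspanE) (auto simp: numeral_eq_Suc)
  next
    fix u v :: "'k poly6" assume "u \<in> hpart (d - 1)" "v \<in> hpart (d - 1)"
    then show "u * l + v * p \<in> gr.gspan ((!) [l, p, r]) 2 1 d"
      using gr.gspan_gen[of 0 2 u d 1 "(!) [l, p, r]"] gr.gspan_gen[of 1 2 v d 1 "(!) [l, p, r]"]
      by (simp add: gr.gspan_add)
  qed
  have "r * m' = n * l + (- m) * p" using rel by (simp add: algebra_simps)
  also have "\<dots> \<in> gr.gspan ((!) [l, p, r]) 2 1 (1 + 1)" unfolding two using H gr.uminus_H by fastforce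
  finally have "m' \<in> gr.gspan ((!) [l, p, r]) 2 1 1" using gr.gregularD[OF z, of 2 m' 1] H by simp
  then obtain u v where "m' = u * l + v * p" "u \<in> hpart 0" "v \<in> hpart 0" unfolding two by auto
  then obtain s t where m': "m' = smult s l + smult t p" unfolding hpart_0_iff smult_def by auto
  have "p * (m + smult t r) = (n - smult s r) * l"
    using rel unfolding m' by (simp add: algebra_simps smult_mult_left smult_mult_right)
  moreover have "n - smult s r \<in> hpart 1" by (intro gr.diff_H smult_hpart H lpr)
  ultimately have "p * (m + smult t r) \<in> gr.gspan ((!) [l, p, r]) 1 1 (1 + 1)"
    using gr.gspan_gen[of 0 1 "n - smult s r" "1 + 1" 1 "(!) [l, p, r]"] by simp
  moreover have "m + smult t r \<in> hpart 1" by (intro gr.add_H smult_hpart H lpr)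
  ultimately have "m + smult t r \<in> gr.gspan ((!) [l, p, r]) 1 1 1" using gr.gregularD[OF z, of 1 "m + smult t r" 1] by simp
  then obtain w where "w \<in> hpart 0" "m + smult t r = w * l" by (rule gr.gspanE) auto
  then obtain k where "m + smult t r = smult k l" unfolding hpart_0_iff smult_def by auto
  then have "m = smult k l - smult t r" by (simp add: algebra_simps)
  then have "(m, m') = smult2 k (l, 0) + smult2 s (0, l) + smult2 (- t) (r, - p)"
    by (simp add: m' smult2_def)
  also have "\<dots> \<in> pairs.span {(l, 0), (0, l), (r, - p)}"
    by (intro pairs.span_add pairs.span_scale pairs.span_base) auto
  finally show ?thesis .
qed

lemma indep_family_unique:
  fixes F :: "nat \<Rightarrow> ('x, 'k::field) mpoly"
  assumes "mpoly.indep_family F n" "(\<Sum>j<n. smult (u j) (F j)) = (\<Sum>j<n. smult (v j) (F j))" "j < n"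
  shows "u j = v j"
proof -
  have "(\<Sum>j<n. smult (u j - v j) (F j)) = 0"
    using assms(2) by (simp add: mpoly.scale_left_diff_distrib sum_subtractf)
  from mpoly.indep_familyD[OF assms(1) this assms(3)] show ?thesis by simp
qed

lemma delta_combination:
  fixes F :: "nat \<Rightarrow> ('x, 'k::field) mpoly"
  assumes "i < n"
  shows "(\<Sum>j<n. smult (if j = i then c else 0) (F j)) = smult c (F i)"
proof -
  have "(\<Sum>j<n. smult (if j = i then c else 0) (F j)) = (\<Sum>j<n. if j = i then smult c (F j) else 0)"
    by (rule sum.cong) auto
  then show ?thesis using assms by simp
qed

text \<open>\<open>phi\<close> spans a space of quadrics orthogonal to \<open>c\<close>; completing it to a basis of the span
  of \<open>F\<close> whose first five members are orthogonal to \<open>c\<close> makes each \<open>F k\<close> congruent to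
  \<open>c k\<close> times the last one.\<close>

lemma adapted_basis:
  fixes F :: "nat \<Rightarrow> 'k::field poly6"
  assumes F: "gr.gregular F 6 2" and ck: "k < 6" "c k \<noteq> (0 :: 'k)"
    and phi: "mpoly.indep_family phi 3"
    and phi_comb: "\<And>i. i < 3 \<Longrightarrow> \<exists>u. phi i = (\<Sum>j<6. smult (u j) (F j)) \<and> (\<Sum>j<6. u j * c j) = 0"
  shows "\<exists>F' dd. gr.gregular F' 6 2 \<and> (\<forall>i<3. F' i = phi i) \<and>
    (\<forall>i<6. F i = (\<Sum>s<5. smult (dd i s) (F' s)) + smult (c i) (F' 5))"
proof -
  have indF: "mpoly.indep_family F 6" by (rule gregular_indep_family[OF F]) simp
  define L where "L = {\<Sum>j<6. smult (u j) (F j) | u. (\<Sum>j<6. u j * c j) = 0}"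
  have Ls: "mpoly.subspace L"
  proof (rule mpoly.subspaceI)
    show "0 \<in> L" unfolding L_def by (intro CollectI exI[of _ "\<lambda>_. 0"]) simp
    fix x y assume "x \<in> L" "y \<in> L"
    then obtain u v where "x = (\<Sum>j<6. smult (u j) (F j))" "(\<Sum>j<6. u j * c j) = 0"
      "y = (\<Sum>j<6. smult (v j) (F j))" "(\<Sum>j<6. v j * c j) = 0" unfolding L_def by blast
    then show "x + y \<in> L" unfolding L_def
      by (intro CollectI exI[of _ "\<lambda>j. u j + v j"]) (simp add: mpoly.scale_left_distrib distrib_right sum.distrib)
  next
    fix a x assume "x \<in> L"
    then obtain u where "x = (\<Sum>j<6. smult (u j) (F j))" "(\<Sum>j<6. u j * c j) = 0" unfolding L_def by blast
    then show "smult a x \<in> L" unfolding L_def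
      by (intro CollectI exI[of _ "\<lambda>j. a * u j"])
        (simp add: mpoly.scale_sum_right mult.assoc sum_distrib_left[symmetric])
  qed
  have LF: "L \<subseteq> mpoly.span (F ` {..<6})"
  proof
    fix x assume "x \<in> L"
    then obtain u where "x = (\<Sum>j<6. smult (u j) (F j))" unfolding L_def by blast
    then show "x \<in> mpoly.span (F ` {..<6})" unfolding mpoly.span_family by (intro exI)
  qed
  have phiL: "phi ` {..<3} \<subseteq> L"
  proof safe
    fix i :: nat assume "i < 3"
    from phi_comb[OF this] obtain u where "phi i = (\<Sum>j<6. smult (u j) (F j))" "(\<Sum>j<6. u j * c j) = 0" by blast
    then show "phi i \<in> L" unfolding L_def by (intro CollectI exI[of _ u]) simp
  qed
  obtain B where B: "phi ` {..<3} \<subseteq> B" "B \<subseteq> L" "mpoly.independent B" "L \<subseteq> mpoly.span B"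
    using mpoly.maximal_independent_subset_extend[OF phiL mpoly.indep_family_independent[OF phi]] by auto
  have spB: "mpoly.span B = L" using B(2,4) Ls by (intro mpoly.span_subspace)
  have fB: "finite B" using mpoly.independent_span_bound[of "F ` {..<6}" B] B(2,3) LF by auto
  \<comment> \<open>The coefficient vector of \<open>f\<close> pairs to 1 with \<open>c\<close>, so
    subtracting \<open>c i\<close> times \<open>f\<close> moves \<open>F i\<close> into the
    hyperplane \<open>L\<close>.\<close>
  define f where "f = smult (1 / c k) (F k)"
  have f_comb: "f = (\<Sum>j<6. smult (if j = k then 1 / c k else 0) (F j))"
    unfolding f_def by (rule delta_combination[OF ck(1), symmetric])
  have fL: "f \<notin> L"
  proof
    assume "f \<in> L"
    then obtain u where u: "f = (\<Sum>j<6. smult (u j) (F j))" "(\<Sum>j<6. u j * c j) = 0" unfolding L_def by blast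
    have "u j = (if j = k then 1 / c k else 0)" if "j < 6" for j
      by (rule indep_family_unique[OF indF _ that]) (simp only: u(1)[symmetric] f_comb[symmetric])
    then have "(\<Sum>j<6. u j * c j) = (\<Sum>j<6. if j = k then 1 else 0)"
      using ck by (intro sum.cong) auto
    then show False using u(2) ck by simp
  qed
  have FL: "F i - smult (c i) f \<in> L" if i: "i < 6" for i
  proof -
    define u where "u j = (if j = i then 1 else 0) - (if j = k then c i / c k else 0)" for j
    have "F i - smult (c i) f = (\<Sum>j<6. smult (u j) (F j))"
      unfolding u_def mpoly.scale_left_diff_distrib sum_subtractf delta_combination[OF i] delta_combination[OF ck(1)]
      by (simp add: f_def)
    moreover have "(\<Sum>j<6. u j * c j) = 0"
    proof -
      have "(\<Sum>j<6. u j * c j) = (\<Sum>j<6. (if j = i then c j else 0) - (if j = k then c i else 0))"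
        unfolding u_def using ck(2) by (intro sum.cong) (auto simp: algebra_simps)
      then show ?thesis using i ck(1) by (simp add: sum_subtractf)
    qed
    ultimately show ?thesis unfolding L_def by (intro CollectI exI[of _ u]) simp
  qed
  have fB': "f \<notin> B" using fL B(2) by blast
  have ind: "mpoly.independent (insert f B)"
    using fL B(3) spB by (intro mpoly.independent_insertI) auto
  have "mpoly.span (insert f B) = mpoly.span (F ` {..<6})"
  proof
    have "f \<in> mpoly.span (F ` {..<6})" unfolding f_def using ck by (intro mpoly.span_scale mpoly.span_base) auto
    then show "mpoly.span (insert f B) \<subseteq> mpoly.span (F ` {..<6})"
      using B(2) LF by (intro mpoly.span_minimal) auto
    have "F i \<in> mpoly.span (insert f B)" if "i < 6" for i
    proof -
      have "F i - smult (c i) f \<in> mpoly.span (insert f B)"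
        using FL[OF that] spB mpoly.span_mono[of B "insert f B"] by auto
      moreover have "smult (c i) f \<in> mpoly.span (insert f B)" by (intro mpoly.span_scale mpoly.span_base) simp
      ultimately show ?thesis using mpoly.span_add by fastforce
    qed
    then show "mpoly.span (F ` {..<6}) \<subseteq> mpoly.span (insert f B)" by (intro mpoly.span_minimal) auto
  qed
  then have span6: "mpoly.span (insert f B) = mpoly.span (F ` {..<6})" .
  have c6: "card (insert f B) = 6"
    using mpoly.dim_span_eq_card_independent[OF ind] mpoly.indep_family_dim[OF indF] span6 by simp
  then have c5: "card B = 5" using fB fB' by simp
  have c3: "card (phi ` {..<3}) = 3" using card_image[OF mpoly.indep_family_inj[OF phi]] by simp
  have "card (B - phi ` {..<3}) = 2" using c5 c3 B(1) by (simp add: card_Diff_subset)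
  then obtain x y where xy: "B - phi ` {..<3} = {x, y}" "x \<noteq> y" unfolding card_2_iff by blast
  define F' where "F' s = (if s < 3 then phi s else if s = 3 then x else if s = 4 then y else f)" for s :: nat
  have e5: "{..<5} = {..<3} \<union> {3, 4 :: nat}" and e6: "{..<6} = insert 5 {..<5 :: nat}" by auto
  have im5: "F' ` {..<5} = B"
  proof -
    have 1: "F' ` {..<3} = phi ` {..<3}" by (intro image_cong) (auto simp: F'_def)
    have 2: "F' ` {3, 4} = {x, y}" by (auto simp: F'_def)
    show ?thesis unfolding e5 image_Un 1 2 xy(1)[symmetric] using B(1) by blast
  qed
  have im6: "F' ` {..<6} = insert f B" unfolding e6 image_insert im5 by (simp add: F'_def)
  have "inj_on F' {..<6}" using im6 c6 by (intro eq_card_imp_inj_on) auto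
  then have indF': "mpoly.indep_family F' 6" using im6 ind by (intro mpoly.indep_familyI) auto
  have reg: "gr.gregular F' 6 2"
  proof (rule gregular_base_change[OF F _ indF'])
    fix i :: nat assume "i < 6"
    then have "F' i \<in> F' ` {..<6}" by simp
    then have "F' i \<in> mpoly.span (insert f B)" unfolding im6 by (rule mpoly.span_base)
    then show "F' i \<in> mpoly.span (F ` {..<6})" unfolding span6 .
  qed simp
  have "\<exists>d. F i - smult (c i) f = (\<Sum>s<5. smult (d s) (F' s))" if "i < 6" for i
    using FL[OF that] unfolding spB[symmetric] im5[symmetric] mpoly.span_family .
  then obtain dd where dd: "\<And>i. i < 6 \<Longrightarrow> F i - smult (c i) f = (\<Sum>s<5. smult (dd i s) (F' s))" by metis
  have "F' 5 = f" by (simp add: F'_def)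
  then have "F i = (\<Sum>s<5. smult (dd i s) (F' s)) + smult (c i) (F' 5)" if "i < 6" for i
    unfolding dd[OF that, symmetric] by simp
  moreover have "F' i = phi i" if "i < 3" for i using that by (simp add: F'_def)
  ultimately show ?thesis using reg by (intro exI[of _ F'] exI[of _ dd] conjI allI impI)
qed

text \<open>The quadric \<open>phi i\<close> is \<open>m i * p + m' i * r\<close> modulo \<open>l\<close>; the alternating matrix
  \<open>t i\<close> records the Koszul relation behind \<open>m i * g + m' i * h \<in> (F)\<close>.\<close>

lemma alternating_data_contradiction:
  fixes F :: "nat \<Rightarrow> 'k::field poly6"
  assumes F: "gr.gregular F 6 2"
    and z: "gr.gregular ((!) [l, \<Sum>i<6. smult (c i) (a i), \<Sum>i<6. smult (c i) (b i)]) 3 1"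
    and ab: "\<And>i. a i \<in> hpart 1" "\<And>i. b i \<in> hpart 1"
    and phi: "mpoly.indep_family phi 3"
    and phi_comb: "\<And>i. i < 3 \<Longrightarrow> phi i = (\<Sum>j<6. smult (cc i j) (F j))"
    and H: "\<And>i. i < 3 \<Longrightarrow> m i \<in> hpart 1" "\<And>i. i < 3 \<Longrightarrow> m' i \<in> hpart 1" "\<And>i k. i < 3 \<Longrightarrow> e i k \<in> hpart 1"
    and rel: "\<And>i k. i < 3 \<Longrightarrow> k < 6 \<Longrightarrow>
      m i * a k + m' i * b k - l * e i k = (\<Sum>j<6. smult (t i k j - t i j k) (F j))"
    and cc: "\<And>i j. i < 3 \<Longrightarrow> j < 6 \<Longrightarrow> cc i j = (\<Sum>k<6. c k * (t i k j - t i j k))"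
  shows False
proof -
  define p r where "p = (\<Sum>i<6. smult (c i) (a i))" and "r = (\<Sum>i<6. smult (c i) (b i))"
  let ?z = "(!) [l, p, r]"
  have z: "gr.gregular ?z 3 1" using z unfolding p_def r_def .
  have zI: "u * l + v * p + w * r \<in> gr.gspan ?z 3 1 2" if "u \<in> hpart 1" "v \<in> hpart 1" "w \<in> hpart 1" for u v w
    using gr.gspan_gen[of 0 3 u 2 1 ?z] gr.gspan_gen[of 1 3 v 2 1 ?z] gr.gspan_gen[of 2 3 w 2 1 ?z] that
    by (simp add: gr.gspan_add)
  have "\<exists>k<6. c k \<noteq> 0"
  proof (rule ccontr)
    assume "\<not> ?thesis"
    then have "p = 0" unfolding p_def by simp
    then have "(\<Sum>j<3. smult (if j = 1 then 1 else 0) (?z j)) = 0" by (simp add: numeral_eq_Suc)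
    from mpoly.indep_familyD[OF gregular_indep_family[OF z zero_less_one] this, of 1] show False by simp
  qed
  then obtain k where k: "k < 6" "c k \<noteq> 0" by blast
  \<comment> \<open>The quadratic form of an alternating matrix vanishes at
    \<open>c\<close>.\<close>
  have orth: "(\<Sum>j<6. cc i j * c j) = 0" if i: "i < 3" for i
  proof -
    have "(\<Sum>j<6. cc i j * c j) = (\<Sum>j<6. \<Sum>k<6. c k * t i k j * c j) - (\<Sum>j<6. \<Sum>k<6. c k * t i j k * c j)"
      using i by (simp add: cc sum_distrib_right right_diff_distrib left_diff_distrib sum_subtractf)
    also have "(\<Sum>j<6. \<Sum>k<6. c k * t i j k * c j) = (\<Sum>j<6. \<Sum>k<6. c k * t i k j * c j)"
      by (subst sum.swap) (simp add: mult_ac)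
    finally show ?thesis by simp
  qed
  have comb: "\<exists>u. phi i = (\<Sum>j<6. smult (u j) (F j)) \<and> (\<Sum>j<6. u j * c j) = 0" if "i < 3" for i
    by (intro exI[of _ "cc i"] conjI phi_comb orth that)
  obtain F' dd where F': "gr.gregular F' 6 2" "\<And>i. i < 3 \<Longrightarrow> F' i = phi i"
    "\<And>i. i < 6 \<Longrightarrow> F i = (\<Sum>s<5. smult (dd i s) (F' s)) + smult (c i) (F' 5)"
    using adapted_basis[OF F k phi comb] by blast
  have expand: "(\<Sum>j<6. smult (u j) (F j)) =
      (\<Sum>s<5. smult (\<Sum>j<6. u j * dd j s) (F' s)) + smult (\<Sum>j<6. u j * c j) (F' 5)" for u
  proof -
    have "(\<Sum>j<6. smult (u j) (F j)) =
        (\<Sum>j<6. \<Sum>s<5. smult (u j * dd j s) (F' s)) + (\<Sum>j<6. smult (u j * c j) (F' 5))"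
      by (simp add: F'(3) mpoly.scale_right_distrib mpoly.scale_sum_right sum.distrib)
    also have "(\<Sum>j<6. \<Sum>s<5. smult (u j * dd j s) (F' s)) = (\<Sum>s<5. smult (\<Sum>j<6. u j * dd j s) (F' s))"
      by (subst sum.swap) (simp add: mpoly.scale_sum_left)
    finally show ?thesis by (simp add: mpoly.scale_sum_left)
  qed
  have ind5: "mpoly.indep_family F' 5"
    by (rule gregular_indep_family[OF gr.gregular_prefix[OF F'(1)]]) auto
  \<comment> \<open>Since \<open>phi i\<close> is itself the basis member \<open>F' i\<close>,
    comparing coordinates shows that the columns of \<open>dd\<close> are dual to the vectors
    \<open>cc i\<close>.\<close>
  have delta: "(\<Sum>j<6. cc i j * dd j s) = (if s = i then 1 else 0)" if i: "i < 3" and s: "s < 5" for i s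
  proof (rule indep_family_unique[OF ind5 _ s])
    have "(\<Sum>s<5. smult (if s = i then 1 else 0) (F' s)) = phi i"
      using delta_combination[of i 5 1 F'] i F'(2)[OF i] by simp
    then show "(\<Sum>s<5. smult (\<Sum>j<6. cc i j * dd j s) (F' s)) = (\<Sum>s<5. smult (if s = i then 1 else 0) (F' s))"
      unfolding phi_comb[OF i] expand orth[OF i] by simp
  qed
  have phiz: "phi i \<in> gr.gspan ?z 3 1 2" if i: "i < 3" for i
  proof -
    have "phi i = (\<Sum>j<6. \<Sum>k<6. smult (c k) (smult (t i k j - t i j k) (F j)))"
      unfolding phi_comb[OF i] using i by (intro sum.cong refl) (simp add: cc mpoly.scale_sum_left)
    also have "\<dots> = (\<Sum>k<6. smult (c k) (m i * a k + m' i * b k - l * e i k))"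
      by (subst sum.swap) (simp add: rel[OF i] mpoly.scale_sum_right)
    also have "\<dots> = (- (\<Sum>k<6. smult (c k) (e i k))) * l + m i * p + m' i * r"
      unfolding p_def r_def
      by (simp add: mpoly.scale_right_distrib mpoly.scale_right_diff_distrib sum.distrib sum_subtractf
          sum_distrib_left smult_mult_right algebra_simps)
    also have "\<dots> \<in> gr.gspan ?z 3 1 2"
      using H i by (intro zI gr.uminus_H gr.sum_H smult_hpart) auto
    finally show ?thesis .
  qed
  \<comment> \<open>Contracting with the dual columns of \<open>dd\<close> instead of
    \<open>c\<close> produces the two factors of the singular matrix.\<close>
  define A B where "A j = (\<Sum>k<6. smult (dd k j) (a k))" and "B j = (\<Sum>k<6. smult (dd k j) (b k))" for j
  show False
  proof (rule singular_matrix_contradiction[where m = m and m' = m' and A = A and B = B, OF F'(1) z])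
    show "F' i \<in> gr.gspan ?z 3 1 2" if "i < 3" for i using phiz[OF that] F'(2)[OF that] by simp
    show "A i \<in> hpart 1" "B i \<in> hpart 1" if "i < 3" for i
      unfolding A_def B_def by (intro gr.sum_H smult_hpart ab)+
    show "m i \<in> hpart 1" "m' i \<in> hpart 1" if "i < 3" for i using H that by auto
    fix i j :: nat assume ij: "i < 3" "j < 3"
    define \<theta> where "\<theta> n = (\<Sum>k<6. dd k j * (t i k n - t i n k))" for n
    define E where "E = (\<Sum>k<6. smult (dd k j) (e i k))"
    have "m i * A j + m' i * B j = (\<Sum>k<6. smult (dd k j) (m i * a k + m' i * b k))"
      unfolding A_def B_def by (simp add: mpoly.scale_right_distrib sum.distrib sum_distrib_left smult_mult_right)
    also have "\<dots> = (\<Sum>k<6. smult (dd k j) (l * e i k + (\<Sum>n<6. smult (t i k n - t i n k) (F n))))"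
      by (intro sum.cong refl) (simp add: rel[OF ij(1), symmetric])
    also have "\<dots> = E * l + (\<Sum>k<6. \<Sum>n<6. smult (dd k j * (t i k n - t i n k)) (F n))"
      unfolding E_def
      by (simp add: mpoly.scale_right_distrib sum.distrib sum_distrib_left smult_mult_right
          mpoly.scale_sum_right mult.commute[of _ l])
    also have "(\<Sum>k<6. \<Sum>n<6. smult (dd k j * (t i k n - t i n k)) (F n)) = (\<Sum>n<6. smult (\<theta> n) (F n))"
      unfolding \<theta>_def by (subst sum.swap) (simp add: mpoly.scale_sum_left)
    finally have prod: "m i * A j + m' i * B j = E * l + (\<Sum>n<6. smult (\<theta> n) (F n))" .
    \<comment> \<open>Moving the alternating matrix to the other factor changes the sign, so
      \<open>\<theta>\<close> pairs with \<open>c\<close> to minus the pairing of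
      \<open>cc i\<close> with column \<open>j\<close>, that is, to minus an entry of the identity
      matrix. By \<open>expand\<close> this is the coefficient of \<open>F' 5\<close>.\<close>
    have "(\<Sum>n<6. \<theta> n * c n) = - (\<Sum>k<6. cc i k * dd k j)"
    proof -
      have "(\<Sum>n<6. \<theta> n * c n) = (\<Sum>k<6. \<Sum>n<6. dd k j * (t i k n - t i n k) * c n)"
        unfolding \<theta>_def sum_distrib_right by (rule sum.swap)
      also have "\<dots> = (\<Sum>k<6. - (cc i k * dd k j))"
      proof (rule sum.cong[OF refl])
        fix k :: nat assume "k \<in> {..<6}"
        then have k: "cc i k = (\<Sum>n<6. c n * (t i n k - t i k n))" using cc[OF ij(1)] by simp
        show "(\<Sum>n<6. dd k j * (t i k n - t i n k) * c n) = - (cc i k * dd k j)"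
          unfolding k sum_distrib_right sum_negf[symmetric] by (intro sum.cong refl) (simp add: algebra_simps)
      qed
      finally show ?thesis by (simp add: sum_negf)
    qed
    then have "(\<Sum>n<6. \<theta> n * c n) = - (if i = j then 1 else 0)" using delta[of i j] ij by auto
    then have "(\<Sum>n<6. smult (\<theta> n) (F n)) = (\<Sum>s<5. smult (\<Sum>n<6. \<theta> n * dd n s) (F' s)) - (if i = j then F' 5 else 0)"
      unfolding expand by simp
    then have eq: "m i * A j + m' i * B j + (if i = j then F' 5 else 0) =
        E * l + (\<Sum>s<5. smult (\<Sum>n<6. \<theta> n * dd n s) (F' s))" unfolding prod by simp
    have "(\<Sum>s<5. smult (\<Sum>n<6. \<theta> n * dd n s) (F' s)) = (\<Sum>s<3. smult (\<Sum>n<6. \<theta> n * dd n s) (F' s))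
        + smult (\<Sum>n<6. \<theta> n * dd n 3) (F' 3) + smult (\<Sum>n<6. \<theta> n * dd n 4) (F' 4)"
      using sum.lessThan_Suc[of "\<lambda>s. smult (\<Sum>n<6. \<theta> n * dd n s) (F' s)" 4]
        sum.lessThan_Suc[of "\<lambda>s. smult (\<Sum>n<6. \<theta> n * dd n s) (F' s)" 3] by simp
    moreover have "E * l + (\<Sum>s<3. smult (\<Sum>n<6. \<theta> n * dd n s) (F' s)) \<in> gr.gspan ?z 3 1 2"
    proof (rule gr.gspan_add)
      have "E \<in> hpart 1" unfolding E_def using H(3)[OF ij(1)] by (intro gr.sum_H smult_hpart) auto
      then show "E * l \<in> gr.gspan ?z 3 1 2" using zI[of E 0 0] by (simp add: gr.zero_H)
      show "(\<Sum>s<3. smult (\<Sum>n<6. \<theta> n * dd n s) (F' s)) \<in> gr.gspan ?z 3 1 2"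
        by (intro mpoly.subspace_sum[OF gspan_subspace] mpoly.subspace_scale[OF gspan_subspace])
          (use phiz F'(2) in auto)
    qed
    ultimately show "\<exists>q\<in>gr.gspan ?z 3 1 2. \<exists>s t. m i * A j + m' i * B j + (if i = j then F' 5 else 0)
        = q + smult s (F' 3) + smult t (F' 4)"
      unfolding eq by (metis (no_types, lifting) add.assoc)
  qed
qed

text \<open>Modulo \<open>L\<close>, the multiples of \<open>l\<close>, the map \<open>S\<close> has
  kernel of dimension at most 3 on \<open>W\<close>, hence an image of dimension at least 3. Modulo
  \<open>L\<close> each \<open>S w\<close> is also a member of \<open>Phi\<close>, so
  \<open>Phi\<close> contains the three independent quadrics that
  \<open>alternating_data_contradiction\<close> excludes.\<close>

lemma dim_ge_43_common_annihilator:
  fixes F :: "nat \<Rightarrow> 'k::field poly6"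
  assumes F: "gr.gregular F 6 2" and gh: "g \<in> hpart 2" "h \<in> hpart 2"
    and ind: "\<And>s t. smult s g + smult t h \<in> gr.gspan F 6 2 2 \<Longrightarrow> s = 0 \<and> t = 0"
    and l: "l \<in> hpart 1" "l \<noteq> 0" "l * g \<in> gr.gspan F 6 2 3" "l * h \<in> gr.gspan F 6 2 3"
  shows "43 \<le> mpoly.dim (cubics F g h)"
proof (rule ccontr)
  let ?N = "gr.gspan F 6 2 3" and ?V = "hpart 1 :: 'k poly6 set"
  let ?I = "{x + m * g + m' * h |x m m'. x \<in> ?N \<and> m \<in> ?V \<and> m' \<in> ?V}"
  assume "\<not> 43 \<le> mpoly.dim ?I"
  then have small: "mpoly.dim ?I \<le> 42" by simp
  have FH: "F i \<in> hpart 2" if "i < 6" for i using gr.gregular_H[OF F that] .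
  have NH: "?N \<subseteq> hpart 3" using gr.gspan_H[of 6 F 2] FH by auto
  obtain a where a: "\<And>i. a i \<in> hpart 1" "l * g = (\<Sum>i<6. a i * F i)"
    using l(3) by (rule gr.gspanE) auto
  obtain b where b: "\<And>i. b i \<in> hpart 1" "l * h = (\<Sum>i<6. b i * F i)"
    using l(4) by (rule gr.gspanE) auto
  obtain c where c: "mpoly.indep_family ((!) [l, \<Sum>i<6. smult (c i) (a i), \<Sum>i<6. smult (c i) (b i)]) 3"
    using independent_combination_exists[OF F gh ind l(1,2) a b] by blast
  define p r where "p = (\<Sum>i<6. smult (c i) (a i))" and "r = (\<Sum>i<6. smult (c i) (b i))"
  have prH: "p \<in> ?V" "r \<in> ?V" unfolding p_def r_def by (intro gr.sum_H smult_hpart a b)+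
  have z: "gr.gregular ((!) [l, p, r]) 3 1"
    by (rule gregular_linear_forms[OF c[folded p_def r_def]])
      (use prH l in \<open>auto simp: numeral_eq_Suc less_Suc_eq\<close>)
  define T S where "T w = fst w * g + snd w * h" and "S w = fst w * p + snd w * r" for w
  have linT: "Vector_Spaces.linear smult2 smult T" and linS: "Vector_Spaces.linear smult2 smult S"
    unfolding T_def S_def by (rule linear_pair_combination)+
  interpret S: Vector_Spaces.linear smult2 smult S by (rule linS)
  interpret T: Vector_Spaces.linear smult2 smult T by (rule linT)
  define W where "W = {w \<in> ?V \<times> ?V. T w \<in> ?N}"
  obtain G where G: "finite G" "hpart 3 \<subseteq> mpoly.span (G :: 'k poly6 set)" by (rule hpart_finite_span)
  obtain G2 where G2: "finite G2" "hpart 2 \<subseteq> mpoly.span (G2 :: 'k poly6 set)" by (rule hpart_finite_span)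
  obtain GP where GP: "finite GP" "?V \<times> ?V \<subseteq> pairs.span GP" by (rule pairs_finite_span)
  have NG: "?N \<subseteq> mpoly.span G" using NH G by blast
  have "{x + T w |x w. x \<in> ?N \<and> w \<in> ?V \<times> ?V} = ?I"
  proof (intro Set.set_eqI iffI)
    fix y assume "y \<in> {x + T w |x w. x \<in> ?N \<and> w \<in> ?V \<times> ?V}"
    then show "y \<in> ?I" unfolding T_def by (auto simp: add.assoc)
  next
    fix y assume "y \<in> ?I"
    then obtain x m m' where "y = x + m * g + m' * h" "x \<in> ?N" "m \<in> ?V" "m' \<in> ?V" by blast
    then have "y = x + T (m, m')" "(m, m') \<in> ?V \<times> ?V" by (auto simp: T_def add.assoc)
    then show "y \<in> {x + T w |x w. x \<in> ?N \<and> w \<in> ?V \<times> ?V}" using \<open>x \<in> ?N\<close> by blast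
  qed
  \<comment> \<open>From \<open>36 + 12 - dim W \<le> 42\<close>.\<close>
  then have W6: "6 \<le> pairs.dim W"
    using pairs_mpoly.dim_sum_image[OF linT pairs_subspace GP(2,1) gspan_subspace NG G(1)] small
    unfolding W_def by (simp add: dim_pairs dim_ideal_degree_3[OF F])
  have Ws: "pairs.subspace W"
    using pairs.subspace_inter[OF pairs_subspace T.subspace_linear_preimage[OF gspan_subspace]]
    by (simp add: W_def Int_def)
  have WV: "W \<subseteq> ?V \<times> ?V" by (auto simp: W_def)
  then have WG: "W \<subseteq> pairs.span GP" using GP by blast
  define L where "L = (\<lambda>m. m * l) ` ?V"
  have Ls: "mpoly.subspace L"
  proof -
    interpret M: Vector_Spaces.linear smult smult "\<lambda>m. m * l" by (rule linear_mult_right)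
    show ?thesis unfolding L_def by (rule M.subspace_image[OF hpart_subspace])
  qed
  have two: "x * y \<in> hpart 2" if "x \<in> ?V" "y \<in> ?V" for x y using gr.mult_H[OF that] by simp
  have LH: "L \<subseteq> hpart 2" unfolding L_def using two l by blast
  have LG: "L \<subseteq> mpoly.span G2" using LH G2 by blast
  have "{w \<in> W. S w \<in> L} \<subseteq> pairs.span {(l, 0), (0, l), (r, - p)}"
  proof safe
    fix m m' assume w: "(m, m') \<in> W" "S (m, m') \<in> L"
    then obtain n where n: "n \<in> ?V" "m * p + m' * r = n * l" unfolding S_def L_def by auto
    have mm: "m \<in> ?V" "m' \<in> ?V" using w(1) WV by auto
    show "(m, m') \<in> pairs.span {(l, 0), (0, l), (r, - p)}"
      by (rule linear_relations_in_span[OF z mm n])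
  qed
  then have "pairs.dim {w \<in> W. S w \<in> L} \<le> card {(l, 0), (0, l), (r, - p)}"
    by (rule pairs.dim_le_card) simp
  also have "\<dots> \<le> 3" by (rule card_insert_le_m1 | simp)+
  finally have LS: "mpoly.dim L + 3 \<le> mpoly.dim {x + S w |x w. x \<in> L \<and> w \<in> W}"
    using pairs_mpoly.dim_sum_image[OF linS Ws WG GP(1) Ls LG G2(1)] W6 by simp
  \<comment> \<open>\<open>D\<close> bundles a pair of linear forms with the Koszul data of its
    relation. Collecting all admissible data at once makes \<open>Phi\<close> a subspace without
    choosing \<open>e\<close> and \<open>t\<close> linearly in the pair.\<close>
  define D where "D cc m m' e t \<longleftrightarrow> m \<in> ?V \<and> m' \<in> ?V \<and> (\<forall>k. e k \<in> ?V) \<and>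
    (\<forall>k<6. m * a k + m' * b k - l * e k = (\<Sum>j<6. smult (t k j - t j k) (F j))) \<and>
    (\<forall>j<6. cc j = (\<Sum>k<6. c k * (t k j - t j k)))" for cc m m' e and t :: "nat \<Rightarrow> nat \<Rightarrow> 'k"
  define Phi where "Phi = {x. \<exists>cc m m' e t. x = (\<Sum>j<6. smult (cc j) (F j)) \<and> D cc m m' e t}"
  have D_add: "D (\<lambda>j. cc j + cc' j) (m + n) (m' + n') (\<lambda>k. e k + e' k) (\<lambda>i j. t i j + t' i j)"
    if "D cc m m' e t" "D cc' n n' e' t'" for cc m m' e t cc' n n' e' t'
    unfolding D_def
  proof (intro conjI allI impI)
    fix k :: nat assume k: "k < 6"
    have "(m + n) * a k + (m' + n') * b k - l * (e k + e' k) =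
        (m * a k + m' * b k - l * e k) + (n * a k + n' * b k - l * e' k)" by (simp add: algebra_simps)
    also have "\<dots> = (\<Sum>j<6. smult (t k j - t j k) (F j)) + (\<Sum>j<6. smult (t' k j - t' j k) (F j))"
      using that k unfolding D_def by simp
    also have "\<dots> = (\<Sum>j<6. smult (t k j + t' k j - (t j k + t' j k)) (F j))"
      unfolding sum.distrib[symmetric] mpoly.scale_left_distrib[symmetric] by (simp add: algebra_simps)
    finally show "(m + n) * a k + (m' + n') * b k - l * (e k + e' k) =
        (\<Sum>j<6. smult (t k j + t' k j - (t j k + t' j k)) (F j))" .
    have "cc k + cc' k = (\<Sum>i<6. c i * (t i k - t k i)) + (\<Sum>i<6. c i * (t' i k - t' k i))"
      using that k unfolding D_def by simp
    then show "cc k + cc' k = (\<Sum>i<6. c i * (t i k + t' i k - (t k i + t' k i)))"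
      unfolding sum.distrib[symmetric] distrib_left[symmetric] by (simp add: algebra_simps)
  qed (use that in \<open>auto simp: D_def intro: gr.add_H\<close>)
  have D_scale: "D (\<lambda>j. s * cc j) (smult s m) (smult s m') (\<lambda>k. smult s (e k)) (\<lambda>i j. s * t i j)"
    if "D cc m m' e t" for s cc m m' e t
    unfolding D_def
  proof (intro conjI allI impI)
    fix k :: nat assume k: "k < 6"
    have "smult s m * a k + smult s m' * b k - l * smult s (e k) = smult s (m * a k + m' * b k - l * e k)"
      by (simp add: smult_mult_left smult_mult_right mpoly.scale_right_distrib mpoly.scale_right_diff_distrib)
    also have "\<dots> = smult s (\<Sum>j<6. smult (t k j - t j k) (F j))" using that k unfolding D_def by simp
    also have "\<dots> = (\<Sum>j<6. smult (s * t k j - s * t j k) (F j))"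
      by (simp add: mpoly.scale_sum_right right_diff_distrib)
    finally show "smult s m * a k + smult s m' * b k - l * smult s (e k) = (\<Sum>j<6. smult (s * t k j - s * t j k) (F j))" .
    have "s * cc k = s * (\<Sum>i<6. c i * (t i k - t k i))" using that k unfolding D_def by simp
    then show "s * cc k = (\<Sum>i<6. c i * (s * t i k - s * t k i))"
      unfolding sum_distrib_left by (simp add: algebra_simps)
  qed (use that in \<open>auto simp: D_def intro: smult_hpart\<close>)
  have Phis: "mpoly.subspace Phi"
  proof (rule mpoly.subspaceI)
    have "D (\<lambda>_. 0) 0 0 (\<lambda>_. 0) (\<lambda>_ _. 0)" by (simp add: D_def gr.zero_H)
    then show "0 \<in> Phi" unfolding Phi_def by force
    fix x y assume "x \<in> Phi" "y \<in> Phi"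
    then obtain cc m m' e t cc' n n' e' t' where x: "x = (\<Sum>j<6. smult (cc j) (F j))" "D cc m m' e t"
      and y: "y = (\<Sum>j<6. smult (cc' j) (F j))" "D cc' n n' e' t'" unfolding Phi_def by blast
    have "x + y = (\<Sum>j<6. smult (cc j + cc' j) (F j))"
      unfolding x(1) y(1) by (simp add: mpoly.scale_left_distrib sum.distrib)
    then show "x + y \<in> Phi" unfolding Phi_def using D_add[OF x(2) y(2)] by (intro CollectI exI conjI)
  next
    fix s x assume "x \<in> Phi"
    then obtain cc m m' e t where x: "x = (\<Sum>j<6. smult (cc j) (F j))" "D cc m m' e t" unfolding Phi_def by blast
    have "smult s x = (\<Sum>j<6. smult (s * cc j) (F j))" unfolding x(1) by (simp add: mpoly.scale_sum_right)
    then show "smult s x \<in> Phi" unfolding Phi_def using D_scale[OF x(2)] by (intro CollectI exI conjI)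
  qed
  have PhiH: "Phi \<subseteq> hpart 2"
    unfolding Phi_def using FH by (auto intro!: gr.sum_H smult_hpart)
  then have PhiG: "Phi \<subseteq> mpoly.span G2" using G2 by blast
  have S_mem: "\<exists>x\<in>L. \<exists>y\<in>Phi. S w = x + y" if w: "w \<in> W" for w
  proof -
    obtain m m' where mm: "w = (m, m')" "m \<in> ?V" "m' \<in> ?V" using w WV by auto
    have "m * g + m' * h \<in> ?N" using w by (simp add: W_def T_def mm)
    then obtain e where e: "\<And>k. e k \<in> ?V" "m * g + m' * h = (\<Sum>k<6. e k * F k)"
      by (rule gr.gspanE) auto
    define u where "u k = m * a k + m' * b k - l * e k" for k
    \<comment> \<open>Expanding \<open>l * (m * g + m' * h)\<close> in two ways makes
      \<open>u\<close> a syzygy. Its entries have degree 2, so the Koszul matrix has scalar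
      entries.\<close>
    have "(\<Sum>k<6. u k * F k) = m * (l * g) + m' * (l * h) - l * (m * g + m' * h)"
      unfolding u_def a(2) b(2) e(2)
      by (simp add: sum_distrib_left sum.distrib sum_subtractf distrib_right left_diff_distrib mult.assoc)
    also have "\<dots> = 0" by (simp add: algebra_simps)
    finally have "(\<Sum>k<6. u k * F k) = 0" .
    moreover have "u k \<in> hpart 2" for k
      unfolding u_def by (intro gr.diff_H gr.add_H two mm a b e l)
    ultimately obtain t where t: "\<And>i j. t i j \<in> hpart (2 - 2)" "\<And>k. k < 6 \<Longrightarrow> u k = (\<Sum>j<6. (t k j - t j k) * F j)"
      using gr.gsyzE[OF gr.gregular_imp_gsyz[OF F], of u 2] by blast
    have "\<exists>s. t i j = single 0 s" for i j using t(1)[of i j] by (simp add: hpart_0_iff)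
    then obtain \<tau> where \<tau>: "\<And>i j. t i j = single 0 (\<tau> i j)" by metis
    have u: "u k = (\<Sum>j<6. smult (\<tau> k j - \<tau> j k) (F j))" if "k < 6" for k
      using t(2)[OF that] by (simp add: \<tau> smult_def single_diff)
    define cc where "cc j = (\<Sum>k<6. c k * (\<tau> k j - \<tau> j k))" for j
    have D: "D cc m m' e \<tau>" unfolding D_def using mm e u by (simp add: cc_def u_def)
    have "(\<Sum>j<6. smult (cc j) (F j)) = (\<Sum>k<6. smult (c k) (u k))"
    proof -
      have "(\<Sum>j<6. smult (cc j) (F j)) = (\<Sum>j<6. \<Sum>k<6. smult (c k * (\<tau> k j - \<tau> j k)) (F j))"
        by (simp add: cc_def mpoly.scale_sum_left)
      also have "\<dots> = (\<Sum>k<6. smult (c k) (u k))"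
        by (subst sum.swap) (simp add: u mpoly.scale_sum_right)
      finally show ?thesis .
    qed
    also have "\<dots> = m * p + m' * r - (\<Sum>k<6. smult (c k) (e k)) * l"
      unfolding u_def p_def r_def
      by (simp add: mpoly.scale_right_distrib mpoly.scale_right_diff_distrib sum.distrib sum_subtractf
          sum_distrib_left smult_mult_right mult.commute[of _ l])
    finally have "S w = (\<Sum>k<6. smult (c k) (e k)) * l + (\<Sum>j<6. smult (cc j) (F j))"
      by (simp add: S_def mm)
    moreover have "(\<Sum>k<6. smult (c k) (e k)) * l \<in> L"
      unfolding L_def by (intro imageI gr.sum_H smult_hpart e)
    moreover have "(\<Sum>j<6. smult (cc j) (F j)) \<in> Phi" unfolding Phi_def using D by blast
    ultimately show ?thesis by blast
  qed
  have sub: "{x + S w |x w. x \<in> L \<and> w \<in> W} \<subseteq> {x + y |x y. x \<in> L \<and> y \<in> Phi}"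
  proof safe
    fix x w assume xw: "x \<in> L" "w \<in> W"
    from S_mem[OF xw(2)] obtain x' y where "x' \<in> L" "y \<in> Phi" "S w = x' + y" by blast
    then show "\<exists>x' y. x + S w = x' + y \<and> x' \<in> L \<and> y \<in> Phi"
      using mpoly.subspace_add[OF Ls xw(1)] by (intro exI[of _ "x + x'"] exI[of _ y]) (simp add: add.assoc)
  qed
  have "{x + y |x y. x \<in> L \<and> y \<in> Phi} \<subseteq> hpart 2" using LH PhiH by (auto intro: gr.add_H)
  from hpart_dim_mono[OF sub this] have "mpoly.dim L + 3 \<le> mpoly.dim {x + y |x y. x \<in> L \<and> y \<in> Phi}"
    using LS by simp
  moreover have "mpoly.dim {x + y |x y. x \<in> L \<and> y \<in> Phi} \<le> mpoly.dim L + mpoly.dim Phi"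
    using mpolys.dim_sum_image[OF mpoly.linear_ident Phis PhiG G2(1) Ls LG G2(1)] by simp
  ultimately have "3 \<le> mpoly.dim Phi" by simp
  from mpoly.dim_imp_indep_family[OF Phis PhiG G2(1) this]
  obtain phi where phi: "mpoly.indep_family phi 3" "phi ` {..<3} \<subseteq> Phi" .
  define R where "R i w \<longleftrightarrow> phi i = (\<Sum>j<6. smult (fst w j) (F j)) \<and>
      D (fst w) (fst (snd w)) (fst (snd (snd w))) (fst (snd (snd (snd w)))) (snd (snd (snd (snd w))))" for i w
  have "\<exists>w. R i w" if "i < 3" for i
  proof -
    have "phi i \<in> Phi" using phi(2) that by blast
    then obtain cc m m' e t where "phi i = (\<Sum>j<6. smult (cc j) (F j))" "D cc m m' e t"
      unfolding Phi_def by blast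
    then show ?thesis by (intro exI[of _ "(cc, m, m', e, t)"]) (simp add: R_def)
  qed
  then obtain w where w: "\<And>i. i < 3 \<Longrightarrow> R i (w i)" by metis
  define cc m m' e t where "cc i = fst (w i)" and "m i = fst (snd (w i))" and "m' i = fst (snd (snd (w i)))"
    and "e i = fst (snd (snd (snd (w i))))" and "t i = snd (snd (snd (snd (w i))))" for i
  have cm: "phi i = (\<Sum>j<6. smult (cc i j) (F j))" "D (cc i) (m i) (m' i) (e i) (t i)" if "i < 3" for i
    using w[OF that] unfolding R_def cc_def m_def m'_def e_def t_def by blast+
  have z': "gr.gregular ((!) [l, \<Sum>i<6. smult (c i) (a i), \<Sum>i<6. smult (c i) (b i)]) 3 1"
    using z unfolding p_def r_def .
  show False
  proof (rule alternating_data_contradiction[where c = c and m = m and m' = m' and e = e and t = t and cc = cc,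
        OF F z' a(1) b(1) phi(1)])
    fix i :: nat assume i: "i < 3"
    show "phi i = (\<Sum>j<6. smult (cc i j) (F j))" by (rule cm(1)[OF i])
    note d = cm(2)[OF i, unfolded D_def]
    show "m i \<in> ?V" "m' i \<in> ?V" "e i k \<in> ?V" for k using d by blast+
    show "m i * a k + m' i * b k - l * e i k = (\<Sum>j<6. smult (t i k j - t i j k) (F j))" if "k < 6" for k
      using d that by blast
    show "cc i j = (\<Sum>k<6. c k * (t i k j - t i j k))" if "j < 6" for j
      using d that by blast
  qed
qed

section \<open>Combination of the cases over an algebraically closed field\<close>

lemma gspan_add_two:
  "gr.gspan F (Suc (Suc n)) 2 3 = {x + m * F n + m' * F (Suc n) |x m m'. x \<in> gr.gspan F n 2 3 \<and> m \<in> hpart 1 \<and> m' \<in> hpart 1}"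
proof (intro Set.set_eqI iffI)
  fix x assume "x \<in> gr.gspan F (Suc (Suc n)) 2 3"
  then obtain y a where y: "y \<in> gr.gspan F (Suc n) 2 3" "a \<in> hpart (3 - 2)" "x = y + a * F (Suc n)"
    by (rule gr.gspan_SucE)
  from y(1) obtain w b where "w \<in> gr.gspan F n 2 3" "b \<in> hpart (3 - 2)" "y = w + b * F n"
    by (rule gr.gspan_SucE)
  with y show "x \<in> {x + m * F n + m' * F (Suc n) |x m m'. x \<in> gr.gspan F n 2 3 \<and> m \<in> hpart 1 \<and> m' \<in> hpart 1}"
    by auto
next
  fix x assume "x \<in> {x + m * F n + m' * F (Suc n) |x m m'. x \<in> gr.gspan F n 2 3 \<and> m \<in> hpart 1 \<and> m' \<in> hpart 1}"
  then obtain w m m' where x: "x = w + m * F n + m' * F (Suc n)" "w \<in> gr.gspan F n 2 3" "m \<in> hpart 1" "m' \<in> hpart 1"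
    by blast
  show "x \<in> gr.gspan F (Suc (Suc n)) 2 3" unfolding x(1)
    by (intro gr.gspan_add gr.gspan_gen gr.gspan_mono_Suc[OF gr.gspan_mono_Suc[OF x(2)]]) (use x in auto)
qed

text \<open>As \<open>a\<close> is nonzero, the annihilated member of the pencil can replace
  \<open>g\<close> among the generators. The cases are whether \<open>l\<close> also annihilates
  \<open>h\<close>, and with it the whole pencil.\<close>

lemma dim_ge_43_pencil_annihilator:
  fixes F :: "nat \<Rightarrow> 'k::field poly6"
  assumes F: "gr.gregular F 6 2" and gh: "g \<in> hpart 2" "h \<in> hpart 2"
    and ind: "\<And>s t. smult s g + smult t h \<in> gr.gspan F 6 2 2 \<Longrightarrow> s = 0 \<and> t = 0"
    and l: "l \<in> hpart 1" "l \<noteq> 0" "l * (smult a g + smult b h) \<in> gr.gspan F 6 2 3" and a: "a \<noteq> 0"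
  shows "43 \<le> mpoly.dim (cubics F g h)"
proof (cases "l * h \<in> gr.gspan F 6 2 3")
  case False
  define q where "q = smult a g + smult b h"
  have q: "q \<in> hpart 2" unfolding q_def by (intro gr.add_H smult_hpart gh)
  have "q \<notin> gr.gspan F 6 2 2" using ind a unfolding q_def by blast
  from dim_ge_43_single_annihilator[OF F q gh(2) this l(1) l(3)[folded q_def] False]
  have "43 \<le> mpoly.dim (cubics F q h)" .
  also have "cubics F q h = cubics F g h" (is "?A = ?B")
  proof (intro Set.set_eqI iffI)
    fix y assume "y \<in> ?A"
    then obtain x m m' where y: "y = x + m * q + m' * h" "x \<in> gr.gspan F 6 2 3" "m \<in> hpart 1" "m' \<in> hpart 1" by blast
    have "y = x + smult a m * g + (m' + smult b m) * h"
      by (simp add: y q_def distrib_left distrib_right smult_mult_left smult_mult_right add_ac)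
    then show "y \<in> ?B" using y smult_hpart gr.add_H by blast
  next
    fix y assume "y \<in> ?B"
    then obtain x m m' where y: "y = x + m * g + m' * h" "x \<in> gr.gspan F 6 2 3" "m \<in> hpart 1" "m' \<in> hpart 1" by blast
    have "y = x + smult (1 / a) m * q + (m' - smult (b / a) m) * h"
      using a by (simp add: y q_def distrib_left left_diff_distrib mpoly.scale_right_distrib smult_mult_left smult_mult_right add_ac)
    then show "y \<in> ?A" using y smult_hpart gr.diff_H by blast
  qed
  finally show ?thesis .
next
  case True
  have "l * g = smult (1 / a) (l * (smult a g + smult b h) - smult b (l * h))"
    using a by (simp add: distrib_left smult_mult_right)
  also have "\<dots> \<in> gr.gspan F 6 2 3"
    by (intro mpoly.subspace_scale[OF gspan_subspace] mpoly.subspace_diff[OF gspan_subspace] l True)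
  finally show ?thesis by (intro dim_ge_43_common_annihilator[OF F gh _ l(1,2) _ True] ind)
qed

lemma dim_ge_43_alg_closed:
  fixes F :: "nat \<Rightarrow> 'k::alg_closed_field poly6"
  assumes F: "gr.gregular F 6 2" and gh: "F 6 \<in> hpart 2" "F 7 \<in> hpart 2"
    and ind: "\<And>s t. smult s (F 6) + smult t (F 7) \<in> gr.gspan F 6 2 2 \<Longrightarrow> s = 0 \<and> t = 0"
  shows "43 \<le> mpoly.dim (gr.gspan F 8 2 3)"
proof (rule ccontr)
  let ?I = "cubics F"
  assume not: "\<not> 43 \<le> mpoly.dim (gr.gspan F 8 2 3)"
  have eq: "gr.gspan F 8 2 3 = ?I (F 6) (F 7)" using gspan_add_two[of F 6] by (simp add: numeral_eq_Suc)
  \<comment> \<open>For \<open>a = 0\<close> the annihilated member is a multiple of the last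
    generator, and the two roles are exchanged.\<close>
  have swap: "?I (F 7) (F 6) = ?I (F 6) (F 7)"
  proof (intro Set.set_eqI iffI)
    fix y assume "y \<in> ?I (F 7) (F 6)"
    then obtain x m m' where "y = x + m * F 7 + m' * F 6" "x \<in> gr.gspan F 6 2 3" "m \<in> hpart 1" "m' \<in> hpart 1" by blast
    then have "y = x + m' * F 6 + m * F 7 \<and> x \<in> gr.gspan F 6 2 3 \<and> m' \<in> hpart 1 \<and> m \<in> hpart 1" by (simp add: add_ac)
    then show "y \<in> ?I (F 6) (F 7)" by blast
  next
    fix y assume "y \<in> ?I (F 6) (F 7)"
    then obtain x m m' where "y = x + m * F 6 + m' * F 7" "x \<in> gr.gspan F 6 2 3" "m \<in> hpart 1" "m' \<in> hpart 1" by blast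
    then have "y = x + m' * F 7 + m * F 6 \<and> x \<in> gr.gspan F 6 2 3 \<and> m' \<in> hpart 1 \<and> m \<in> hpart 1" by (simp add: add_ac)
    then show "y \<in> ?I (F 7) (F 6)" by blast
  qed
  have "mpoly.dim (?I (F 6) (F 7)) \<le> 42" using not eq by simp
  from pencil_annihilator_exists[OF F gh this] obtain l a b where
    l: "l \<in> hpart 1" "l \<noteq> 0" "a \<noteq> 0 \<or> b \<noteq> 0" "l * (smult a (F 6) + smult b (F 7)) \<in> gr.gspan F 6 2 3" .
  have "43 \<le> mpoly.dim (?I (F 6) (F 7))"
  proof (cases "a = 0")
    case False
    from dim_ge_43_pencil_annihilator[OF F gh ind l(1,2,4) False] show ?thesis .
  next
    case True
    then have b: "b \<noteq> 0" using l(3) by simp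
    have ind': "s = 0 \<and> t = 0" if "smult s (F 7) + smult t (F 6) \<in> gr.gspan F 6 2 2" for s t
      using ind[of t s] that by (simp add: add.commute)
    have "l * (smult b (F 7) + smult a (F 6)) \<in> gr.gspan F 6 2 3" using l(4) by (simp add: add.commute)
    from dim_ge_43_pencil_annihilator[OF F gh(2,1) ind' l(1,2) this b] show ?thesis unfolding swap .
  qed
  then show False using not eq by simp
qed

section \<open>Extension of scalars\<close>

definition cmap :: "('a::zero \<Rightarrow> 'b::zero) \<Rightarrow> ('x, 'a) mpoly \<Rightarrow> ('x, 'b) mpoly" where
  "cmap f p = Poly_Mapping.map f p"

lemma lookup_cmap: "f 0 = 0 \<Longrightarrow> lookup (cmap f p) m = f (lookup p m)"
  by (simp add: cmap_def Poly_Mapping.map.rep_eq when_def)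

lemma cmap_sum:
  fixes f :: "'a::comm_ring_1 \<Rightarrow> 'b::comm_ring_1"
  assumes "f 0 = 0" "\<And>x y. f (x + y) = f x + f y"
  shows "cmap f (sum p A) = (\<Sum>i\<in>A. cmap f (p i))"
proof (rule poly_mapping_eqI)
  have "f (sum g A) = (\<Sum>i\<in>A. f (g i))" for g
    by (induction A rule: infinite_finite_induct) (simp_all add: assms)
  then show "lookup (cmap f (sum p A)) m = lookup (\<Sum>i\<in>A. cmap f (p i)) m" for m
    by (simp add: lookup_cmap assms(1) lookup_sum)
qed

lemma cmap_add:
  fixes f :: "'a::comm_ring_1 \<Rightarrow> 'b::comm_ring_1"
  assumes "f 0 = 0" "\<And>x y. f (x + y) = f x + f y"
  shows "cmap f (p + q) = cmap f p + cmap f q"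
  by (rule poly_mapping_eqI) (simp add: lookup_cmap assms lookup_add)

lemma cmap_single: "f 0 = 0 \<Longrightarrow> cmap f (single m c) = single m (f c)"
  by (rule poly_mapping_eqI) (simp add: lookup_cmap lookup_single when_def)

lemma cmap_hpart: "f 0 = 0 \<Longrightarrow> p \<in> hpart d \<Longrightarrow> cmap f p \<in> hpart d"
  by (auto simp: hpart_def in_keys_iff lookup_cmap)

lemma cmap_expand:
  assumes "f 0 = 0"
  shows "cmap f p = (\<Sum>m\<in>keys p. single m (f (lookup p m)))"
  by (rule poly_mapping_eqI)
    (auto simp: lookup_cmap assms lookup_sum lookup_single when_def in_keys_iff sum.delta)

text \<open>One statement for two purposes. With \<open>u\<close> the identity and
  \<open>v = f = to_ac\<close> it makes extension of scalars multiplicative. With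
  \<open>u = to_ac\<close>, \<open>v\<close> the identity and \<open>f\<close> a coordinate
  functional it makes taking coordinates linear over polynomials with coefficients in the base
  field.\<close>

lemma cmap_mult:
  fixes u :: "'a::comm_ring_1 \<Rightarrow> 'b::comm_ring_1" and v :: "'a \<Rightarrow> 'c::comm_ring_1" and f :: "'b \<Rightarrow> 'c"
  assumes u: "u 0 = 0" and v: "v 0 = 0" and f: "f 0 = 0" "\<And>x y. f (x + y) = f x + f y"
    and mult: "\<And>c d. f (u c * d) = v c * f d"
  shows "cmap f (cmap u q * p) = cmap v q * cmap f p"
proof -
  have "cmap u q * p = (\<Sum>m\<in>keys q. \<Sum>n\<in>keys p.
      single (m + n) (u (lookup q m) * lookup p n))"
    unfolding cmap_expand[where f = u, OF u]
    by (subst poly_mapping_sum_single[of p]) (simp add: sum_product mult_single)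
  then have "cmap f (cmap u q * p) = (\<Sum>m\<in>keys q. \<Sum>n\<in>keys p.
      single (m + n) (v (lookup q m) * f (lookup p n)))"
    by (simp add: cmap_sum[OF f] cmap_single f(1) mult)
  also have "\<dots> = cmap v q * cmap f p"
    unfolding cmap_expand[where f = v, OF v] cmap_expand[where f = f, OF f(1)] by (simp add: sum_product mult_single)
  finally show ?thesis .
qed


abbreviation ext :: "('x, 'k::field) mpoly \<Rightarrow> ('x, 'k alg_closure) mpoly" where
  "ext \<equiv> cmap to_ac"

interpretation ac: vector_space "\<lambda>(c :: 'k::field) (x :: 'k alg_closure). to_ac c * x"
  by unfold_locales (simp_all add: distrib_left distrib_right)

text \<open>Coordinates with respect to a fixed basis of the closure over the base field. Applied
  coefficientwise they carry ideal membership over the closure back to the base field.\<close>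

definition ac_coord :: "'k::field alg_closure \<Rightarrow> 'k alg_closure \<Rightarrow> 'k" where
  "ac_coord b x = ac.representation (ac.extend_basis {}) x b"

lemma ac_basis: "ac.independent (ac.extend_basis {})" "ac.span (ac.extend_basis {}) = UNIV"
  using ac.independent_extend_basis ac.span_extend_basis ac.independent_empty by auto

lemma ac_coord_add: "ac_coord b (x + y) = ac_coord b x + ac_coord b y"
  by (simp add: ac_coord_def ac.representation_add ac_basis)

lemma ac_coord_scale: "ac_coord b (to_ac c * x) = c * ac_coord b x"
  by (simp add: ac_coord_def ac.representation_scale ac_basis)

lemma ac_coord_0 [simp]: "ac_coord b 0 = 0"
  by (simp add: ac_coord_def ac.representation_zero)

lemma ac_coord_finite: "finite {b. ac_coord b x \<noteq> 0}"
  unfolding ac_coord_def by (rule ac.finite_representation)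

lemma ac_coord_sum:
  assumes "finite S" "{b. ac_coord b x \<noteq> 0} \<subseteq> S"
  shows "(\<Sum>b\<in>S. to_ac (ac_coord b x) * b) = x"
proof -
  have "(\<Sum>b\<in>S. to_ac (ac_coord b x) * b) = (\<Sum>b | ac_coord b x \<noteq> 0. to_ac (ac_coord b x) * b)"
    using assms by (intro sum.mono_neutral_right) auto
  also have "\<dots> = x"
    unfolding ac_coord_def by (rule ac.sum_nonzero_representation_eq) (simp_all add: ac_basis)
  finally show ?thesis .
qed

lemma ac_coord_eq_0: "(\<And>b. ac_coord b x = 0) \<Longrightarrow> x = 0"
  using ac_coord_sum[of "{}" x] by simp

lemma cmap_coord_ext_mult: "cmap (ac_coord b) (ext q * p) = q * cmap (ac_coord b) p"
proof -
  have "cmap (ac_coord b) (ext q * p) = cmap (\<lambda>x. x) q * cmap (ac_coord b) p"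
    by (rule cmap_mult) (simp_all add: ac_coord_add ac_coord_scale)
  moreover have "cmap (\<lambda>x. x) q = q" by (rule poly_mapping_eqI) (simp add: lookup_cmap)
  ultimately show ?thesis by simp
qed

lemma ext_mult: "ext (p * q) = ext p * ext q"
proof -
  have "cmap to_ac (cmap (\<lambda>x. x) p * q) = ext p * ext q"
    by (rule cmap_mult) simp_all
  moreover have "cmap (\<lambda>x. x) p = p" by (rule poly_mapping_eqI) (simp add: lookup_cmap)
  ultimately show ?thesis by simp
qed

lemma ext_hpart: "p \<in> hpart d \<Longrightarrow> ext p \<in> hpart d"
  by (rule cmap_hpart) simp

lemma lookup_smult: "lookup (smult c p) m = c * lookup p m"
  using lookup_single_mult[of 0 c p m] by (simp add: smult_def)

lemma poly_coord_sum:
  obtains S where "finite S" "p = (\<Sum>b\<in>S. smult b (ext (cmap (ac_coord b) p)))"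
proof -
  define S where "S = (\<Union>m\<in>keys p. {b. ac_coord b (lookup p m) \<noteq> 0})"
  have fin: "finite S" unfolding S_def by (intro finite_UN_I finite_keys ac_coord_finite)
  have "lookup p m = lookup (\<Sum>b\<in>S. smult b (ext (cmap (ac_coord b) p))) m" for m
  proof -
    have "{b. ac_coord b (lookup p m) \<noteq> 0} \<subseteq> S"
      by (cases "m \<in> keys p") (auto simp: S_def in_keys_iff)
    from ac_coord_sum[OF fin this] show ?thesis
      by (simp add: lookup_sum lookup_smult lookup_cmap mult.commute)
  qed
  then have "p = (\<Sum>b\<in>S. smult b (ext (cmap (ac_coord b) p)))" by (rule poly_mapping_eqI)
  with fin show ?thesis by (rule that)
qed

lemma gspan_coord:
  assumes "p \<in> gr.gspan (\<lambda>i. ext (F i)) n e d"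
  shows "cmap (ac_coord b) p \<in> gr.gspan F n e d"
proof -
  obtain v where v: "\<And>j. v j \<in> hpart (d - e)" "p = (\<Sum>j<n. v j * ext (F j))" using assms by (rule gr.gspanE) auto
  have "cmap (ac_coord b) (v j * ext (F j)) = cmap (ac_coord b) (v j) * F j" for j
    using cmap_coord_ext_mult[of b "F j" "v j"] by (simp add: mult.commute)
  then have "cmap (ac_coord b) p = (\<Sum>j<n. cmap (ac_coord b) (v j) * F j)"
    unfolding v(2) by (subst cmap_sum) (simp_all add: ac_coord_add)
  also have "\<dots> \<in> gr.gspan F n e d" by (intro gr.gspanI cmap_hpart v) simp
  finally show ?thesis .
qed

lemma gspan_ext:
  assumes "p \<in> gr.gspan F n e d"
  shows "ext p \<in> gr.gspan (\<lambda>i. ext (F i)) n e d"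
proof -
  obtain v where v: "\<And>j. v j \<in> hpart (d - e)" "p = (\<Sum>j<n. v j * F j)" using assms by (rule gr.gspanE) auto
  have "ext p = (\<Sum>j<n. ext (v j) * ext (F j))"
    unfolding v(2) by (subst cmap_sum) (simp_all add: ext_mult)
  also have "\<dots> \<in> gr.gspan (\<lambda>i. ext (F i)) n e d" by (intro gr.gspanI ext_hpart v)
  finally show ?thesis .
qed

text \<open>This is flatness of the field extension: a relation over the closure is split into
  coordinates, regularity applies to each of them, and the pieces are recombined with basis elements
  as scalars.\<close>

lemma gregular_ext:
  fixes F :: "nat \<Rightarrow> ('x, 'k::field) mpoly"
  assumes F: "gr.gregular F n e"
  shows "gr.gregular (\<lambda>i. ext (F i)) n e"
  unfolding gr.gregular_def
proof (intro conjI allI impI ballI)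
  show "ext (F i) \<in> hpart e" if "i < n" for i using gr.gregular_H[OF F that] by (rule ext_hpart)
  fix i d and p :: "('x, 'k alg_closure) mpoly"
  assume i: "i < n" and p: "p \<in> hpart d" and mem: "ext (F i) * p \<in> gr.gspan (\<lambda>i. ext (F i)) i e (d + e)"
  obtain S where S: "finite S" "p = (\<Sum>b\<in>S. smult b (ext (cmap (ac_coord b) p)))" by (rule poly_coord_sum)
  have "cmap (ac_coord b) p \<in> gr.gspan F i e d" for b
    using gspan_coord[OF mem, of b] gr.gregularD[OF F i cmap_hpart[OF _ p]] by (simp add: cmap_coord_ext_mult)
  then have "(\<Sum>b\<in>S. smult b (ext (cmap (ac_coord b) p))) \<in> gr.gspan (\<lambda>i. ext (F i)) i e d"
    by (intro mpoly.subspace_sum[OF gspan_subspace] mpoly.subspace_scale[OF gspan_subspace] gspan_ext)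
  then show "p \<in> gr.gspan (\<lambda>i. ext (F i)) i e d" unfolding S(2)[symmetric] .
qed

lemma cmap_coord_smult_ext: "cmap (ac_coord b) (smult s (ext g)) = smult (ac_coord b s) g"
proof -
  have "cmap (ac_coord b) (smult s (ext g)) = cmap (ac_coord b) (ext g * single 0 s)"
    by (simp add: smult_def mult.commute)
  also have "\<dots> = smult (ac_coord b s) g"
    unfolding cmap_coord_ext_mult by (simp add: cmap_single smult_def mult.commute)
  finally show ?thesis .
qed

lemma ext_Var: "ext (Var i) = Var i"
  unfolding Var_def by (subst cmap_single) simp_all

text \<open>A basis over the base field spans the extended space, so a lower bound over the closure
  descends. In degree \<open>e + 1\<close> the coefficients are linear forms, combinations of
  variables, and these are fixed by \<open>ext\<close>.\<close>

lemma dim_gspan_ext: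
  fixes F :: "nat \<Rightarrow> 'k::field poly6"
  assumes F: "\<And>i. i < n \<Longrightarrow> F i \<in> hpart e"
  shows "mpoly.dim (gr.gspan (\<lambda>i. ext (F i)) n e (e + 1)) \<le> mpoly.dim (gr.gspan F n e (e + 1))"
proof -
  obtain G where G: "finite G" "hpart (e + 1) \<subseteq> mpoly.span (G :: 'k poly6 set)" by (rule hpart_finite_span)
  have "gr.gspan F n e (e + 1) \<subseteq> mpoly.span G" using gr.gspan_H[of n F e] F G by blast
  from mpoly.subspace_basis[OF gspan_subspace this G(1)] obtain B where
    B: "finite B" "mpoly.span B = gr.gspan F n e (e + 1)" "card B = mpoly.dim (gr.gspan F n e (e + 1))" by metis
  have ext_B: "ext y \<in> mpoly.span (ext ` B)" if y: "y \<in> gr.gspan F n e (e + 1)" for y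
  proof -
    obtain t r where t: "finite t" "t \<subseteq> B" "y = (\<Sum>b\<in>t. smult (r b) b)"
      using y unfolding B(2)[symmetric] mpoly.span_explicit by blast
    have "ext y = (\<Sum>b\<in>t. ext (smult (r b) b))" unfolding t(3) by (subst cmap_sum) simp_all
    also have "\<dots> = (\<Sum>b\<in>t. smult (to_ac (r b)) (ext b))" by (simp add: smult_def ext_mult cmap_single)
    also have "\<dots> \<in> mpoly.span (ext ` B)" using t(2) by (intro mpoly.span_sum mpoly.span_scale mpoly.span_base) auto
    finally show ?thesis .
  qed
  have "gr.gspan (\<lambda>i. ext (F i)) n e (e + 1) \<subseteq> mpoly.span (ext ` B)"
  proof
    fix x assume "x \<in> gr.gspan (\<lambda>i. ext (F i)) n e (e + 1)"
    then obtain v where v: "\<And>j. v j \<in> hpart 1" "x = (\<Sum>j<n. v j * ext (F j))" by (rule gr.gspanE) auto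
    have "v j * ext (F j) \<in> mpoly.span (ext ` B)" if j: "j < n" for j
    proof -
      have "v j \<in> mpoly.span (var6 ` {..<6})" using v(1) by (simp add: hpart_1_eq_span)
      then obtain c where c: "v j = (\<Sum>i<6. smult (c i) (var6 i))" unfolding mpoly.span_family by blast
      have "v j * ext (F j) = (\<Sum>i<6. smult (c i) (ext (var6 i * F j)))"
        unfolding c by (simp add: sum_distrib_right smult_mult_left ext_mult ext_Var)
      also have "\<dots> \<in> mpoly.span (ext ` B)"
        using j by (intro mpoly.span_sum mpoly.span_scale ext_B gr.gspan_gen) auto
      finally show ?thesis .
    qed
    then show "x \<in> mpoly.span (ext ` B)" unfolding v(2) by (intro mpoly.span_sum) auto
  qed
  from mpoly.dim_le_card[OF this] B(1,3) card_image_le[OF B(1), of ext] show ?thesis by fastforce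
qed

lemma dim_ge_43:
  fixes F :: "nat \<Rightarrow> 'k::field poly6"
  assumes F: "gr.gregular F 6 2" and gh: "F 6 \<in> hpart 2" "F 7 \<in> hpart 2"
    and ind: "\<And>s t. smult s (F 6) + smult t (F 7) \<in> gr.gspan F 6 2 2 \<Longrightarrow> s = 0 \<and> t = 0"
  shows "43 \<le> mpoly.dim (gr.gspan F 8 2 3)"
proof -
  have "43 \<le> mpoly.dim (gr.gspan (\<lambda>i. ext (F i)) 8 2 3)"
  proof (rule dim_ge_43_alg_closed[OF gregular_ext[OF F]])
    show "ext (F 6) \<in> hpart 2" "ext (F 7) \<in> hpart 2" using gh by (auto intro: ext_hpart)
    fix s t assume st: "smult s (ext (F 6)) + smult t (ext (F 7)) \<in> gr.gspan (\<lambda>i. ext (F i)) 6 2 2"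
    have "ac_coord b s = 0 \<and> ac_coord b t = 0" for b
    proof -
      have "cmap (ac_coord b) (smult s (ext (F 6)) + smult t (ext (F 7))) \<in> gr.gspan F 6 2 2"
        by (rule gspan_coord[OF st])
      then show ?thesis
        by (subst (asm) cmap_add) (auto simp: ac_coord_add cmap_coord_smult_ext dest: ind)
    qed
    then show "s = 0 \<and> t = 0" using ac_coord_eq_0 by blast
  qed
  moreover have "F i \<in> hpart 2" if i8: "i < 8" for i
  proof -
    consider "i < 6" | "i = 6" | "i = 7" using i8 by linarith
    then show ?thesis using gh gr.gregular_H[OF F] by cases auto
  qed
  ultimately show ?thesis using dim_gspan_ext[of 8 F 2] by fastforce
qed

section \<open>The monomial ideal\<close>

lemma dim_span_monomials:
  fixes A :: "('x \<Rightarrow>\<^sub>0 nat) set"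
  assumes "finite A"
  shows "mpoly.dim (mpoly.span ((\<lambda>m. single m (1 :: 'k::field)) ` A)) = card A"
proof -
  let ?s = "\<lambda>m. single m (1 :: 'k)"
  have inj: "inj_on ?s A"
  proof (rule inj_onI)
    fix m n assume "?s m = ?s n"
    then have "lookup (?s m) n = 1" by simp
    then show "m = n" by (auto simp: lookup_single when_def split: if_splits)
  qed
  have "mpoly.independent (?s ` A)"
  proof (rule mpoly.independent_if_scalars_zero)
    fix f x assume 0: "(\<Sum>x\<in>?s ` A. smult (f x) x) = 0" and x: "x \<in> ?s ` A"
    from x obtain m where m: "m \<in> A" "x = ?s m" by blast
    have "0 = lookup (\<Sum>n\<in>A. smult (f (?s n)) (?s n)) m"
      using 0 by (simp add: sum.reindex[OF inj])
    also have "\<dots> = (\<Sum>n\<in>A. if n = m then f (?s m) else 0)"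
      by (auto simp: lookup_sum lookup_smult lookup_single when_def intro!: sum.cong)
    finally show "f x = 0" using m assms by simp
  qed (use assms in simp)
  then show ?thesis using mpoly.dim_span_eq_card_independent card_image[OF inj] by metis
qed

text \<open>Monomials are encoded as exponent lists indexed by the indeterminates \<open>0, \<dots>, 5\<close>, so
  that the number of monomials in the ideal can be computed.\<close>

definition gen_exps :: "nat \<Rightarrow> nat list" where
  "gen_exps j = (if j < 6 then (replicate 6 0)[j := 2]
     else if j = 6 then [0, 1, 1, 0, 0, 0] else [0, 1, 0, 1, 0, 0])"

definition prod_exps :: "nat list list" where
  "prod_exps = [(gen_exps j)[i := Suc (gen_exps j ! i)]. i \<leftarrow> [0..<6], j \<leftarrow> [0..<8]]"

text \<open>Of the 48 products of a variable and a generator, five are repetitions: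
  \<open>x1 x1 x2\<close>, \<open>x1 x2 x2\<close>, \<open>x1 x1 x3\<close> and
  \<open>x1 x3 x3\<close> also arise from squares, and \<open>x1 x2 x3\<close> arises from both
  mixed generators.\<close>

lemma card_prod_exps: "card (set prod_exps) = 43"
proof -
  have "length (remdups prod_exps) = 43" by code_simp
  then show ?thesis by (simp add: length_remdups_card_conv)
qed

definition mono_of :: "nat list \<Rightarrow> 6 \<Rightarrow>\<^sub>0 nat" where
  "mono_of xs = (\<Sum>i<6. single (of_nat i) (xs ! i))"

lemma of_nat_6_eq_iff: "i < 6 \<Longrightarrow> j < 6 \<Longrightarrow> (of_nat i :: 6) = of_nat j \<longleftrightarrow> i = j"
  using inj_of_nat_6 by (auto simp: inj_on_def)

lemma lookup_mono_of: "j < 6 \<Longrightarrow> lookup (mono_of xs) (of_nat j) = xs ! j"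
proof -
  assume j: "j < 6"
  have "lookup (mono_of xs) (of_nat j) = (\<Sum>i<6. if i = j then xs ! j else 0)"
    unfolding mono_of_def using j
    by (auto simp: lookup_sum lookup_single when_def of_nat_6_eq_iff intro!: sum.cong)
  then show ?thesis using j by simp
qed

lemma poly_mapping_6_eqI:
  assumes "\<And>j. j < 6 \<Longrightarrow> lookup m (of_nat j :: 6) = lookup n (of_nat j)"
  shows "m = n"
proof (rule poly_mapping_eqI)
  fix k :: 6
  have "k \<in> of_nat ` {..<6}" using range_of_nat_6 by simp
  then show "lookup m k = lookup n k" using assms by auto
qed

definition mono_gens :: "nat \<Rightarrow> 'k::field poly6" where
  "mono_gens j = single (mono_of (gen_exps j)) 1"

lemma length_gen_exps: "length (gen_exps j) = 6"
  by (simp add: gen_exps_def)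

lemma var6_mult_mono:
  assumes "i < 6" "length xs = 6"
  shows "var6 i * single (mono_of xs) 1 =
    (single (mono_of (xs[i := Suc (xs ! i)])) 1 :: 'k::field poly6)"
proof -
  have "single (of_nat i) 1 + mono_of xs = mono_of (xs[i := Suc (xs ! i)])"
    by (rule poly_mapping_6_eqI)
      (use assms in \<open>auto simp: lookup_add lookup_mono_of lookup_single when_def of_nat_6_eq_iff nth_list_update\<close>)
  then show ?thesis by (simp add: Var_def mult_single)
qed

lemma mono_gens_image:
  "range (\<lambda>i. (Var i :: 'k::field poly6)\<^sup>2) \<union> {Var 1 * Var 2, Var 1 * Var 3} = mono_gens ` {..<8}"
proof -
  have sq: "(var6 j)\<^sup>2 = (mono_gens j :: 'k poly6)" if j: "j < 6" for j
  proof -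
    have "single (of_nat j) 1 + single (of_nat j) 1 = mono_of (gen_exps j)"
      by (rule poly_mapping_6_eqI)
        (use j in \<open>auto simp: gen_exps_def lookup_add lookup_mono_of lookup_single when_def of_nat_6_eq_iff nth_list_update\<close>)
    then show ?thesis by (simp add: mono_gens_def Var_def power2_eq_square mult_single)
  qed
  have pr: "var6 a * var6 b = (mono_gens j :: 'k poly6)"
    if "a < 6" "b < 6" "\<And>k. k < 6 \<Longrightarrow> gen_exps j ! k = (if k = a then 1 else 0) + (if k = b then 1 else 0)" for a b j
  proof -
    have "single (of_nat a) 1 + single (of_nat b) 1 = mono_of (gen_exps j)"
      by (rule poly_mapping_6_eqI)
        (use that in \<open>auto simp: lookup_add lookup_mono_of lookup_single when_def of_nat_6_eq_iff\<close>)
    then show ?thesis by (simp add: mono_gens_def Var_def mult_single)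
  qed
  have p12: "Var 1 * Var 2 = (mono_gens 6 :: 'k poly6)" and p13: "Var 1 * Var 3 = (mono_gens 7 :: 'k poly6)"
  proof -
    have "gen_exps 6 ! k = (if k = 1 then 1 else 0) + (if k = 2 then 1 else 0)"
      "gen_exps 7 ! k = (if k = 1 then 1 else 0) + (if k = 3 then 1 else 0)" if "k < 6" for k
      using that by (auto simp: gen_exps_def numeral_eq_Suc less_Suc_eq)
    from pr[OF _ _ this(1)] pr[OF _ _ this(2)]
    show "Var 1 * Var 2 = (mono_gens 6 :: 'k poly6)" "Var 1 * Var 3 = (mono_gens 7 :: 'k poly6)" by simp_all
  qed
  have "range (\<lambda>i. (Var i :: 'k poly6)\<^sup>2) = (\<lambda>j. (var6 j)\<^sup>2) ` {..<6}"
    unfolding range_of_nat_6[symmetric] by (simp add: image_image)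
  also have "\<dots> = mono_gens ` {..<6}" by (intro image_cong) (auto simp: sq)
  finally have *: "range (\<lambda>i. (Var i :: 'k poly6)\<^sup>2) = mono_gens ` {..<6}" .
  have "{..<8} = {..<6} \<union> {6, 7 :: nat}" by auto
  then show ?thesis unfolding * p12 p13 by (simp add: image_Un)
qed

lemma mdeg_sum: "mdeg (sum f A) = (\<Sum>i\<in>A. mdeg (f i))"
  by (induction A rule: infinite_finite_induct) (simp_all add: mdeg_add)

lemma mono_gens_hpart: "j < 8 \<Longrightarrow> mono_gens j \<in> hpart 2"
proof -
  assume "j < 8"
  then consider "j < 6" | "j = 6" | "j = 7" by linarith
  then have "(\<Sum>i<6. gen_exps j ! i) = 2"
    by cases (auto simp: gen_exps_def numeral_eq_Suc less_Suc_eq)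
  moreover have "mdeg (mono_of xs) = (\<Sum>i<6. xs ! i)" for xs
    by (simp add: mono_of_def mdeg_sum)
  ultimately show ?thesis unfolding mono_gens_def by (intro single_hpart) simp
qed

lemma gspan_eq_span_products:
  fixes F :: "nat \<Rightarrow> 'k::field poly6"
  shows "gr.gspan F n e (e + 1) = mpoly.span {var6 i * F j | i j. i < 6 \<and> j < n}"
proof
  show "gr.gspan F n e (e + 1) \<subseteq> mpoly.span {var6 i * F j | i j. i < 6 \<and> j < n}"
  proof
    fix x assume "x \<in> gr.gspan F n e (e + 1)"
    then obtain v where v: "\<And>j. v j \<in> hpart 1" "x = (\<Sum>j<n. v j * F j)" by (rule gr.gspanE) auto
    have "v j * F j \<in> mpoly.span {var6 i * F j | i j. i < 6 \<and> j < n}" if j: "j < n" for j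
    proof -
      have "v j \<in> mpoly.span (var6 ` {..<6})" using v(1) by (simp add: hpart_1_eq_span)
      then obtain c where c: "v j = (\<Sum>i<6. smult (c i) (var6 i))" unfolding mpoly.span_family by blast
      have "v j * F j = (\<Sum>i<6. smult (c i) (var6 i * F j))"
        unfolding c by (simp add: sum_distrib_right smult_mult_left)
      also have "\<dots> \<in> mpoly.span {var6 i * F j | i j. i < 6 \<and> j < n}"
        using j by (intro mpoly.span_sum mpoly.span_scale mpoly.span_base) auto
      finally show ?thesis .
    qed
    then show "x \<in> mpoly.span {var6 i * F j | i j. i < 6 \<and> j < n}" unfolding v(2) by (intro mpoly.span_sum) auto
  qed
  show "mpoly.span {var6 i * F j | i j. i < 6 \<and> j < n} \<subseteq> gr.gspan F n e (e + 1)"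
    by (intro mpoly.span_minimal gspan_subspace) (auto intro: gr.gspan_gen)
qed

lemma dim_monomial_ideal:
  "mpoly.dim (ideal_gen (range (\<lambda>i. (Var i :: 'k::field poly6)\<^sup>2) \<union> {Var 1 * Var 2, Var 1 * Var 3})
     \<inter> homogeneous_part 3) = 43"
proof -
  have eq: "{var6 i * mono_gens j | i j. i < 6 \<and> j < (8::nat)} =
      (\<lambda>m. single m (1::'k)) ` mono_of ` set prod_exps"
    unfolding prod_exps_def mono_gens_def image_image
    by (force simp: var6_mult_mono length_gen_exps)
  have card: "card (mono_of ` set prod_exps) = 43"
  proof -
    have len: "length xs = 6" if "xs \<in> set prod_exps" for xs
      using that by (auto simp: prod_exps_def length_gen_exps)
    have "inj_on mono_of (set prod_exps)"
    proof (rule inj_onI)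
      fix xs ys assume xy: "xs \<in> set prod_exps" "ys \<in> set prod_exps" "mono_of xs = mono_of ys"
      then show "xs = ys" using lookup_mono_of[of _ xs] lookup_mono_of[of _ ys] len
        by (intro nth_equalityI) auto
    qed
    then show ?thesis using card_image card_prod_exps by metis
  qed
  have "gr.gspan mono_gens 8 2 3 = mpoly.span ({var6 i * mono_gens j | i j. i < 6 \<and> j < 8} :: 'k poly6 set)"
    using gspan_eq_span_products[of mono_gens 8 2] by simp
  then have "mpoly.dim (gr.gspan (mono_gens :: nat \<Rightarrow> 'k poly6) 8 2 3) = 43"
    unfolding eq by (simp only: dim_span_monomials card finite_imageI finite_set)
  then show ?thesis
    unfolding mono_gens_image homogeneous_part_eq_hpart
    by (subst ideal_gen_hpart[OF mono_gens_hpart]) auto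
qed

theorem theorem4p2:
  fixes fs :: "'k::field poly6 list" and g h :: "'k poly6"
  assumes "length fs = 6"
    and "set fs \<subseteq> homogeneous_part 2"
    and "regular_sequence fs"
    and "g \<in> homogeneous_part 2" and "h \<in> homogeneous_part 2"
    and "mpoly.dim (ideal_gen (set fs \<union> {g, h}) \<inter> homogeneous_part 2) = 8"
  shows "mpoly.dim (ideal_gen (set fs \<union> {g, h}) \<inter> homogeneous_part 3)
           \<ge> mpoly.dim (ideal_gen (range (\<lambda>i. (Var i :: 'k poly6)\<^sup>2) \<union> {Var 1 * Var 2, Var 1 * Var 3})
               \<inter> homogeneous_part 3)
       \<and> mpoly.dim (ideal_gen (range (\<lambda>i. (Var i :: 'k poly6)\<^sup>2) \<union> {Var 1 * Var 2, Var 1 * Var 3})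
               \<inter> homogeneous_part 3) = 43"
proof -
  define F where "F = (!) (fs @ [g, h])"
  have Ffs: "F i = fs ! i" if "i < 6" for i using that assms(1) by (simp add: F_def nth_append)
  have F67: "F 6 = g" "F 7 = h" using assms(1) by (simp_all add: F_def nth_append)
  have e8: "{..<8} = {..<6} \<union> {6, 7 :: nat}" by auto
  have set_fs: "F ` {..<6} = set fs"
  proof -
    have "F ` {..<6} = (!) fs ` {..<6}" by (intro image_cong) (auto simp: Ffs)
    also have "\<dots> = set fs" using assms(1) nth_image[of 6 fs] by (simp add: lessThan_atLeast0)
    finally show ?thesis .
  qed
  have gens: "set fs \<union> {g, h} = F ` {..<8}" unfolding e8 by (simp add: image_Un set_fs F67)
  have FH: "F j \<in> hpart 2" if "j < 8" for j
  proof -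
    have "F j \<in> set fs \<union> {g, h}" unfolding gens using that by blast
    then show ?thesis using assms(2,4,5) by (auto simp: homogeneous_part_eq_hpart)
  qed
  have ideal: "ideal_gen (set fs \<union> {g, h}) \<inter> homogeneous_part t = gr.gspan F 8 2 (int t)" for t
    unfolding gens homogeneous_part_eq_hpart by (rule ideal_gen_hpart[OF FH])
  have reg: "gr.gregular F 6 2"
  proof -
    have "gr.gregular ((!) fs) 6 2"
      using regular_sequence_gregular[OF assms(3), of 2] assms(1,2) by (simp add: homogeneous_part_eq_hpart)
    moreover have "gr.gspan F i 2 d = gr.gspan ((!) fs) i 2 d" if "i \<le> 6" for i d
      using that by (auto simp: gr.gspan_def Ffs)
    ultimately show ?thesis unfolding gr.gregular_def by (auto simp: Ffs)
  qed
  have "gr.gspan F 8 2 2 = mpoly.span (set fs \<union> {g, h})" unfolding gens by (rule gspan_eq_span)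
  then have dim8: "mpoly.dim (mpoly.span (set fs \<union> {g, h})) = 8"
    using assms(6) unfolding ideal by simp
  \<comment> \<open>If \<open>g\<close> and \<open>h\<close> were dependent modulo the span of
    \<open>fs\<close>, seven quadrics would span a space of dimension 8. In this way the dimension
    hypothesis becomes independence of the pencil modulo the ideal.\<close>
  have card7: "\<not> mpoly.span (set fs \<union> {g, h}) \<subseteq> mpoly.span (insert x (set fs))" for x
  proof
    assume "mpoly.span (set fs \<union> {g, h}) \<subseteq> mpoly.span (insert x (set fs))"
    from mpoly.dim_le_card[OF this] have "8 \<le> card (insert x (set fs))" unfolding dim8 by simp
    also have "\<dots> \<le> Suc (card (set fs))" by (simp add: card_insert_if)
    also have "\<dots> \<le> 7" using card_length[of fs] assms(1) by simp
    finally show False by simp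
  qed
  have ind: "s = 0 \<and> t = 0" if st: "smult s (F 6) + smult t (F 7) \<in> gr.gspan F 6 2 2" for s t
  proof (rule ccontr)
    assume not: "\<not> (s = 0 \<and> t = 0)"
    have mem: "smult s g + smult t h \<in> mpoly.span (set fs)"
      using st unfolding F67 gspan_eq_span set_fs .
    have sp: "y \<in> mpoly.span (insert x (set fs))"
      if *: "smult a x + smult b y \<in> mpoly.span (set fs)" "b \<noteq> 0" for x y a b
    proof -
      have "smult a x + smult b y \<in> mpoly.span (insert x (set fs))"
        using *(1) mpoly.span_mono[of "set fs" "insert x (set fs)"] by blast
      moreover have "smult a x \<in> mpoly.span (insert x (set fs))" by (intro mpoly.span_scale mpoly.span_base) simp
      ultimately have "smult b y \<in> mpoly.span (insert x (set fs))" by (simp add: mpoly.span_add_eq)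
      then have "smult (1 / b) (smult b y) \<in> mpoly.span (insert x (set fs))" by (rule mpoly.span_scale)
      then show ?thesis using *(2) by simp
    qed
    have sub: "mpoly.span (set fs \<union> {g, h}) \<subseteq> mpoly.span (insert x (set fs))"
      if "{x, y} = {g, h}" "y \<in> mpoly.span (insert x (set fs))" for x y
    proof (rule mpoly.span_minimal)
      have "set fs \<union> {g, h} = insert y (insert x (set fs))" using that(1) by blast
      then show "set fs \<union> {g, h} \<subseteq> mpoly.span (insert x (set fs))"
        using that(2) mpoly.span_superset[of "insert x (set fs)"] by simp
    qed simp
    show False
    proof (cases "t = 0")
      case False
      from sp[OF mem False] show False using sub[of g h] card7 by blast
    next
      case True
      then have s: "s \<noteq> 0" using not by simp
      have "smult t h + smult s g \<in> mpoly.span (set fs)" using mem by (simp add: add.commute)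
      from sp[OF this s] show False using sub[of h g] card7 by blast
    qed
  qed
  have "43 \<le> mpoly.dim (gr.gspan F 8 2 3)"
    by (rule dim_ge_43[OF reg _ _ ind]) (use FH in auto)
  then show ?thesis unfolding dim_monomial_ideal ideal by simp
qed

end
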